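(* Let $\Omega\subset Q^\pi_m$ be generic, $\Lambda=\{(t,x_t):t\in\mathbb{R}_+,x\in\Omega\}$, and let $\Sigma:\Lambda\to S_m^+$ be right-continuous, where $S_m^+$ is the set of positive-definite symmetric $m\times m$ matrices. If $F\in C^{1,2}(\Lambda)$ is $\Sigma$-harmonic, then there exists a class $\mathcal{M}$ functional $M\in\mathcal{M}(\Lambda)$ such that $M|_{\Omega_\Sigma}\equiv F$, i.e. $M(t,x_t)=F(t,x_t)$ for all $t\ge0$ and $x\in\Omega_\Sigma$. In particular, $M$ is uniquely determined on $\Omega_\Sigma$ by $$M(t,x_t)=F(t,x_t)=F(0,x_0)+\int_0^t\nabla_xF(s,x_{s-})\,dx,\qquad t\ge0,\ x\in\Omega_\Sigma .$$
   Context: $\Omega_\Sigma:=\{x\in\Omega: \frac{d[x]}{dt}=\Sigma\}$ is the set of paths $x\in\Omega$ whose quadratic variation $[x]$ is absolutely continuous with Lebesgue density $t\mapsto\Sigma(t,x_t)$. $F\in C^{1,2}(\Lambda)$ is $\Sigma$-harmonic if for all $x\in\Omega_\Sigma$ and $t\ge0$: $\mathcal{D}F(t,x_t)+\frac12\langle\nabla_x^2F(t,x_t),\Sigma(t,x_t)\rangle=0$ ($\langle\cdot,\cdot\rangle$ is the Frobenius inner product). The integral is $\int_0^t\nabla_xF(s,x_{s-})\,dx:=\lim_n\sum_{\pi_n\ni t_i\le t}\nabla_xF(t_i,x^n_{t_i-})\cdot(x(t_{i+1})-x(t_i))$, which exists for $F\in C^{1,2}(\Lambda)$ and $x\in\Omega$.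 Partitions: $\pi=(\pi_n)_{n\ge1}$ is a fixed sequence of partitions $\pi_n=(0=t^n_0<\dots<t^n_{k_n}<\infty)$ of $[0,\infty)$ with $t^n_{k_n}\to\infty$ and mesh vanishing on compacts; the superscript $n$ is dropped and sums involving $t_{i+1}$ run over $i<k_n$. Paths: $D_m$ is the space of càdlàg functions $[0,\infty)\to\mathbb{R}^m$, $x(0-):=x(0)$, $\Delta x(t):=x(t)-x(t-)$; $x_t(s):=x(s\wedge t)$, $x_{t-}(s):=x(s)1_{s<t}+x(t-)1_{s\ge t}$. $x^n:=\sum_{t_i\in\pi_n}x(t_{i+1})1_{[t_i,t_{i+1})}$, and $x^n_t,x^n_{t-}$ are the stopped versions of $x^n$. $Q^\pi_m$ is the set of $x\in D_m$ for which $q_n(t):=\sum_{\pi_n\ni t_i\le t}(x(t_{i+1})-x(t_i))(x(t_{i+1})-x(t_i))'$ converges in the Skorokhod $J_1$ topology; the limit is $[x]$. Generic sets: a nonempty $\Omega\subset D_m$ is generic if (i) for every $x\in\Omega$, $T>0$ there is $N=N_T(x)$ with $x^n_T\in\Omega$ for all $n\ge N$; (ii) for every $x\in\Omega$, $t\ge0$ there is a convex neighbourhood $\mathcal{U}$ of $0$ in $\mathbb{R}^m$ with $-\Delta x(t)\in\mathcal{U}$ and $x_t+e1_{[t,\infty)}\in\Omega$ for all $e\in\mathcal{U}$. Consequently, at each $(t,x)$ one fixes a convex neighbourhood $\mathcal{U}_{t-}(x)$ of $0$ containing $\Delta x(t)$ with $x_{t-}+e1_{[t,\infty)}\in\Omega$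 for all $e\in\mathcal{U}_{t-}(x)$. Continuity of functionals $F$ on $\Lambda$: let $t'_n:=\max\{t_i<t:t_i\in\pi_n\}$ (and $0$ if there is no such $t_i$). $F$ is left-continuous if for all $(t,x_t)\in\Lambda$ ($x\in\Omega$): 1(a) $\lim_{s\uparrow t,\,s\le t}F(s,x_{s-})=F(t,x_{t-})$; 1(b) $\lim_{s\uparrow t,\,s<t}F(s,x_s)=F(t,x_{t-})$; 1(c) $t_n\to t$, $t_n\le t'_n$ implies $F(t_n,x^n_{t_n-})\to F(t,x_{t-})$; 1(d) $t_n\to t$, $t_n<t'_n$ implies $F(t_n,x^n_{t_n})\to F(t,x_{t-})$. $F$ is right-continuous if for all such $(t,x_t)$: 2(a) $\lim_{s\downarrow t,\,s\ge t}F(s,x_s)=F(t,x_t)$; 2(b) $\lim_{s\downarrow t,\,s>t}F(s,x_{s-})=F(t,x_t)$; 2(c) $t_n\to t$, $t_n\ge t'_n$ implies $F(t_n,x^n_{t_n})\to F(t,x_t)$; 2(d) $t_n\to t$, $t_n>t'_n$ implies $F(t_n,x^n_{t_n-})\to F(t,x_t)$. $F$ is continuous if it is both left- and right-continuous. Vector- and matrix-valued functionals: componentwise. Notation: $F_-(t,x_t):=F(t,x_{t-})$; $F$ is strictly causal if $F=F_-$. Derivatives: $\mathcal{D}F(t,x_t):=\lim_{h\downarrow0}\frac{F(t+h,x_t)-F(t,x_t)}{h}$; $\nabla_xF(t,x_t)$ is the gradient at $e=0$ of $e\mapsto F(t,x_t+e1_{[t,\infty)})$; $\nabla_x^2F$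 is the vertical derivative of $\nabla_xF$. $F$ is differentiable if $\mathcal{D}F$ and $\nabla_xF$ exist on $\Lambda$. $F$ is locally bounded if for every $x\in\Omega$, $T\ge0$ there is $n_0\ge N_T(x)$ such that the family $(t\mapsto F(t,x^n_t))_{n\ge n_0}$ is bounded on $[0,T]$ uniformly in $n\ge n_0$. $F$ admits a modulus of vertical continuity if for every $x\in\Omega$, $T\ge0$, $r>0$ there is an increasing $\omega:\mathbb{R}_+\to\mathbb{R}_+$ with $\omega(0+)=0$ and $|F(t,x^n_{t-}+a1_{[t,\infty)})-F(t,x^n_{t-}+b1_{[t,\infty)})|\le\omega(|a-b|)$ for all $a,b\in\mathcal{U}_{t-}(x^n)\cap\overline{B}_r(0)$, $t\le T$ and all sufficiently large $n$. $C^{1,2}(\Lambda)$: continuous $F:\Lambda\to\mathbb{R}$ such that $\mathcal{D}F,\nabla_xF,\nabla_x^2F$ exist on $\Lambda$; $\mathcal{D}F$ is right-continuous and locally bounded; $(\nabla_xF)_-$ is left-continuous; $(\nabla^2_xF)_-$ is left-continuous and locally bounded, and $\nabla_x^2F$ admits a modulus of vertical continuity. Class $\mathcal{M}(\Lambda)$: continuous differentiable $F:\Lambda\to\mathbb{R}$ with $\mathcal{D}F=0$ and $\nabla_xF$ left-continuous and strictly causal. *)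

theory Defs
  imports "HOL-Analysis.Analysis"
begin

text \<open>
  A function on \<open>[0,\<infinity>)\<close> is encoded as a function on all reals that vanishes on
  \<open>(-\<infinity>,0)\<close>; this makes equality of the HOL functions equality of the paths.
  A functional on \<open>\<Lambda>\<close> is encoded as a curried function \<open>F t y\<close> of time and stopped path.
  Its values off \<open>\<Lambda>\<close> are irrelevant to every notion below.
\<close>

type_synonym 'm path = "real \<Rightarrow> real ^ 'm"

definition cadlag :: "(real \<Rightarrow> 'a::real_normed_vector) \<Rightarrow> bool" where
  "cadlag f \<longleftrightarrow>
     (\<forall>t<0. f t = 0) \<and>
     (\<forall>t\<ge>0. (f \<longlongrightarrow> f t) (at_right t)) \<and>
     (\<forall>t>0. \<exists>l. (f \<longlongrightarrow> l) (at_left t))"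

definition left_lim :: "(real \<Rightarrow> 'a::t2_space) \<Rightarrow> real \<Rightarrow> 'a" where
  "left_lim x t = (if t = 0 then x 0 else Lim (at_left t) x)"

definition jump :: "(real \<Rightarrow> 'a::real_normed_vector) \<Rightarrow> real \<Rightarrow> 'a" where
  "jump x t = x t - left_lim x t"

text \<open>The stopped paths \<open>x\<^sub>t\<close> and \<open>x\<^sub>t\<^sub>-\<close>, and \<open>y + e 1\<^bsub>[t,\<infinity>)\<^esub>\<close>.\<close>

definition stop :: "real \<Rightarrow> 'm::finite path \<Rightarrow> 'm path" where
  "stop t x = (\<lambda>s. x (min s t))"

definition stop_left :: "real \<Rightarrow> 'm::finite path \<Rightarrow> 'm path" where
  "stop_left t x = (\<lambda>s. if s < t then x s else left_lim x t)"

definition bump :: "real \<Rightarrow> real ^ 'm \<Rightarrow> 'm::finite path \<Rightarrow> 'm path" where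
  "bump t e y = (\<lambda>s. y s + indicat_real {t..} s *\<^sub>R e)"


text \<open>
  The partition \<open>\<pi>\<^sub>n = (0 = t\<^sub>0 < \<dots> < t\<^sub>k)\<close> is the list \<open>\<pi> n\<close>, so \<open>t\<^sub>i = \<pi> n ! i\<close> and
  \<open>k = length (\<pi> n) - 1\<close>. The mesh condition bounds the length of
  \<open>[t\<^sub>i, t\<^sub>i\<^sub>+\<^sub>1] \<inter> [0,T]\<close>, uniformly in \<open>i\<close>.
\<close>

definition partition_seq :: "(nat \<Rightarrow> real list) \<Rightarrow> bool" where
  "partition_seq \<pi> \<longleftrightarrow>
     (\<forall>n. \<pi> n \<noteq> [] \<and> hd (\<pi> n) = 0 \<and> sorted_wrt (<) (\<pi> n)) \<and>
     filterlim (\<lambda>n. last (\<pi> n)) at_top sequentially \<and>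
     (\<forall>T>0. \<forall>\<epsilon>>0. \<forall>\<^sub>F n in sequentially. \<forall>i < length (\<pi> n) - 1.
        min (\<pi> n ! Suc i) T - min (\<pi> n ! i) T < \<epsilon>)"

definition pw_const :: "(nat \<Rightarrow> real list) \<Rightarrow> nat \<Rightarrow> 'm::finite path \<Rightarrow> 'm path" where
  "pw_const \<pi> n x = (\<lambda>s. \<Sum>i < length (\<pi> n) - 1.
     indicat_real {\<pi> n ! i ..< \<pi> n ! Suc i} s *\<^sub>R x (\<pi> n ! Suc i))"

text \<open>\<open>t'\<^sub>n\<close>: since partition points are nonnegative, inserting \<open>0\<close> only matters
  when no partition point lies strictly before \<open>t\<close>.\<close>

definition last_before :: "(nat \<Rightarrow> real list) \<Rightarrow> nat \<Rightarrow> real \<Rightarrow> real" where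
  "last_before \<pi> n t = Max (insert 0 {s \<in> set (\<pi> n). s < t})"


text \<open>
  Convergence in the Skorokhod \<open>J\<^sub>1\<close> topology on cadlag functions on \<open>[0,\<infinity>)\<close>, in terms of
  time changes (Billingsley, Theorem 16.1; Jacod-Shiryaev, Theorem VI.1.14). The topology is
  Hausdorff, so the limit \<open>quad_var\<close> is unique whenever it exists.
\<close>

definition time_changes :: "(real \<Rightarrow> real) set" where
  "time_changes = {l. strict_mono_on {0..} l \<and> continuous_on {0..} l \<and> l ` {0..} = {0..}}"

definition J1_lim ::
  "(nat \<Rightarrow> real \<Rightarrow> 'a::real_normed_vector) \<Rightarrow> (real \<Rightarrow> 'a) \<Rightarrow> bool" where
  "J1_lim f g \<longleftrightarrow> cadlag g \<and>
     (\<exists>l. (\<forall>n. l n \<in> time_changes) \<and>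
          uniform_limit {0..} l (\<lambda>s. s) sequentially \<and>
          (\<forall>T\<ge>0. uniform_limit {0..T} (\<lambda>n s. f n (l n s)) g sequentially))"

definition quad_sum ::
  "(nat \<Rightarrow> real list) \<Rightarrow> 'm::finite path \<Rightarrow> nat \<Rightarrow> real \<Rightarrow> real ^ 'm ^ 'm" where
  "quad_sum \<pi> x n t = (\<Sum>i | i < length (\<pi> n) - 1 \<and> \<pi> n ! i \<le> t.
     let d = x (\<pi> n ! Suc i) - x (\<pi> n ! i) in (\<chi> j k. d $ j * d $ k))"

definition Q_paths :: "(nat \<Rightarrow> real list) \<Rightarrow> ('m::finite path) set" where
  "Q_paths \<pi> = {x. cadlag x \<and> (\<exists>V. J1_lim (quad_sum \<pi> x) V)}"

definition quad_var :: "(nat \<Rightarrow> real list) \<Rightarrow> 'm::finite path \<Rightarrow> real \<Rightarrow> real ^ 'm ^ 'm" where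
  "quad_var \<pi> x = (THE V. J1_lim (quad_sum \<pi> x) V)"


definition generic :: "(nat \<Rightarrow> real list) \<Rightarrow> ('m::finite path) set \<Rightarrow> bool" where
  "generic \<pi> \<Omega> \<longleftrightarrow> \<Omega> \<noteq> {} \<and> \<Omega> \<subseteq> {x. cadlag x} \<and>
     (\<forall>x\<in>\<Omega>. \<forall>T>0. \<exists>N. \<forall>n\<ge>N. stop T (pw_const \<pi> n x) \<in> \<Omega>) \<and>
     (\<forall>x\<in>\<Omega>. \<forall>t\<ge>0. \<exists>U. convex U \<and> 0 \<in> interior U \<and> - jump x t \<in> U \<and>
        (\<forall>e\<in>U. bump t e (stop t x) \<in> \<Omega>))"

definition Lam :: "('m::finite path) set \<Rightarrow> (real \<times> 'm path) set" where
  "Lam \<Omega> = {(t, stop t x) | t x. 0 \<le> t \<and> x \<in> \<Omega>}"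

text \<open>
  A fixed choice of the neighbourhoods \<open>\<U>\<^bsub>t-\<^esub>(x)\<close>. The requirements depend on \<open>x\<close> only
  through \<open>x\<^sub>t\<close>, so the choice is indexed by \<open>(t, x\<^sub>t) \<in> \<Lambda>\<close>.
\<close>

definition jump_nbhds ::
  "('m::finite path) set \<Rightarrow> (real \<Rightarrow> 'm path \<Rightarrow> (real ^ 'm) set) \<Rightarrow> bool" where
  "jump_nbhds \<Omega> \<U> \<longleftrightarrow> (\<forall>(t, y) \<in> Lam \<Omega>.
     convex (\<U> t y) \<and> 0 \<in> interior (\<U> t y) \<and> jump y t \<in> \<U> t y \<and>
     (\<forall>e \<in> \<U> t y. bump t e (stop_left t y) \<in> \<Omega>))"


text \<open>
  In the conditions on sequences \<open>t\<^sub>n \<rightarrow> t\<close>, the comparison with \<open>t'\<^sub>n\<close> is only required for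
  large \<open>n\<close>: it may be unsatisfiable for the first few (coarse) partitions.
\<close>

definition left_cont :: "(nat \<Rightarrow> real list) \<Rightarrow> ('m::finite path) set \<Rightarrow>
    (real \<Rightarrow> 'm path \<Rightarrow> 'b::topological_space) \<Rightarrow> bool" where
  "left_cont \<pi> \<Omega> F \<longleftrightarrow> (\<forall>x\<in>\<Omega>. \<forall>t\<ge>0.
     ((\<lambda>s. F s (stop_left s x)) \<longlongrightarrow> F t (stop_left t x)) (at t within {0..t}) \<and>
     ((\<lambda>s. F s (stop s x)) \<longlongrightarrow> F t (stop_left t x)) (at t within {0..<t}) \<and>
     (\<forall>u. u \<longlonglongrightarrow> t \<longrightarrow> (\<forall>\<^sub>F n in sequentially. 0 \<le> u n \<and> u n \<le> last_before \<pi> n t) \<longrightarrow>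
        (\<lambda>n. F (u n) (stop_left (u n) (pw_const \<pi> n x))) \<longlonglongrightarrow> F t (stop_left t x)) \<and>
     (\<forall>u. u \<longlonglongrightarrow> t \<longrightarrow> (\<forall>\<^sub>F n in sequentially. 0 \<le> u n \<and> u n < last_before \<pi> n t) \<longrightarrow>
        (\<lambda>n. F (u n) (stop (u n) (pw_const \<pi> n x))) \<longlonglongrightarrow> F t (stop_left t x)))"

definition right_cont :: "(nat \<Rightarrow> real list) \<Rightarrow> ('m::finite path) set \<Rightarrow>
    (real \<Rightarrow> 'm path \<Rightarrow> 'b::topological_space) \<Rightarrow> bool" where
  "right_cont \<pi> \<Omega> F \<longleftrightarrow> (\<forall>x\<in>\<Omega>. \<forall>t\<ge>0.
     ((\<lambda>s. F s (stop s x)) \<longlongrightarrow> F t (stop t x)) (at t within {t..}) \<and>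
     ((\<lambda>s. F s (stop_left s x)) \<longlongrightarrow> F t (stop t x)) (at t within {t<..}) \<and>
     (\<forall>u. u \<longlonglongrightarrow> t \<longrightarrow> (\<forall>\<^sub>F n in sequentially. last_before \<pi> n t \<le> u n) \<longrightarrow>
        (\<lambda>n. F (u n) (stop (u n) (pw_const \<pi> n x))) \<longlonglongrightarrow> F t (stop t x)) \<and>
     (\<forall>u. u \<longlonglongrightarrow> t \<longrightarrow> (\<forall>\<^sub>F n in sequentially. last_before \<pi> n t < u n) \<longrightarrow>
        (\<lambda>n. F (u n) (stop_left (u n) (pw_const \<pi> n x))) \<longlonglongrightarrow> F t (stop t x)))"

definition continuous_fun :: "(nat \<Rightarrow> real list) \<Rightarrow> ('m::finite path) set \<Rightarrow>
    (real \<Rightarrow> 'm path \<Rightarrow> 'b::topological_space) \<Rightarrow> bool" where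
  "continuous_fun \<pi> \<Omega> F \<longleftrightarrow> left_cont \<pi> \<Omega> F \<and> right_cont \<pi> \<Omega> F"

definition pre :: "(real \<Rightarrow> 'm::finite path \<Rightarrow> 'b) \<Rightarrow> real \<Rightarrow> 'm path \<Rightarrow> 'b" where
  "pre F t y = F t (stop_left t y)"

definition strictly_causal ::
  "('m::finite path) set \<Rightarrow> (real \<Rightarrow> 'm path \<Rightarrow> 'b) \<Rightarrow> bool" where
  "strictly_causal \<Omega> F \<longleftrightarrow> (\<forall>(t, y) \<in> Lam \<Omega>. F t y = pre F t y)"


text \<open>
  Derivatives at \<open>(t, y) \<in> \<Lambda>\<close>, where \<open>y\<close> is already stopped at \<open>t\<close>. Differentiability in the
  vertical variable \<open>e\<close> is total (Frechet) differentiability at \<open>0\<close>.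
\<close>

definition hor_quot ::
  "(real \<Rightarrow> 'm::finite path \<Rightarrow> real) \<Rightarrow> real \<Rightarrow> 'm path \<Rightarrow> real \<Rightarrow> real" where
  "hor_quot F t y h = (F (t + h) y - F t y) / h"

definition hor_differentiable ::
  "('m::finite path) set \<Rightarrow> (real \<Rightarrow> 'm path \<Rightarrow> real) \<Rightarrow> bool" where
  "hor_differentiable \<Omega> F \<longleftrightarrow>
     (\<forall>(t, y) \<in> Lam \<Omega>. \<exists>L. (hor_quot F t y \<longlongrightarrow> L) (at_right 0))"

definition hor_deriv ::
  "(real \<Rightarrow> 'm::finite path \<Rightarrow> real) \<Rightarrow> real \<Rightarrow> 'm path \<Rightarrow> real" where
  "hor_deriv F t y = Lim (at_right 0) (hor_quot F t y)"

definition vert_differentiable ::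
  "('m::finite path) set \<Rightarrow> (real \<Rightarrow> 'm path \<Rightarrow> 'b::real_normed_vector) \<Rightarrow> bool" where
  "vert_differentiable \<Omega> F \<longleftrightarrow>
     (\<forall>(t, y) \<in> Lam \<Omega>. (\<lambda>e. F t (bump t e y)) differentiable (at 0))"

definition vert_grad ::
  "(real \<Rightarrow> 'm::finite path \<Rightarrow> real) \<Rightarrow> real \<Rightarrow> 'm path \<Rightarrow> real ^ 'm" where
  "vert_grad F t y = (THE g. GDERIV (\<lambda>e. F t (bump t e y)) 0 :> g)"

definition vert_hess ::
  "(real \<Rightarrow> 'm::finite path \<Rightarrow> real) \<Rightarrow> real \<Rightarrow> 'm path \<Rightarrow> real ^ 'm ^ 'm" where
  "vert_hess F t y = jacobian (\<lambda>e. vert_grad F t (bump t e y)) (at 0)"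


text \<open>
  The first conjunct under the quantifier over \<open>n\<close> is the requirement \<open>n\<^sub>0 \<ge> N\<^sub>T(x)\<close>.
\<close>

definition locally_bdd :: "(nat \<Rightarrow> real list) \<Rightarrow> ('m::finite path) set \<Rightarrow>
    (real \<Rightarrow> 'm path \<Rightarrow> 'b::real_normed_vector) \<Rightarrow> bool" where
  "locally_bdd \<pi> \<Omega> F \<longleftrightarrow> (\<forall>x\<in>\<Omega>. \<forall>T\<ge>0. \<exists>n0 K. \<forall>n\<ge>n0.
     stop T (pw_const \<pi> n x) \<in> \<Omega> \<and>
     (\<forall>t\<in>{0..T}. norm (F t (stop t (pw_const \<pi> n x))) \<le> K))"

definition vert_modulus :: "(nat \<Rightarrow> real list) \<Rightarrow> ('m::finite path) set \<Rightarrow>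
    (real \<Rightarrow> 'm path \<Rightarrow> (real ^ 'm) set) \<Rightarrow>
    (real \<Rightarrow> 'm path \<Rightarrow> 'b::real_normed_vector) \<Rightarrow> bool" where
  "vert_modulus \<pi> \<Omega> \<U> F \<longleftrightarrow> (\<forall>x\<in>\<Omega>. \<forall>T\<ge>0. \<forall>r>0. \<exists>\<omega> :: real \<Rightarrow> real.
     (\<forall>s\<ge>0. 0 \<le> \<omega> s) \<and> mono_on {0..} \<omega> \<and> (\<omega> \<longlongrightarrow> 0) (at_right 0) \<and>
     (\<forall>\<^sub>F n in sequentially. \<forall>t\<in>{0..T}.
        \<forall>a \<in> \<U> t (stop t (pw_const \<pi> n x)) \<inter> cball 0 r.
        \<forall>b \<in> \<U> t (stop t (pw_const \<pi> n x)) \<inter> cball 0 r.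
          norm (F t (bump t a (stop_left t (pw_const \<pi> n x))) -
                F t (bump t b (stop_left t (pw_const \<pi> n x)))) \<le> \<omega> (norm (a - b))))"

definition C12 :: "(nat \<Rightarrow> real list) \<Rightarrow> ('m::finite path) set \<Rightarrow>
    (real \<Rightarrow> 'm path \<Rightarrow> (real ^ 'm) set) \<Rightarrow> (real \<Rightarrow> 'm path \<Rightarrow> real) \<Rightarrow> bool" where
  "C12 \<pi> \<Omega> \<U> F \<longleftrightarrow>
     continuous_fun \<pi> \<Omega> F \<and>
     hor_differentiable \<Omega> F \<and> vert_differentiable \<Omega> F \<and> vert_differentiable \<Omega> (vert_grad F) \<and>
     right_cont \<pi> \<Omega> (hor_deriv F) \<and> locally_bdd \<pi> \<Omega> (hor_deriv F) \<and>
     left_cont \<pi> \<Omega> (pre (vert_grad F)) \<and>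
     left_cont \<pi> \<Omega> (pre (vert_hess F)) \<and> locally_bdd \<pi> \<Omega> (pre (vert_hess F)) \<and>
     vert_modulus \<pi> \<Omega> \<U> (vert_hess F)"

definition class_M ::
  "(nat \<Rightarrow> real list) \<Rightarrow> ('m::finite path) set \<Rightarrow> (real \<Rightarrow> 'm path \<Rightarrow> real) \<Rightarrow> bool" where
  "class_M \<pi> \<Omega> F \<longleftrightarrow>
     continuous_fun \<pi> \<Omega> F \<and> hor_differentiable \<Omega> F \<and> vert_differentiable \<Omega> F \<and>
     (\<forall>(t, y) \<in> Lam \<Omega>. hor_deriv F t y = 0) \<and>
     left_cont \<pi> \<Omega> (vert_grad F) \<and> strictly_causal \<Omega> (vert_grad F)"


definition pos_def_sym :: "(real ^ 'm::finite ^ 'm) set" where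
  "pos_def_sym = {A. transpose A = A \<and> (\<forall>v. v \<noteq> 0 \<longrightarrow> 0 < v \<bullet> (A *v v))}"

definition Omega_Sigma :: "(nat \<Rightarrow> real list) \<Rightarrow> ('m::finite path) set \<Rightarrow>
    (real \<Rightarrow> 'm path \<Rightarrow> real ^ 'm ^ 'm) \<Rightarrow> ('m path) set" where
  "Omega_Sigma \<pi> \<Omega> \<Sigma> = {x \<in> \<Omega>. \<forall>t\<ge>0.
     set_integrable lebesgue {0..t} (\<lambda>s. \<Sigma> s (stop s x)) \<and>
     quad_var \<pi> x t - quad_var \<pi> x 0 = (LINT s:{0..t}|lebesgue. \<Sigma> s (stop s x))}"

text \<open>The inner product on \<^typ>\<open>real ^ 'm ^ 'm\<close> is the Frobenius inner product.\<close>

definition harmonic :: "(nat \<Rightarrow> real list) \<Rightarrow> ('m::finite path) set \<Rightarrow>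
    (real \<Rightarrow> 'm path \<Rightarrow> real ^ 'm ^ 'm) \<Rightarrow> (real \<Rightarrow> 'm path \<Rightarrow> real) \<Rightarrow> bool" where
  "harmonic \<pi> \<Omega> \<Sigma> F \<longleftrightarrow> (\<forall>x \<in> Omega_Sigma \<pi> \<Omega> \<Sigma>. \<forall>t\<ge>0.
     hor_deriv F t (stop t x) + 1/2 * (vert_hess F t (stop t x) \<bullet> \<Sigma> t (stop t x)) = 0)"

text \<open>Riemann sums and the pathwise integral \<open>\<integral>\<^sub>0\<^sup>t \<nabla>\<^sub>xF(s,x\<^bsub>s-\<^esub>) dx\<close>.\<close>

definition grad_sum :: "(nat \<Rightarrow> real list) \<Rightarrow> (real \<Rightarrow> 'm::finite path \<Rightarrow> real) \<Rightarrow>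
    'm path \<Rightarrow> real \<Rightarrow> nat \<Rightarrow> real" where
  "grad_sum \<pi> F x t n = (\<Sum>i | i < length (\<pi> n) - 1 \<and> \<pi> n ! i \<le> t.
     vert_grad F (\<pi> n ! i) (stop_left (\<pi> n ! i) (pw_const \<pi> n x)) \<bullet>
       (x (\<pi> n ! Suc i) - x (\<pi> n ! i)))"

definition grad_integral :: "(nat \<Rightarrow> real list) \<Rightarrow> (real \<Rightarrow> 'm::finite path \<Rightarrow> real) \<Rightarrow>
    'm path \<Rightarrow> real \<Rightarrow> real" where
  "grad_integral \<pi> F x t = lim (grad_sum \<pi> F x t)"

end

theory Submission
  imports Defs
begin

text \<open>
  The functional \<open>M(t,x\<^sub>t) = F(0,x\<^sub>0) + \<integral>\<^sub>0\<^sup>t \<nabla>\<^sub>xF(s,x\<^sub>s\<^sub>-) dx\<close> works on all of \<open>\<Lambda>\<close>. Its approximating sums do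
  not change when a stopped path is continued, and change by \<open>\<nabla>\<^sub>xF(t'\<^sub>n,x\<^sup>n\<^bsub>t'\<^sub>n-\<^esub>) \<bullet> e\<close> when \<open>e 1\<^bsub>[t,\<infinity>)\<^esub>\<close>
  is added; hence \<open>\<D>M = 0\<close>, \<open>\<nabla>\<^sub>xM = (\<nabla>\<^sub>xF)\<^sub>-\<close>, and \<open>M\<close> is an explicit finite sum on the paths \<open>x\<^sup>n\<close>.

  Convergence of the sums and continuity of \<open>M\<close> come from a telescoping of \<open>F\<close> along \<open>x\<^sup>n\<close>, which expresses
  the sums by values of \<open>F\<close>, an integral of \<open>\<D>F\<close>, and the sum of the second-order Taylor remainders at
  the jumps of \<open>x\<^sup>n\<close>. The remainders are weights times the squared increments, whose cumulative sums
  converge to \<open>[x]\<close> in \<open>J\<^sub>1\<close>, and such weighted sums converge by a quantile transformation and dominated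
  convergence; no separation of large and small jumps is needed.

  On \<open>\<Omega>\<^sub>\<Sigma>\<close> the difference \<open>F - M\<close> along a path is continuous and has, off a countable set, the right
  derivative \<open>\<D>F + 1/2 \<langle>\<nabla>\<^sub>x\<^sup>2F, \<Sigma>\<rangle> = 0\<close>, so it is constant.
\<close>

section \<open>Right derivatives and right-continuous functions\<close>

text \<open>Left-continuity of the Hessian controls it along \<open>x\<^sup>n\<close> only at times
  up to \<open>t'\<^sub>n\<close>, whereas squared increments also put weight on later times.
  One-sided limits at every time are however two-sided limits off a countable set. On that set
  weight survives only where \<open>[x]\<close> jumps, and there J1 convergence forces the whole
  jump onto the single increment that starts at \<open>t'\<^sub>n\<close>, where the left-continuity
  conditions do apply. The same index separates the value of \<open>M\<close> at
  \<open>x\<^sub>t\<close> from that at \<open>x\<^sub>t\<^sub>-\<close>: sums that include it tend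
  to the former, sums that end before it to the latter.

  The increment with index 0 is special: \<open>x\<^sup>n\<close> already starts at
  \<open>x(t\<^sub>1)\<close>, so this increment is no jump of \<open>x\<^sup>n\<close>. It is left
  out of the sums that define \<open>M\<close> and vanishes in the limit by right-continuity at
  0.\<close>

lemma right_deriv_nonpos_imp_le:
  fixes f :: "real \<Rightarrow> real"
  assumes "a \<le> b" and cont: "continuous_on {a..b} f" and D: "countable D"
    and der: "\<And>t \<epsilon>. t \<in> {a..<b} - D \<Longrightarrow> \<epsilon> > 0 \<Longrightarrow>
      \<forall>\<^sub>F s in at_right t. f s - f t \<le> \<epsilon> * (s - t)"
  shows "f b \<le> f a"
proof (rule ccontr)
  assume "\<not> f b \<le> f a"
  then have gt: "f b > f a" by simp
  then have ab: "a < b" using \<open>a \<le> b\<close> by (cases "a = b") auto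
  \<comment> \<open>Half the mean slope: subtracting \<open>c * (t - a)\<close> keeps
    \<open>g b > g a\<close>, while \<open>c > 0\<close> leaves a margin against the derivative
    bound.\<close>
  define c where "c = (f b - f a) / (2 * (b - a))"
  have c: "c > 0" using gt ab by (simp add: c_def)
  define g where "g t = f t - c * (t - a)" for t
  have gb: "g b > g a"
  proof -
    have "c * (b - a) = (f b - f a) / 2" using ab by (simp add: c_def field_simps)
    then show ?thesis using gt by (simp add: g_def)
  qed
  have gcont: "continuous_on {a..b} g" unfolding g_def
    by (intro continuous_intros cont)
  \<comment> \<open>The last time at which \<open>g\<close> is at most \<open>y\<close>. To its
    right \<open>f\<close> grows faster than slope \<open>c\<close>, so this time must lie in
    \<open>D\<close>. Different levels have different last times, which would make \<open>D\<close>
    uncountable.\<close>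
  have "\<exists>t \<in> {a..<b}. g t = y \<and> (\<forall>s\<in>{t<..b}. g s > y)" if y: "g a < y" "y < g b" for y
  proof -
    define S where "S = {t \<in> {a..b}. g t \<le> y}"
    have S_alt: "S = {a..b} \<inter> g -` {..y}" by (auto simp: S_def)
    have "closed S" unfolding S_alt
      by (rule continuous_closed_preimage[OF gcont closed_atLeastAtMost closed_atMost])
    then have "compact S" unfolding S_alt
      by (metis compact_Icc compact_Int_closed inf.idem inf_assoc)
    moreover have "a \<in> S" using y ab by (auto simp: S_def)
    ultimately obtain t where t: "t \<in> S" "\<And>s. s \<in> S \<Longrightarrow> s \<le> t"
      using compact_attains_sup[of S] by blast
    have tb: "t < b" using t(1) y by (cases "t = b") (auto simp: S_def)
    have gt': "g s > y" if "s \<in> {t<..b}" for s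
    proof (rule ccontr)
      assume "\<not> g s > y"
      then have "s \<in> S" using that t(1) by (auto simp: S_def)
      then show False using t(2)[of s] that by auto
    qed
    have "\<exists>s\<ge>t. s \<le> b \<and> g s = y"
      using t(1) y tb by (intro IVT' continuous_on_subset[OF gcont]) (auto simp: S_def)
    then obtain s where "s \<ge> t" "s \<le> b" "g s = y" by blast
    then have "g t = y" using gt'[of s] by (cases "s = t") auto
    then show ?thesis using gt' tb t(1) by (intro bexI[of _ t]) (auto simp: S_def)
  qed
  then obtain \<tau> where \<tau>: "\<And>y. g a < y \<Longrightarrow> y < g b \<Longrightarrow>
      \<tau> y \<in> {a..<b} \<and> g (\<tau> y) = y \<and> (\<forall>s\<in>{\<tau> y<..b}. g s > y)" by metis
  have "\<tau> y \<in> D" if y: "g a < y" "y < g b" for y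
  proof (rule ccontr)
    assume "\<tau> y \<notin> D"
    then have "\<forall>\<^sub>F s in at_right (\<tau> y). f s - f (\<tau> y) \<le> c / 2 * (s - \<tau> y)"
      using \<tau>[OF y] c by (intro der) auto
    moreover have "\<forall>\<^sub>F s in at_right (\<tau> y). s \<in> {\<tau> y<..<b}"
      using \<tau>[OF y] by (intro eventually_at_right_real) auto
    ultimately have "\<forall>\<^sub>F s in at_right (\<tau> y). False"
    proof eventually_elim
      case (elim s)
      then have "g s > g (\<tau> y)" using \<tau>[OF y] by auto
      then have "c * (s - \<tau> y) < f s - f (\<tau> y)" by (simp add: g_def algebra_simps)
      also have "\<dots> \<le> c / 2 * (s - \<tau> y)" using elim by simp
      finally have "c / 2 * (s - \<tau> y) < 0" by (simp add: algebra_simps)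
      then show False using c elim by (simp add: mult_less_0_iff)
    qed
    then show False by simp
  qed
  then have "\<tau> ` {g a<..<g b} \<subseteq> D" by auto
  then have "countable (\<tau> ` {g a<..<g b})" using D countable_subset by blast
  moreover have "inj_on \<tau> {g a<..<g b}"
    by (rule inj_onI) (metis \<tau> greaterThanLessThan_iff)
  ultimately have "countable {g a<..<g b}" using countable_image_inj_on by blast
  then show False using gb uncountable_open_interval by blast
qed

text \<open>The inequality is applied to \<open>f\<close> and to \<open>- f\<close>. Horizontal
  derivatives look only forward in time, and limits of the Hessian may fail at countably many times;
  this form tolerates both.\<close>

lemma right_deriv_zero_imp_const:
  fixes f :: "real \<Rightarrow> real"
  assumes "a \<le> b" and cont: "continuous_on {a..b} f" and D: "countable D"
    and der: "\<And>t. t \<in> {a..<b} - D \<Longrightarrow> (f has_vector_derivative 0) (at_right t)"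
  shows "f b = f a"
proof -
  have ev: "\<forall>\<^sub>F s in at_right t. \<bar>f s - f t\<bar> \<le> \<epsilon> * (s - t)" if t: "t \<in> {a..<b} - D" "\<epsilon> > 0" for t \<epsilon>
  proof -
    have "\<exists>d>0. \<forall>y\<in>{t<..}. norm (y - t) < d \<longrightarrow> norm (f y - f t) \<le> \<epsilon> * norm (y - t)"
      using der[OF t(1)] t(2) unfolding has_vector_derivative_def has_derivative_within_alt
      by fastforce
    then obtain d where d: "d > 0"
      "\<And>y. y > t \<Longrightarrow> norm (y - t) < d \<Longrightarrow> norm (f y - f t) \<le> \<epsilon> * norm (y - t)" by auto
    have "\<forall>\<^sub>F s in at_right t. s \<in> {t<..<t + d}"
      using d(1) by (intro eventually_at_right_real) auto
    then show ?thesis by eventually_elim (use d(2) in auto)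
  qed
  have "f b \<le> f a"
    by (rule right_deriv_nonpos_imp_le[OF assms(1) cont D]) (use ev in \<open>force elim: eventually_mono\<close>)
  moreover have "- f b \<le> - f a"
    by (rule right_deriv_nonpos_imp_le[OF assms(1) _ D])
      (use ev in \<open>force elim: eventually_mono intro!: continuous_intros cont\<close>)+
  ultimately show ?thesis by simp
qed

text \<open>Sampling \<open>g\<close> at the next point of the grid of step \<open>1 / Suc n\<close>
  strictly to the right of \<open>s\<close> gives functions with countably many values, which
  converge to \<open>g\<close> by right-continuity.\<close>

lemma right_cont_imp_borel_measurable:
  fixes g :: "real \<Rightarrow> 'a::metric_space"
  assumes "\<And>t. (g \<longlongrightarrow> g t) (at_right t)"
  shows "g \<in> borel_measurable borel"
proof (rule borel_measurable_LIMSEQ_metric[where f = "\<lambda>n s. g ((of_int \<lfloor>real (Suc n) * s\<rfloor> + 1) / real (Suc n))"])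
  fix n :: nat
  define h where "h = (\<lambda>k::int. g ((of_int k + 1) / real (Suc n)))"
  have "(\<lambda>s. h \<lfloor>real (Suc n) * s\<rfloor>) \<in> borel_measurable borel"
    by (rule measurable_compose[of _ _ "count_space UNIV"]) measurable
  then show "(\<lambda>s. g ((of_int \<lfloor>real (Suc n) * s\<rfloor> + 1) / real (Suc n))) \<in> borel_measurable borel"
    by (simp add: h_def)
next
  fix s :: real assume "s \<in> space borel"
  let ?r = "\<lambda>n. (of_int \<lfloor>real (Suc n) * s\<rfloor> + 1) / real (Suc n)"
  have up: "?r n > s" for n
    by (simp add: less_divide_eq) (metis mult.commute floor_less_iff lessI less_add_one real_of_int_floor_add_one_gt)
  have le: "?r n \<le> s + 1 / real (Suc n)" for n
  proof -
    have "of_int \<lfloor>real (Suc n) * s\<rfloor> + 1 \<le> real (Suc n) * s + 1" by linarith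
    then have "?r n \<le> (real (Suc n) * s + 1) / real (Suc n)" by (intro divide_right_mono) auto
    also have "\<dots> = s + 1 / real (Suc n)" by (simp add: field_simps)
    finally show ?thesis .
  qed
  have lim: "?r \<longlonglongrightarrow> s"
  proof (rule tendsto_sandwich)
    show "\<forall>\<^sub>F n in sequentially. s \<le> ?r n"
      by (intro always_eventually allI less_imp_le up)
    show "\<forall>\<^sub>F n in sequentially. ?r n \<le> s + 1 / real (Suc n)"
      by (intro always_eventually allI le)
    show "(\<lambda>n. s + 1 / real (Suc n)) \<longlonglongrightarrow> s"
      using LIMSEQ_inverse_real_of_nat_add[of s] by (simp add: inverse_eq_divide)
  qed auto
  have "filterlim ?r (at_right s) sequentially"
    unfolding filterlim_at
  proof (intro conjI always_eventually allI)
    show "?r n \<in> {s<..}" "?r n \<noteq> s" for n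
      using up[of n] unfolding greaterThan_iff by (metis less_irrefl)+
  qed (rule lim)
  then show "(\<lambda>n. g (?r n)) \<longlonglongrightarrow> g s" by (rule filterlim_compose[OF assms])
qed

text \<open>Setting the function to 0 outside \<open>{0..<T}\<close> makes it right-continuous on
  the whole line, hence Borel. Inside \<open>{0..T}\<close> only the value at \<open>T\<close>
  changes, which the integral does not see.\<close>

lemma right_cont_bounded_integrable:
  fixes g :: "real \<Rightarrow> 'a::euclidean_space"
  assumes rc: "\<And>t. 0 \<le> t \<Longrightarrow> t < T \<Longrightarrow> (g \<longlongrightarrow> g t) (at_right t)"
    and bd: "\<And>t. 0 \<le> t \<Longrightarrow> t \<le> T \<Longrightarrow> norm (g t) \<le> K"
  shows "g integrable_on {0..T}"
proof -
  define h where "h s = (if 0 \<le> s \<and> s < T then g s else 0)" for s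
  have "(h \<longlongrightarrow> h t) (at_right t)" for t
  proof -
    consider "t < 0" | "0 \<le> t" "t < T" | "T \<le> t" by linarith
    then show ?thesis
    proof cases
      case 1
      have "\<forall>\<^sub>F s in at_right t. s \<in> {t<..<0}" using 1 by (rule eventually_at_right_real)
      then have "\<forall>\<^sub>F s in at_right t. h t = h s" by eventually_elim (use 1 in \<open>auto simp: h_def\<close>)
      then show ?thesis by (rule tendsto_eventually[OF eventually_mono]) auto
    next
      case 2
      have "\<forall>\<^sub>F s in at_right t. s \<in> {t<..<T}" using 2(2) by (rule eventually_at_right_real)
      then have "\<forall>\<^sub>F s in at_right t. g s = h s" by eventually_elim (use 2 in \<open>auto simp: h_def\<close>)
      then have "(h \<longlongrightarrow> g t) (at_right t)" by (rule Lim_transform_eventually[OF rc[OF 2]])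
      then show ?thesis using 2 by (simp add: h_def)
    next
      case 3
      have "\<forall>\<^sub>F s in at_right t. s \<in> {t<..<t+1}" by (rule eventually_at_right_real) simp
      then have "\<forall>\<^sub>F s in at_right t. h s = h t" by eventually_elim (use 3 in \<open>auto simp: h_def\<close>)
      then show ?thesis by (rule tendsto_eventually)
    qed
  qed
  then have meas: "h \<in> borel_measurable borel" by (rule right_cont_imp_borel_measurable)
  have "h integrable_on {0..T}"
  proof (rule measurable_bounded_by_integrable_imp_integrable[where g = "\<lambda>_. \<bar>K\<bar>"])
    show "h \<in> borel_measurable (lebesgue_on {0..T})"
      by (rule measurable_restrict_space1) (use meas in \<open>simp add: measurable_completion\<close>)
    show "norm (h x) \<le> \<bar>K\<bar>" if "x \<in> {0..T}" for x using bd[of x] that by (auto simp: h_def)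
  qed auto
  moreover have "h x = g x" if "x \<in> {0..T} - {T}" for x using that by (auto simp: h_def)
  ultimately show ?thesis using integrable_spike_finite[of "{T}" "{0..T}" g h] by fastforce
qed

lemma integral_right_deriv:
  fixes g :: "real \<Rightarrow> 'a::euclidean_space"
  assumes int: "g integrable_on {0..T}" and t: "0 \<le> t" "t < T"
    and rc: "(g \<longlongrightarrow> g t) (at_right t)"
  shows "((\<lambda>u. integral {0..u} g) has_vector_derivative g t) (at_right t)"
proof -
  have i: "g integrable_on {t..T}" "\<And>u. u \<in> {t..T} \<Longrightarrow> g integrable_on {0..u}"
    using int t by (auto intro: integrable_on_subinterval)
  have "continuous (at t within ({t..T} - {})) g"
    using rc t by (simp add: continuous_within at_within_Icc_at_right)
  then have "((\<lambda>u. integral {t..u} g) has_vector_derivative g t) (at t within {t..T})"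
    using integral_has_vector_derivative_continuous_at[OF i(1), of t "{}"] t by auto
  then have "((\<lambda>u. integral {0..t} g + integral {t..u} g) has_vector_derivative g t) (at t within {t..T})"
    by (auto intro!: derivative_eq_intros)
  then have "((\<lambda>u. integral {0..u} g) has_vector_derivative g t) (at t within {t..T})"
  proof (rule has_vector_derivative_transform[rotated 2])
    show "integral {0..u} g = integral {0..t} g + integral {t..u} g" if "u \<in> {t..T}" for u
      using Henstock_Kurzweil_Integration.integral_combine[of 0 t u g] that t i(2) by auto
  qed (use t in auto)
  then show ?thesis using t
    by (simp add: has_vector_derivative_def at_within_Icc_at_right)
qed

section \<open>Limits along sequences of times\<close>

text \<open>Passes from sequences to neighbourhoods. Otherwise violating pairs \<open>(n, u)\<close>
  with \<open>u\<close> ever closer to \<open>t\<close> occur along a subsequence \<open>r\<close>;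
  spliced into the admissible sequence \<open>v\<close>, which fills the indices outside
  \<open>range r\<close>, they form an admissible sequence along which \<open>f\<close> does not
  converge to \<open>l\<close>.\<close>

lemma sequence_condition_uniform:
  fixes f :: "nat \<Rightarrow> real \<Rightarrow> 'b::metric_space"
  assumes v: "v \<longlonglongrightarrow> t" "\<forall>\<^sub>F n in sequentially. P n (v n)"
    and H: "\<And>u. u \<longlonglongrightarrow> t \<Longrightarrow> \<forall>\<^sub>F n in sequentially. P n (u n) \<Longrightarrow> (\<lambda>n. f n (u n)) \<longlonglongrightarrow> l"
    and "\<epsilon> > 0"
  shows "\<exists>\<eta>>0. \<exists>N. \<forall>n\<ge>N. \<forall>u. \<bar>u - t\<bar> < \<eta> \<longrightarrow> P n u \<longrightarrow> dist (f n u) l < \<epsilon>"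
proof (rule ccontr)
  assume neg: "\<not> ?thesis"
  define B where "B k n \<longleftrightarrow> (\<exists>u. \<bar>u - t\<bar> < inverse (real (Suc k)) \<and> P n u \<and> \<not> dist (f n u) l < \<epsilon>)" for k n
  have inf: "\<exists>n\<ge>N. B k n" for k N
    using neg unfolding B_def by (metis inverse_positive_iff_positive of_nat_0_less_iff zero_less_Suc)
  have "\<exists>r. \<forall>k. B k (r k) \<and> r k < r (Suc k)"
  proof (rule dependent_nat_choice[where P = B and Q = "\<lambda>_ x y. x < y"])
    show "\<exists>n. B 0 n" using inf by blast
    show "\<exists>y. B (Suc k) y \<and> n < y" for k n using inf[of "Suc n" "Suc k"] by (auto simp: Suc_le_eq)
  qed
  then obtain r where r: "\<And>k. B k (r k)" "strict_mono r"
    unfolding strict_mono_Suc_iff by blast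
  obtain w where w: "\<And>k. \<bar>w k - t\<bar> < inverse (real (Suc k))" "\<And>k. P (r k) (w k)"
      "\<And>k. \<not> dist (f (r k) (w k)) l < \<epsilon>"
    using r(1) unfolding B_def by metis
  define u where "u n = (if n \<in> range r then w (inv r n) else v n)" for n
  have ur: "u (r k) = w k" for k
    using r(2) by (simp add: u_def strict_mono_imp_inj_on inv_f_f)
  have wt: "w \<longlonglongrightarrow> t"
  proof (rule LIM_zero_cancel, rule Lim_null_comparison)
    show "\<forall>\<^sub>F n in sequentially. norm (w n - t) \<le> inverse (real (Suc n))"
      by (intro always_eventually allI) (use w(1) in \<open>simp add: less_imp_le\<close>)
  qed (rule LIMSEQ_inverse_real_of_nat)
  have "u \<longlonglongrightarrow> t"
  proof (rule LIMSEQ_I)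
    fix e :: real assume e: "e > 0"
    obtain N1 where N1: "\<And>n. n \<ge> N1 \<Longrightarrow> norm (v n - t) < e" using LIMSEQ_D[OF v(1) e] by auto
    obtain N2 where N2: "\<And>n. n \<ge> N2 \<Longrightarrow> norm (w n - t) < e" using LIMSEQ_D[OF wt e] by auto
    have "norm (u n - t) < e" if n: "n \<ge> max N1 (r N2)" for n
    proof (cases "n \<in> range r")
      case True
      then obtain k where k: "n = r k" by auto
      then have "k \<ge> N2" using n r(2) by (metis max.boundedE strict_mono_less_eq)
      then show ?thesis using N2 k ur by simp
    next
      case False
      then show ?thesis using N1 n by (simp add: u_def)
    qed
    then show "\<exists>no. \<forall>n\<ge>no. norm (u n - t) < e" by blast
  qed
  moreover have "\<forall>\<^sub>F n in sequentially. P n (u n)"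
    using v(2)
  proof eventually_elim
    case (elim n)
    then show ?case using ur w(2) by (cases "n \<in> range r") (auto simp: u_def)
  qed
  ultimately have "(\<lambda>n. f n (u n)) \<longlonglongrightarrow> l" by (rule H)
  then have "((\<lambda>n. f n (u n)) \<circ> r) \<longlonglongrightarrow> l" using r(2) by (rule LIMSEQ_subseq_LIMSEQ)
  then have "(\<lambda>k. f (r k) (w k)) \<longlonglongrightarrow> l" by (simp add: o_def ur)
  then show False using w(3) \<open>\<epsilon> > 0\<close> unfolding lim_sequentially by blast
qed

lemma sequence_condition_uniformE:
  fixes f :: "nat \<Rightarrow> real \<Rightarrow> 'b::metric_space"
  assumes "\<epsilon> > 0" "v \<longlonglongrightarrow> t" "\<forall>\<^sub>F n in sequentially. P n (v n)"
    and "\<And>u. u \<longlonglongrightarrow> t \<Longrightarrow> \<forall>\<^sub>F n in sequentially. P n (u n) \<Longrightarrow> (\<lambda>n. f n (u n)) \<longlonglongrightarrow> l"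
  obtains \<eta> N where "\<eta> > 0" "\<And>n u. n \<ge> N \<Longrightarrow> \<bar>u - t\<bar> < \<eta> \<Longrightarrow> P n u \<Longrightarrow> dist (f n u) l < \<epsilon>"
proof -
  have "\<exists>\<eta>>0. \<exists>N. \<forall>n\<ge>N. \<forall>u. \<bar>u - t\<bar> < \<eta> \<longrightarrow> P n u \<longrightarrow> dist (f n u) l < \<epsilon>"
    by (rule sequence_condition_uniform[where P = P and v = v and f = f, OF assms(2,3) _ assms(1)]) (rule assms(4))
  then show thesis using that by blast
qed

text \<open>A rational number chosen in the gap to the left of each point determines the
  point.\<close>

lemma left_isolated_countable:
  fixes E :: "real set"
  assumes "\<And>t. t \<in> E \<Longrightarrow> \<exists>\<eta>>0. E \<inter> {t - \<eta><..<t} = {}"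
  shows "countable E"
proof -
  obtain \<eta> where \<eta>: "\<And>t. t \<in> E \<Longrightarrow> \<eta> t > 0 \<and> E \<inter> {t - \<eta> t<..<t} = {}" using assms by metis
  have "\<exists>q\<in>\<rat>. t - \<eta> t < q \<and> q < t" if "t \<in> E" for t
    using Rats_dense_in_real[of "t - \<eta> t" t] \<eta>[OF that] by auto
  then obtain q where q: "\<And>t. t \<in> E \<Longrightarrow> q t \<in> \<rat> \<and> t - \<eta> t < q t \<and> q t < t" by metis
  have "False" if "a \<in> E" "b \<in> E" "q a = q b" "a < b" for a b
    using q[OF that(1)] q[OF that(2)] \<eta>[OF that(2)] that by (auto simp: disjoint_iff)
  then have "inj_on q E" by (metis inj_onI linorder_neqE)
  moreover have "countable (q ` E)" using q countable_rat by (auto intro: countable_subset)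
  ultimately show ?thesis using countable_image_inj_on by blast
qed

text \<open>Uniform control of \<open>f\<close> at times near \<open>t\<close> up to
  \<open>p n t\<close> is two-sided control around every \<open>s\<close> slightly before
  \<open>t\<close>. So the times at which two-sided control fails for a given tolerance are isolated
  from the left, hence countable. This turns left-continuity along \<open>x\<^sup>n\<close> into
  convergence along arbitrary times.\<close>

lemma left_limits_imp_limits_off_countable:
  fixes f :: "nat \<Rightarrow> real \<Rightarrow> 'b::metric_space"
  assumes p: "\<And>t. t > 0 \<Longrightarrow> (\<lambda>n. p n t) \<longlonglongrightarrow> t" "\<And>n t. p n t \<ge> 0"
    and H: "\<And>u t. t > 0 \<Longrightarrow> u \<longlonglongrightarrow> t \<Longrightarrow> \<forall>\<^sub>F n in sequentially. 0 \<le> u n \<and> u n \<le> p n t \<Longrightarrow>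
       (\<lambda>n. f n (u n)) \<longlonglongrightarrow> l t"
  obtains D where "countable D"
    "\<And>u t. t > 0 \<Longrightarrow> t \<notin> D \<Longrightarrow> u \<longlonglongrightarrow> t \<Longrightarrow> (\<lambda>n. f n (u n)) \<longlonglongrightarrow> l t"
proof -
  define G where "G e t \<longleftrightarrow> (\<exists>\<eta>>0. \<exists>N. \<forall>n\<ge>N. \<forall>u. \<bar>u - t\<bar> < \<eta> \<longrightarrow> dist (f n u) (l t) < e)" for e t
  define E where "E k = {t. t > 0 \<and> \<not> G (inverse (real (Suc k))) t}" for k
  have "countable (E k)" for k
  proof (rule left_isolated_countable)
    fix t assume "t \<in> E k"
    then have t: "t > 0" by (simp add: E_def)
    define e where "e = inverse (real (Suc k))"
    have e: "e > 0" by (simp add: e_def)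
    obtain \<eta> N where \<eta>: "\<eta> > 0" "\<And>n u. n \<ge> N \<Longrightarrow> \<bar>u - t\<bar> < \<eta> \<Longrightarrow> 0 \<le> u \<and> u \<le> p n t \<Longrightarrow> dist (f n u) (l t) < e / 2"
    proof -
      have "\<exists>\<eta>>0. \<exists>N. \<forall>n\<ge>N. \<forall>u. \<bar>u - t\<bar> < \<eta> \<longrightarrow> 0 \<le> u \<and> u \<le> p n t \<longrightarrow> dist (f n u) (l t) < e / 2"
        using p t e by (intro sequence_condition_uniform[where v = "\<lambda>n. p n t"] H t) auto
      then show thesis using that by blast
    qed
    have "s \<notin> E k" if s: "s \<in> {t - min \<eta> t<..<t}" for s
    proof -
      have s0: "s > 0" using s by auto
      have "\<forall>\<^sub>F n in sequentially. p n t > (s + t) / 2"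
        using p(1)[OF t] s by (intro order_tendstoD(1)) auto
      then obtain N' where N': "\<And>n. n \<ge> N' \<Longrightarrow> p n t > (s + t) / 2"
        unfolding eventually_sequentially by auto
      have ev: "\<forall>\<^sub>F n in sequentially. p n s < (s + t) / 2" "\<forall>\<^sub>F n in sequentially. p n s > t - \<eta>"
        by (intro order_tendstoD[OF p(1)[OF s0]]; use s in auto)+
      have "(\<lambda>n. f n (p n s)) \<longlonglongrightarrow> l s" using p s0 by (intro H) auto
      moreover have "\<forall>\<^sub>F n in sequentially. dist (f n (p n s)) (l t) \<le> e / 2"
        using ev eventually_ge_at_top[of "max N N'"]
      proof eventually_elim
        case (elim n)
        then show ?case using \<eta>(2)[of n "p n s"] N'[of n] p(2)[of n s] s by (auto simp: abs_if)
      qed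
      ultimately have ls: "dist (l s) (l t) \<le> e / 2"
        by (intro tendsto_upperbound[OF tendsto_dist[OF _ tendsto_const]]) auto
      \<comment> \<open>Keeps \<open>u\<close> below the midpoint of \<open>s\<close> and
        \<open>t\<close>, hence eventually below \<open>p n t\<close>, and above
        \<open>max 0 (t - \<eta>)\<close>, so that the one-sided bound at \<open>t\<close>
        applies.\<close>
      define \<eta>' where "\<eta>' = min (s - (t - min \<eta> t)) ((t - s) / 2)"
      have "dist (f n u) (l s) < e" if "n \<ge> max N N'" "\<bar>u - s\<bar> < \<eta>'" for n u
      proof -
        have "dist (f n u) (l t) < e / 2"
          using that N'[of n] s by (intro \<eta>(2)) (auto simp: \<eta>'_def abs_if split: if_splits)
        then show ?thesis using ls dist_triangle2[of "f n u" "l s" "l t"] by linarith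
      qed
      moreover have "\<eta>' > 0" using s by (auto simp: \<eta>'_def)
      ultimately have "G e s" unfolding G_def by blast
      then show ?thesis by (simp add: E_def e_def)
    qed
    then show "\<exists>\<eta>>0. E k \<inter> {t - \<eta><..<t} = {}"
      using \<eta>(1) t by (intro exI[of _ "min \<eta> t"]) auto
  qed
  then have "countable (\<Union>k. E k)" by blast
  moreover have "(\<lambda>n. f n (u n)) \<longlonglongrightarrow> l t" if t: "t > 0" "t \<notin> (\<Union>k. E k)" and u: "u \<longlonglongrightarrow> t" for u t
  proof (rule metric_LIMSEQ_I)
    fix e :: real assume "e > 0"
    then obtain k where k: "inverse (real (Suc k)) < e" using reals_Archimedean by blast
    have "G (inverse (real (Suc k))) t" using t by (auto simp: E_def)
    then obtain \<eta> N where \<eta>: "\<eta> > 0" "\<And>n u. n \<ge> N \<Longrightarrow> \<bar>u - t\<bar> < \<eta> \<Longrightarrow> dist (f n u) (l t) < inverse (real (Suc k))"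
      unfolding G_def by blast
    obtain N' where "\<And>n. n \<ge> N' \<Longrightarrow> \<bar>u n - t\<bar> < \<eta>" using LIMSEQ_D[OF u \<eta>(1)] by auto
    then show "\<exists>no. \<forall>n\<ge>no. dist (f n (u n)) (l t) < e"
      using \<eta>(2) k by (intro exI[of _ "max N N'"]) (meson less_trans max.boundedE)
  qed
  ultimately show thesis by (rule that)
qed

text \<open>
  The sum is the integral over \<open>v\<close> of \<open>\<phi> n (i\<^sub>n v)\<close>, with \<open>i\<^sub>n v\<close> the index at which the
  cumulative weight crosses the level \<open>v\<close>. For all but countably many \<open>v\<close>, the points
  \<open>s n (i\<^sub>n v)\<close> converge to the \<open>v\<close>-quantile of \<open>Q\<close>, and dominated convergence applies.
\<close>

lemma quantile_convergent:
  fixes s w \<phi> :: "nat \<Rightarrow> nat \<Rightarrow> real" and J :: "nat \<Rightarrow> nat" and Q Qm \<phi>l :: "real \<Rightarrow> real"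
  assumes T: "T \<ge> 0"
    and sorted: "\<And>n i j. i \<le> j \<Longrightarrow> j < J n \<Longrightarrow> s n i \<le> s n j"
    and range: "\<And>n i. i < J n \<Longrightarrow> 0 \<le> s n i \<and> s n i \<le> T"
    and w: "\<And>n i. i < J n \<Longrightarrow> 0 \<le> w n i"
    and \<phi>: "\<And>n i. i < J n \<Longrightarrow> \<bar>\<phi> n i\<bar> \<le> C"
    and Q: "\<And>u. 0 \<le> u \<Longrightarrow> u \<le> T \<Longrightarrow> (\<lambda>n. \<Sum>i<J n. if s n i \<le> u then w n i else 0) \<longlonglongrightarrow> Q u"
    and Q0: "Q 0 = 0"
    and Qr: "\<And>t. 0 \<le> t \<Longrightarrow> t < T \<Longrightarrow> (Q \<longlongrightarrow> Q t) (at_right t)"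
    and D: "countable D"
    and Qm: "\<And>t. t \<in> D \<Longrightarrow> 0 < t \<Longrightarrow> t \<le> T \<Longrightarrow> (Q \<longlongrightarrow> Qm t) (at_left t)"
    and h2: "\<And>t i. 0 < t \<Longrightarrow> t \<le> T \<Longrightarrow> t \<notin> D \<Longrightarrow> (\<lambda>n. s n (i n)) \<longlonglongrightarrow> t \<Longrightarrow>
       \<forall>\<^sub>F n in sequentially. i n < J n \<and> w n (i n) > 0 \<Longrightarrow> (\<lambda>n. \<phi> n (i n)) \<longlonglongrightarrow> \<phi>l t"
    and h1: "\<And>t. t \<in> D \<Longrightarrow> 0 < t \<Longrightarrow> t \<le> T \<Longrightarrow> Qm t < Q t \<Longrightarrow>
       \<exists>k. (\<forall>\<^sub>F n in sequentially. k n < J n) \<and> (\<lambda>n. \<Sum>i<k n. w n i) \<longlonglongrightarrow> Qm t \<and>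
         (\<lambda>n. \<Sum>i<Suc (k n). w n i) \<longlonglongrightarrow> Q t \<and> (\<lambda>n. \<phi> n (k n)) \<longlonglongrightarrow> \<phi>l t"
  shows "convergent (\<lambda>n. \<Sum>i<J n. \<phi> n i * w n i)"
proof -
  define c where "c n k = (\<Sum>i<k. w n i)" for n k
  define \<Phi> where "\<Phi> n v = (\<Sum>i<J n. \<phi> n i * indicat_real {c n i<..c n (Suc i)} v)" for n v
  have c_mono: "c n i \<le> c n j" if "i \<le> j" "j \<le> J n" for n i j
    unfolding c_def using that w by (intro sum_mono2) auto
  have c0: "c n 0 = 0" for n by (simp add: c_def)
  have QT: "(\<lambda>n. c n (J n)) \<longlonglongrightarrow> Q T"
  proof -
    have "(\<Sum>i<J n. if s n i \<le> T then w n i else 0) = c n (J n)" for n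
      unfolding c_def using range by (intro sum.cong) auto
    then show ?thesis using Q[of T] T by simp
  qed
  have Q_mono: "Q a \<le> Q b" if "0 \<le> a" "a \<le> b" "b \<le> T" for a b
    using that w by (intro LIMSEQ_le[OF Q Q] exI[of _ 0] allI impI sum_mono) auto
  have \<Phi>_eq: "\<Phi> n v = \<phi> n i" if i: "i < J n" "c n i < v" "v \<le> c n (Suc i)" for n v i
  proof -
    have "\<phi> n j * indicat_real {c n j<..c n (Suc j)} v = (if j = i then \<phi> n i else 0)" if j: "j < J n" for j
    proof -
      consider "j < i" | "j = i" | "j > i" by linarith
      then show ?thesis
      proof cases
        case 1
        then have "c n (Suc j) \<le> c n i" using i by (intro c_mono) auto
        then show ?thesis using 1 i by auto
      next
        case 3
        then have "c n (Suc i) \<le> c n j" using j by (intro c_mono) auto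
        then show ?thesis using 3 i by auto
      qed (use i in auto)
    qed
    then have "\<Phi> n v = (\<Sum>j<J n. if j = i then \<phi> n i else 0)" unfolding \<Phi>_def by (intro sum.cong) auto
    then show ?thesis using i by simp
  qed
  have idx: "\<exists>i<J n. c n i < v \<and> v \<le> c n (Suc i)" if "0 < v" "v \<le> c n (J n)" for n v
  proof -
    define k where "k = (LEAST k. v \<le> c n k)"
    have k: "v \<le> c n k" "k \<le> J n" unfolding k_def using that by (auto intro: LeastI Least_le)
    have "k \<noteq> 0" using k that c0 by (metis not_less)
    then have "\<not> v \<le> c n (k - 1)" unfolding k_def by (intro not_less_Least) auto
    then show ?thesis using k \<open>k \<noteq> 0\<close> by (intro exI[of _ "k - 1"]) auto
  qed
  have \<Phi>_zero: "\<Phi> n v = 0" if "v \<le> 0 \<or> v > c n (J n)" for n v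
  proof -
    have "indicat_real {c n i<..c n (Suc i)} v = 0" if "i < J n" for i
      using c_mono[of 0 i n] c_mono[of "Suc i" "J n" n] that c0 \<open>v \<le> 0 \<or> v > c n (J n)\<close> by auto
    then show ?thesis unfolding \<Phi>_def by (intro sum.neutral) auto
  qed
  \<comment> \<open>The index that crosses level \<open>v\<close> lies after time \<open>u\<close>
    exactly when the weight accumulated up to \<open>u\<close> is below \<open>v\<close>. This is
    how convergent cumulative weights locate the crossing times.\<close>
  have crossing: "s n i > u \<longleftrightarrow> (\<Sum>j<J n. if s n j \<le> u then w n j else 0) < v"
    if i: "i < J n" "c n i < v" "v \<le> c n (Suc i)" for n i u v
  proof (cases "s n i \<le> u")
    case True
    have "c n (Suc i) = (\<Sum>j<Suc i. if s n j \<le> u then w n j else 0)"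
      unfolding c_def using sorted i True by (intro sum.cong) (auto simp: less_Suc_eq_le intro: order_trans)
    also have "\<dots> \<le> (\<Sum>j<J n. if s n j \<le> u then w n j else 0)"
      using i w by (intro sum_mono2) auto
    finally show ?thesis using True i by auto
  next
    case False
    have "(\<Sum>j<J n. if s n j \<le> u then w n j else 0) \<le> (\<Sum>j<J n. if j < i then w n j else 0)"
    proof (intro sum_mono)
      fix j assume j: "j \<in> {..<J n}"
      have "j < i" if "s n j \<le> u" using sorted[of i j n] j that False by (cases "j < i") auto
      then show "(if s n j \<le> u then w n j else 0) \<le> (if j < i then w n j else 0)" using w j by auto
    qed
    also have "\<dots> = c n i"
      unfolding c_def using i by (simp add: sum.If_cases) (intro sum.cong, auto)
    finally show ?thesis using False i by auto
  qed
  \<comment> \<open>If \<open>Q\<close> takes a level on a whole interval, it takes it at a rational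
    time, so all flat levels are discarded. Discarding the values and left limits at
    \<open>D\<close> places \<open>v\<close> strictly inside a jump whenever its quantile lies in
    \<open>D\<close>.\<close>
  define bad where "bad = Q ` (\<rat> \<inter> {0..T}) \<union> Q ` D \<union> Qm ` D \<union> {0, Q T}"
  have "countable bad" unfolding bad_def using D countable_rat by auto
  have conv: "convergent (\<lambda>n. \<Phi> n v)" if v: "v \<notin> bad" for v
  proof -
    have "v \<noteq> 0" "v \<noteq> Q T" using v by (auto simp: bad_def)
    then consider "v < 0" | "v > Q T" | "0 < v" "v < Q T" by linarith
    then show ?thesis
    proof cases
      case 1
      then show ?thesis using \<Phi>_zero by (simp add: convergent_const)
    next
      case 2
      then have "\<forall>\<^sub>F n in sequentially. c n (J n) < v" by (rule order_tendstoD(2)[OF QT])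
      then have "\<forall>\<^sub>F n in sequentially. \<Phi> n v = 0" by eventually_elim (use \<Phi>_zero in auto)
      then have "(\<lambda>n. \<Phi> n v) \<longlonglongrightarrow> 0" by (rule tendsto_eventually)
      then show ?thesis by (rule convergentI)
    next
      case 3
      define \<tau> where "\<tau> = Inf {u \<in> {0..T}. Q u \<ge> v}"
      have ne: "T \<in> {u \<in> {0..T}. Q u \<ge> v}" using 3 T by auto
      have bb: "bdd_below {u \<in> {0..T}. Q u \<ge> v}" by (rule bdd_belowI[of _ 0]) auto
      have \<tau>0: "0 \<le> \<tau>" unfolding \<tau>_def using ne by (intro cInf_greatest) auto
      have \<tau>T: "\<tau> \<le> T" unfolding \<tau>_def using ne bb by (intro cInf_lower) auto
      have below: "Q u < v" if "0 \<le> u" "u < \<tau>" for u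
      proof (rule ccontr)
        assume "\<not> Q u < v"
        then have "\<tau> \<le> u" unfolding \<tau>_def using bb that \<tau>T by (intro cInf_lower) auto
        then show False using that by simp
      qed
      have above: "Q u > v" if u: "\<tau> < u" "u \<le> T" for u
      proof -
        obtain q where q: "q \<in> \<rat>" "\<tau> < q" "q < u" using Rats_dense_in_real[OF u(1)] by auto
        obtain u' where u': "u' \<in> {0..T}" "Q u' \<ge> v" "u' < q"
          using cInf_lessD[of "{u \<in> {0..T}. Q u \<ge> v}" q] ne q unfolding \<tau>_def by auto
        have "Q u' \<le> Q q" using u' q u by (intro Q_mono) auto
        moreover have "Q q \<noteq> v" using v q \<tau>0 u unfolding bad_def by auto
        moreover have "Q q \<le> Q u" using q u \<tau>0 by (intro Q_mono) auto
        ultimately show ?thesis using u' by linarith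
      qed
      have Q\<tau>: "v \<le> Q \<tau>"
      proof (cases "\<tau> < T")
        case True
        have "\<forall>\<^sub>F u in at_right \<tau>. u \<in> {\<tau><..<T}" using True by (rule eventually_at_right_real)
        then have "\<forall>\<^sub>F u in at_right \<tau>. v \<le> Q u"
          by eventually_elim (use above in \<open>auto intro: less_imp_le\<close>)
        then show ?thesis by (intro tendsto_lowerbound[OF Qr[OF \<tau>0 True]]) auto
      next
        case False
        then show ?thesis using \<tau>T 3 by simp
      qed
      then have \<tau>pos: "\<tau> > 0" using Q0 3 \<tau>0 by (cases "\<tau> = 0") auto
      have ev: "\<forall>\<^sub>F n in sequentially. v < c n (J n)" by (rule order_tendstoD(1)[OF QT 3(2)])
      obtain i where i: "\<And>n. v < c n (J n) \<Longrightarrow> i n < J n \<and> c n (i n) < v \<and> v \<le> c n (Suc (i n))"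
        using idx[OF 3(1)] by (metis less_imp_le)
      have ev_i: "\<forall>\<^sub>F n in sequentially. i n < J n \<and> c n (i n) < v \<and> v \<le> c n (Suc (i n))"
        using ev by eventually_elim (rule i)
      have \<Phi>i: "\<forall>\<^sub>F n in sequentially. \<phi> n (i n) = \<Phi> n v"
        using ev_i by eventually_elim (use \<Phi>_eq in auto)
      show ?thesis
      proof (cases "\<tau> \<in> D")
        case False
        have "(\<lambda>n. s n (i n)) \<longlonglongrightarrow> \<tau>"
        proof (rule order_tendstoI)
          fix a assume a: "a < \<tau>"
          define a' where "a' = max a 0"
          have "a' < \<tau>" "0 \<le> a'" using a \<tau>pos by (auto simp: a'_def)
          then have "\<forall>\<^sub>F n in sequentially. (\<Sum>j<J n. if s n j \<le> a' then w n j else 0) < v"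
            using below \<tau>T by (intro order_tendstoD(2)[OF Q]) auto
          then show "\<forall>\<^sub>F n in sequentially. a < s n (i n)"
            using ev_i by eventually_elim (use crossing[of _ _ v a'] in \<open>auto simp: a'_def\<close>)
        next
          fix a assume a: "\<tau> < a"
          show "\<forall>\<^sub>F n in sequentially. s n (i n) < a"
          proof (cases "a \<le> T")
            case True
            define a' where "a' = (\<tau> + a) / 2"
            have a': "\<tau> < a'" "a' < a" using a by (auto simp: a'_def)
            then have "\<forall>\<^sub>F n in sequentially. v < (\<Sum>j<J n. if s n j \<le> a' then w n j else 0)"
              using above[of a'] \<tau>T True \<tau>pos by (intro order_tendstoD(1)[OF Q]) auto
            then show ?thesis
              using ev_i
            proof eventually_elim
              case (elim n)
              then have "\<not> s n (i n) > a'" using crossing[of "i n" n v a'] by auto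
              then show ?case using a' by simp
            qed
          next
            case False
            show ?thesis using ev_i by eventually_elim (use range False in force)
          qed
        qed
        \<comment> \<open>A crossing index has positive weight, since the cumulative weight rises
          there from below \<open>v\<close> to at least \<open>v\<close>. The estimate of a Taylor
          remainder relative to its squared increment relies on this.\<close>
        moreover have "\<forall>\<^sub>F n in sequentially. i n < J n \<and> w n (i n) > 0"
          using ev_i by eventually_elim (auto simp: c_def)
        ultimately have "(\<lambda>n. \<phi> n (i n)) \<longlonglongrightarrow> \<phi>l \<tau>"
          using h2 \<tau>pos \<tau>T False by blast
        then show ?thesis using \<Phi>i Lim_transform_eventually convergentI by fast
      next
        case True
        have lim: "(Q \<longlongrightarrow> Qm \<tau>) (at_left \<tau>)" using Qm True \<tau>pos \<tau>T by blast
        have "\<forall>\<^sub>F u in at_left \<tau>. u \<in> {0<..<\<tau>}" using \<tau>pos by (rule eventually_at_left_real)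
        then have "\<forall>\<^sub>F u in at_left \<tau>. Q u \<le> v" by eventually_elim (use below in \<open>auto intro: less_imp_le\<close>)
        then have "Qm \<tau> \<le> v" using lim by (intro tendsto_upperbound[OF lim]) auto
        moreover have "v \<noteq> Qm \<tau>" "v \<noteq> Q \<tau>" using v True by (auto simp: bad_def)
        ultimately have 1: "Qm \<tau> < v" "v < Q \<tau>" using Q\<tau> by auto
        obtain k where k: "\<forall>\<^sub>F n in sequentially. k n < J n" "(\<lambda>n. c n (k n)) \<longlonglongrightarrow> Qm \<tau>"
          "(\<lambda>n. c n (Suc (k n))) \<longlonglongrightarrow> Q \<tau>" "(\<lambda>n. \<phi> n (k n)) \<longlonglongrightarrow> \<phi>l \<tau>"
          using h1[OF True \<tau>pos \<tau>T] 1 unfolding c_def by force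
        \<comment> \<open>\<open>v\<close> lies strictly between the limits of the cumulative
          weights before and after index \<open>k n\<close>, so \<open>k n\<close> is eventually the
          crossing index.\<close>
        have "\<forall>\<^sub>F n in sequentially. c n (k n) < v" "\<forall>\<^sub>F n in sequentially. v < c n (Suc (k n))"
          using order_tendstoD(2)[OF k(2)] order_tendstoD(1)[OF k(3)] 1 by auto
        with k(1) have "\<forall>\<^sub>F n in sequentially. \<phi> n (k n) = \<Phi> n v"
          by eventually_elim (use \<Phi>_eq in auto)
        then show ?thesis using k(4) Lim_transform_eventually convergentI by fast
      qed
    qed
  qed
  have C: "\<bar>\<Phi> n v\<bar> \<le> \<bar>C\<bar> * indicat_real {0..c n (J n)} v" for n v
  proof (cases "0 < v \<and> v \<le> c n (J n)")
    case True
    then obtain i where "i < J n" "c n i < v" "v \<le> c n (Suc i)" using idx by blast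
    then show ?thesis using \<Phi>_eq[of i n v] \<phi>[of i n] True by auto
  next
    case False
    then show ?thesis using \<Phi>_zero[of v n] by auto
  qed
  obtain B where B: "\<And>n. \<bar>c n (J n)\<bar> \<le> B"
    using convergent_imp_Bseq[OF convergentI[OF QT]] unfolding Bseq_def by auto
  have ind: "integrable lborel (indicat_real {a<..b})" for a b :: real
    by (cases "a \<le> b") (simp_all add: integrable_indicator_iff)
  have int_\<Phi>: "(\<integral>v. \<Phi> n v \<partial>lborel) = (\<Sum>i<J n. \<phi> n i * w n i)" for n
  proof -
    have "(\<integral>v. \<Phi> n v \<partial>lborel) = (\<Sum>i<J n. \<integral>v. \<phi> n i * indicat_real {c n i<..c n (Suc i)} v \<partial>lborel)"
      unfolding \<Phi>_def by (intro Bochner_Integration.integral_sum) (auto simp: ind)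
    also have "\<dots> = (\<Sum>i<J n. \<phi> n i * w n i)"
    proof (intro sum.cong refl)
      fix i assume i: "i \<in> {..<J n}"
      show "(\<integral>v. \<phi> n i * indicat_real {c n i<..c n (Suc i)} v \<partial>lborel) = \<phi> n i * w n i"
        using w i by (simp add: c_def ind)
    qed
    finally show ?thesis .
  qed
  have meas[measurable]: "\<Phi> n \<in> borel_measurable lborel" for n
    unfolding \<Phi>_def by measurable
  \<comment> \<open>The total weights converge, so \<open>B\<close> bounds them all and every
    \<open>\<Phi> n\<close> lives on the fixed interval \<open>{0..B}\<close>.\<close>
  have "(\<lambda>n. \<integral>v. \<Phi> n v \<partial>lborel) \<longlonglongrightarrow> (\<integral>v. lim (\<lambda>n. \<Phi> n v) \<partial>lborel)"
  proof (rule integral_dominated_convergence[where w = "\<lambda>v. \<bar>C\<bar> * indicat_real {0..B} v"])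
    show "AE v in lborel. (\<lambda>n. \<Phi> n v) \<longlonglongrightarrow> lim (\<lambda>n. \<Phi> n v)"
    proof (rule AE_I')
      show "bad \<in> null_sets lborel" using \<open>countable bad\<close> by (rule countable_imp_null_set_lborel)
      show "{v \<in> space lborel. \<not> (\<lambda>n. \<Phi> n v) \<longlonglongrightarrow> lim (\<lambda>n. \<Phi> n v)} \<subseteq> bad"
        using conv convergent_LIMSEQ_iff by blast
    qed
    show "AE v in lborel. norm (\<Phi> n v) \<le> \<bar>C\<bar> * indicat_real {0..B} v" for n
    proof (rule AE_I2)
      fix v
      have "indicat_real {0..c n (J n)} v \<le> indicat_real {0..B} v"
        using B[of n] by (auto simp: indicator_def)
      then show "norm (\<Phi> n v) \<le> \<bar>C\<bar> * indicat_real {0..B} v"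
        using C[of n v] mult_left_mono[of _ _ "\<bar>C\<bar>"] by (force intro: order_trans)
    qed
    have "B \<ge> 0" using B[of 0] by simp
    then show "integrable lborel (\<lambda>v. \<bar>C\<bar> * indicat_real {0..B} v)"
      by (simp add: integrable_indicator_iff)
  qed (auto intro: borel_measurable_lim_metric)
  then show ?thesis unfolding int_\<Phi> by (rule convergentI)
qed

section \<open>Stopped paths and partitions\<close>

lemma left_lim_eqI:
  fixes x :: "real \<Rightarrow> 'a::t2_space"
  assumes "t > 0" "(x \<longlongrightarrow> l) (at_left t)"
  shows "left_lim x t = l"
  using assms tendsto_Lim[OF _ assms(2)] by (simp add: left_lim_def)

lemma left_lim_cong:
  fixes x y :: "real \<Rightarrow> 'a::t2_space"
  assumes "t > 0" "a < t" "\<And>s. a < s \<Longrightarrow> s < t \<Longrightarrow> x s = y s"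
  shows "left_lim x t = left_lim y t"
proof -
  have "\<forall>\<^sub>F s in at_left t. s \<in> {a<..<t}" using assms(2) by (rule eventually_at_left_real)
  then have "\<forall>\<^sub>F s in at_left t. x s = y s" by eventually_elim (use assms in auto)
  then have "(x \<longlongrightarrow> l) (at_left t) \<longleftrightarrow> (y \<longlongrightarrow> l) (at_left t)" for l
    by (rule tendsto_cong)
  then show ?thesis using assms(1) by (simp add: left_lim_def Topological_Spaces.Lim_def)
qed

lemma left_lim_tendsto:
  assumes "cadlag x" "t > 0"
  shows "(x \<longlongrightarrow> left_lim x t) (at_left t)"
  using assms left_lim_eqI unfolding cadlag_def by metis

lemma left_lim_const:
  fixes x :: "real \<Rightarrow> 'a::t2_space"
  assumes "t > 0" "a < t" "\<And>s. a < s \<Longrightarrow> s < t \<Longrightarrow> x s = c"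
  shows "left_lim x t = c"
proof -
  have "left_lim x t = left_lim (\<lambda>_. c) t" by (rule left_lim_cong[of t a]) (use assms in auto)
  also have "\<dots> = c" by (rule left_lim_eqI) (use assms in auto)
  finally show ?thesis .
qed

lemma stop_stop [simp]: "stop s (stop t x) = stop (min s t) x"
  by (auto simp: stop_def min.assoc)

lemma left_lim_stop:
  assumes "0 \<le> s" "s \<le> t"
  shows "left_lim (stop t x) s = left_lim x s"
proof (cases "s = 0")
  case True
  then show ?thesis using assms by (simp add: left_lim_def stop_def)
next
  case False
  then show ?thesis using assms by (intro left_lim_cong[of s "s - 1"]) (auto simp: stop_def)
qed

lemma stop_left_stop: "0 \<le> s \<Longrightarrow> s \<le> t \<Longrightarrow> stop_left s (stop t x) = stop_left s x"
  by (rule ext) (auto simp: stop_left_def left_lim_stop, auto simp: stop_def)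

lemma left_lim_stop_left [simp]:
  assumes "0 \<le> t"
  shows "left_lim (stop_left t x) t = left_lim x t"
proof (cases "t = 0")
  case True
  then show ?thesis by (simp add: left_lim_def stop_left_def)
next
  case False
  then show ?thesis using assms by (intro left_lim_cong[of t "t - 1"]) (auto simp: stop_left_def)
qed

lemma stop_left_stop_left [simp]:
  assumes "0 \<le> t"
  shows "stop_left t (stop_left t x) = stop_left t x"
proof
  fix s
  show "stop_left t (stop_left t x) s = stop_left t x s"
    using left_lim_stop_left[OF assms, of x] by (auto simp: stop_left_def)
qed

lemma stop_stop_left [simp]: "stop t (stop_left t x) = stop_left t x"
  by (auto simp: stop_def stop_left_def min_def)

lemma stop_left_0: "stop_left 0 x = stop 0 x"
  by (auto simp: stop_left_def left_lim_def stop_def fun_eq_iff min_def)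

lemma stop_left_const:
  assumes "stop a x = x" "0 \<le> a" "a < s"
  shows "stop_left s x = x"
proof
  fix u
  have eq: "x u = x a" if "u \<ge> a" for u
    using fun_cong[OF assms(1), of u] that by (simp add: stop_def min_def split: if_splits)
  have "left_lim x s = x a"
    by (rule left_lim_const[of s a]) (use assms(2,3) in \<open>auto intro: eq\<close>)
  moreover have "x u = x a" if "\<not> u < s" using that assms(3) by (intro eq) simp
  ultimately show "stop_left s x u = x u" by (auto simp: stop_left_def)
qed

lemma stop_mono: "stop a x = x \<Longrightarrow> a \<le> b \<Longrightarrow> stop b x = x"
  by (metis min.absorb2 stop_stop)

lemma bump_0 [simp]: "bump t 0 y = y"
  by (simp add: bump_def)

lemma bump_bump: "bump t a (bump t b y) = bump t (b + a) y"
  by (simp add: bump_def scaleR_add_right add.assoc)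

lemma stop_bump: "stop t (bump t e y) = bump t e (stop t y)"
  by (auto simp: stop_def bump_def fun_eq_iff indicator_def)

lemma stop_left_eq_bump: "stop_left t x = bump t (- jump x t) (stop t x)"
  by (auto simp: stop_left_def bump_def jump_def stop_def fun_eq_iff)

lemma stop_eq_bump: "stop t x = bump t (jump x t) (stop_left t x)"
  by (auto simp: stop_left_def bump_def jump_def stop_def fun_eq_iff)

lemma jump_stop: "0 \<le> t \<Longrightarrow> jump (stop t x) t = jump x t"
  by (simp add: jump_def left_lim_stop) (simp add: stop_def)

section \<open>Indices of the partition points around a time\<close>

locale partitions =
  fixes \<pi> :: "nat \<Rightarrow> real list"
  assumes partition: "partition_seq \<pi>"
begin

definition tp :: "nat \<Rightarrow> nat \<Rightarrow> real" where "tp n i = \<pi> n ! i"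
definition kk :: "nat \<Rightarrow> nat" where "kk n = length (\<pi> n) - 1"

lemma tp_0 [simp]: "tp n 0 = 0"
  using partition unfolding partition_seq_def tp_def by (metis hd_conv_nth)

lemma tp_less: "i < j \<Longrightarrow> j \<le> kk n \<Longrightarrow> tp n i < tp n j"
  using partition unfolding partition_seq_def tp_def kk_def
  by (metis sorted_wrt_nth_less Suc_pred diff_Suc_1 length_greater_0_conv less_Suc_eq_le)

lemma tp_le: "i \<le> j \<Longrightarrow> j \<le> kk n \<Longrightarrow> tp n i \<le> tp n j"
  using tp_less by (cases "i = j") (auto simp: less_imp_le)

lemma tp_less_iff: "i \<le> kk n \<Longrightarrow> j \<le> kk n \<Longrightarrow> tp n i < tp n j \<longleftrightarrow> i < j"
  by (meson tp_le tp_less not_less)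

lemma tp_nonneg: "i \<le> kk n \<Longrightarrow> 0 \<le> tp n i"
  using tp_le[of 0 i n] by simp

lemma set_partition: "set (\<pi> n) = tp n ` {..kk n}"
proof -
  have "\<pi> n \<noteq> []" using partition unfolding partition_seq_def by blast
  then have "{..<length (\<pi> n)} = {..kk n}" unfolding kk_def by (cases "\<pi> n") auto
  then show ?thesis unfolding tp_def by (metis atLeast0LessThan atLeast_upt map_nth set_map)
qed

lemma eventually_last: "\<forall>\<^sub>F n in sequentially. T < tp n (kk n)"
proof -
  have "last (\<pi> n) = tp n (kk n)" for n
    using partition unfolding partition_seq_def tp_def kk_def by (metis last_conv_nth)
  then have "filterlim (\<lambda>n. tp n (kk n)) at_top sequentially"
    using partition unfolding partition_seq_def by simp
  then show ?thesis by (simp add: filterlim_at_top_dense)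
qed

lemma eventually_kk_pos: "\<forall>\<^sub>F n in sequentially. 0 < kk n"
  using eventually_last[of 0] by eventually_elim (metis gr0I less_irrefl tp_0)

lemma eventually_mesh:
  assumes "\<epsilon> > 0"
  shows "\<forall>\<^sub>F n in sequentially. \<forall>i<kk n. min (tp n (Suc i)) T - min (tp n i) T < \<epsilon>"
proof (cases "T > 0")
  case True
  then show ?thesis using partition assms unfolding partition_seq_def tp_def kk_def by blast
next
  case False
  have "min (tp n (Suc i)) T - min (tp n i) T < \<epsilon>" if "i < kk n" for n i
    using False assms tp_nonneg[of i n] tp_nonneg[of "Suc i" n] that by auto
  then show ?thesis by simp
qed

text \<open>The mesh is small only after truncation at a fixed time. Truncating at
  \<open>a > t\<close> suffices: an interval that starts near \<open>t\<close> and reaches beyond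
  \<open>a\<close> would keep truncated length above \<open>(a - t) / 2\<close>.\<close>

lemma mesh_Suc:
  assumes "\<forall>\<^sub>F n in sequentially. i n < kk n" "(\<lambda>n. tp n (i n)) \<longlonglongrightarrow> t"
  shows "(\<lambda>n. tp n (Suc (i n))) \<longlonglongrightarrow> t"
proof (rule order_tendstoI)
  fix a assume "a < t"
  then have "\<forall>\<^sub>F n in sequentially. a < tp n (i n)" by (rule order_tendstoD(1)[OF assms(2)])
  then show "\<forall>\<^sub>F n in sequentially. a < tp n (Suc (i n))"
    using assms(1) by eventually_elim (use less_trans tp_less[OF lessI Suc_leI] in blast)
next
  fix a assume a: "t < a"
  have "\<forall>\<^sub>F n in sequentially. tp n (i n) < (t + a) / 2"
    using a by (intro order_tendstoD(2)[OF assms(2)]) auto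
  moreover have "\<forall>\<^sub>F n in sequentially. \<forall>i<kk n. min (tp n (Suc i)) a - min (tp n i) a < (a - t) / 2"
    using a by (intro eventually_mesh) auto
  ultimately show "\<forall>\<^sub>F n in sequentially. tp n (Suc (i n)) < a"
    using assms(1)
  proof eventually_elim
    case (elim n)
    then have "min (tp n (Suc (i n))) a - min (tp n (i n)) a < (a - t) / 2" by blast
    then show ?case using elim(1) a by (auto simp: min_def field_simps split: if_splits)
  qed
qed

lemma mesh_pred:
  assumes "\<forall>\<^sub>F n in sequentially. i n < kk n" "(\<lambda>n. tp n (Suc (i n))) \<longlonglongrightarrow> t"
  shows "(\<lambda>n. tp n (i n)) \<longlonglongrightarrow> t"
proof (rule order_tendstoI)
  fix a assume "t < a"
  then have "\<forall>\<^sub>F n in sequentially. tp n (Suc (i n)) < a" by (rule order_tendstoD(2)[OF assms(2)])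
  then show "\<forall>\<^sub>F n in sequentially. tp n (i n) < a"
    using assms(1) by eventually_elim (use less_trans tp_less[OF lessI Suc_leI] in blast)
next
  fix a assume a: "a < t"
  have "\<forall>\<^sub>F n in sequentially. (t + a) / 2 < tp n (Suc (i n))" "\<forall>\<^sub>F n in sequentially. tp n (Suc (i n)) < t + 1"
    using a by (intro order_tendstoD[OF assms(2)]; simp)+
  moreover have "\<forall>\<^sub>F n in sequentially. \<forall>i<kk n. min (tp n (Suc i)) (t + 1) - min (tp n i) (t + 1) < (t - a) / 2"
    using a by (intro eventually_mesh) auto
  ultimately show "\<forall>\<^sub>F n in sequentially. a < tp n (i n)"
    using assms(1)
  proof eventually_elim
    case (elim n)
    then have "min (tp n (Suc (i n))) (t + 1) - min (tp n (i n)) (t + 1) < (t - a) / 2" by blast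
    moreover have "tp n (i n) < tp n (Suc (i n))" using elim by (intro tp_less) auto
    ultimately show ?case using elim by (auto simp: min_def field_simps split: if_splits)
  qed
qed

text \<open>\<open>lo n u\<close> is the index of the interval
  \<open>[t\<^sub>i, t\<^sub>i\<^sub>+\<^sub>1)\<close> containing \<open>u\<close>, the relevant
  one for \<open>x\<^sup>n\<close> stopped at \<open>u\<close>; \<open>lb n u\<close> is that of
  \<open>(t\<^sub>i, t\<^sub>i\<^sub>+\<^sub>1]\<close>, relevant for stopping just before
  \<open>u\<close>, and \<open>t'\<^sub>n\<close> is the point with index \<open>lb n t\<close>. The
  inserted 0 is the default when no point precedes \<open>u\<close>.\<close>

definition lo :: "nat \<Rightarrow> real \<Rightarrow> nat" where "lo n u = Max {i. i \<le> kk n \<and> tp n i \<le> u}"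
definition lb :: "nat \<Rightarrow> real \<Rightarrow> nat" where "lb n u = Max (insert 0 {i. i \<le> kk n \<and> tp n i < u})"

lemma lo_props:
  assumes "0 \<le> u" "u < tp n (kk n)"
  shows "lo n u < kk n" "tp n (lo n u) \<le> u" "u < tp n (Suc (lo n u))"
proof -
  let ?S = "{i. i \<le> kk n \<and> tp n i \<le> u}"
  have f: "finite ?S" "0 \<in> ?S" using assms by auto
  have *: "lo n u \<in> ?S" unfolding lo_def using f by (intro Max_in) auto
  have **: "i \<le> lo n u" if "i \<in> ?S" for i unfolding lo_def using f that by (intro Max_ge) auto
  show "tp n (lo n u) \<le> u" using * by auto
  show less: "lo n u < kk n" using * assms(2) by (cases "lo n u = kk n") auto
  show "u < tp n (Suc (lo n u))" using **[of "Suc (lo n u)"] less by fastforce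
qed

lemma lb_props:
  assumes "0 < u" "u \<le> tp n (kk n)"
  shows "lb n u < kk n" "tp n (lb n u) < u" "u \<le> tp n (Suc (lb n u))"
proof -
  let ?S = "{i. i \<le> kk n \<and> tp n i < u}"
  have f: "finite ?S" "0 \<in> ?S" using assms by auto
  then have eq: "lb n u = Max ?S" by (simp add: lb_def insert_absorb)
  moreover have "Max ?S \<in> ?S" using f by (intro Max_in) auto
  ultimately have *: "lb n u \<in> ?S" by simp
  have **: "i \<le> lb n u" if "i \<in> ?S" for i
    unfolding eq using f that by (intro Max_ge) auto
  show "tp n (lb n u) < u" using * by auto
  show less: "lb n u < kk n" using * assms(2) by (cases "lb n u = kk n") auto
  show "u \<le> tp n (Suc (lb n u))" using **[of "Suc (lb n u)"] less by fastforce
qed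

lemma lo_unique:
  assumes "i < kk n" "tp n i \<le> u" "u < tp n (Suc i)"
  shows "lo n u = i"
proof -
  have l: "u < tp n (kk n)" using tp_le[of "Suc i" "kk n" n] assms by auto
  have "0 \<le> u" using tp_nonneg[of i n] assms by auto
  note lo = lo_props[OF this l]
  have "tp n i < tp n (Suc (lo n u))" "tp n (lo n u) < tp n (Suc i)" using lo assms by linarith+
  then show ?thesis using lo assms tp_less_iff[of i n "Suc (lo n u)"] tp_less_iff[of "lo n u" n "Suc i"] by auto
qed

lemma lb_unique:
  assumes "i < kk n" "tp n i < u" "u \<le> tp n (Suc i)"
  shows "lb n u = i"
proof -
  have l: "u \<le> tp n (kk n)" using tp_le[of "Suc i" "kk n" n] assms by auto
  have "0 < u" using tp_nonneg[of i n] assms by auto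
  note lo = lb_props[OF this l]
  have "tp n i < tp n (Suc (lb n u))" "tp n (lb n u) < tp n (Suc i)" using lo assms by linarith+
  then show ?thesis using lo assms tp_less_iff[of i n "Suc (lb n u)"] tp_less_iff[of "lb n u" n "Suc i"] by auto
qed

lemma last_before_eq: "last_before \<pi> n t = tp n (lb n t)"
proof -
  let ?S = "{i. i \<le> kk n \<and> tp n i < t}"
  have "{s \<in> set (\<pi> n). s < t} = tp n ` ?S" unfolding set_partition by auto
  then have eq: "insert 0 {s \<in> set (\<pi> n). s < t} = tp n ` insert 0 ?S" by simp
  have "Max (tp n ` insert 0 ?S) = tp n (Max (insert 0 ?S))"
  proof (rule Max_eqI)
    show "tp n (Max (insert 0 ?S)) \<in> tp n ` insert 0 ?S" by (rule imageI, rule Max_in) auto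
    have "Max (insert 0 ?S) \<le> kk n" by (subst Max_le_iff) auto
    moreover have "i \<le> Max (insert 0 ?S)" if "i \<in> insert 0 ?S" for i using that by (intro Max_ge) auto
    ultimately show "y \<le> tp n (Max (insert 0 ?S))" if "y \<in> tp n ` insert 0 ?S" for y
      using that tp_le by blast
  qed auto
  then show ?thesis unfolding last_before_def lb_def using eq by simp
qed

lemma lb_le: "lb n t \<le> kk n"
  unfolding lb_def by (subst Max_le_iff) auto

lemma last_before_nonneg: "0 \<le> last_before \<pi> n t"
  unfolding last_before_eq by (intro tp_nonneg lb_le)

lemma last_before_0 [simp]: "last_before \<pi> n 0 = 0"
proof -
  have "{i. i \<le> kk n \<and> tp n i < 0} = {}" using tp_nonneg by (auto simp: not_less)
  then show ?thesis by (simp only: last_before_eq lb_def) simp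
qed

lemma eventually_lo:
  assumes "u \<longlonglongrightarrow> t" "\<forall>\<^sub>F n in sequentially. 0 \<le> u n"
  shows "\<forall>\<^sub>F n in sequentially. lo n (u n) < kk n \<and> tp n (lo n (u n)) \<le> u n \<and> u n < tp n (Suc (lo n (u n)))"
proof -
  have "\<forall>\<^sub>F n in sequentially. u n < t + 1" by (rule order_tendstoD(2)[OF assms(1)]) simp
  with assms(2) eventually_last[of "t + 1"] show ?thesis
    by eventually_elim (use lo_props in force)
qed

lemma eventually_lb:
  assumes "u \<longlonglongrightarrow> t" "\<forall>\<^sub>F n in sequentially. 0 < u n"
  shows "\<forall>\<^sub>F n in sequentially. lb n (u n) < kk n \<and> tp n (lb n (u n)) < u n \<and> u n \<le> tp n (Suc (lb n (u n)))"
proof -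
  have "\<forall>\<^sub>F n in sequentially. u n < t + 1" by (rule order_tendstoD(2)[OF assms(1)]) simp
  with assms(2) eventually_last[of "t + 1"] show ?thesis
    by eventually_elim (use lb_props in force)
qed

lemma between_tendsto:
  assumes i: "\<forall>\<^sub>F n in sequentially. i n < kk n \<and> tp n (i n) \<le> u n \<and> u n \<le> tp n (Suc (i n))"
    and u: "u \<longlonglongrightarrow> t"
  shows "(\<lambda>n. tp n (i n)) \<longlonglongrightarrow> t"
proof (rule order_tendstoI)
  fix a assume "t < a"
  then have "\<forall>\<^sub>F n in sequentially. u n < a" by (rule order_tendstoD(2)[OF u])
  then show "\<forall>\<^sub>F n in sequentially. tp n (i n) < a" using i by eventually_elim linarith
next
  fix a assume a: "a < t"
  have "\<forall>\<^sub>F n in sequentially. (t + a) / 2 < u n" "\<forall>\<^sub>F n in sequentially. u n < t + 1"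
    using a by (intro order_tendstoD[OF u]; simp)+
  moreover have "\<forall>\<^sub>F n in sequentially. \<forall>i<kk n. min (tp n (Suc i)) (t + 1) - min (tp n i) (t + 1) < (t - a) / 2"
    using a by (intro eventually_mesh) auto
  ultimately show "\<forall>\<^sub>F n in sequentially. a < tp n (i n)"
    using i
  proof eventually_elim
    case (elim n)
    then have "min (tp n (Suc (i n))) (t + 1) - min (tp n (i n)) (t + 1) < (t - a) / 2" by blast
    then show ?case using elim by (auto simp: min_def field_simps split: if_splits)
  qed
qed

lemma lo_tendsto: "u \<longlonglongrightarrow> t \<Longrightarrow> \<forall>\<^sub>F n in sequentially. 0 \<le> u n \<Longrightarrow> (\<lambda>n. tp n (lo n (u n))) \<longlonglongrightarrow> t"
  by (rule between_tendsto[OF eventually_mono[OF eventually_lo]]) auto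

lemma lb_tendsto: "u \<longlonglongrightarrow> t \<Longrightarrow> \<forall>\<^sub>F n in sequentially. 0 < u n \<Longrightarrow> (\<lambda>n. tp n (lb n (u n))) \<longlonglongrightarrow> t"
  by (rule between_tendsto[OF eventually_mono[OF eventually_lb]]) auto

lemma last_before_tendsto: "t \<ge> 0 \<Longrightarrow> (\<lambda>n. last_before \<pi> n t) \<longlonglongrightarrow> t"
  using lb_tendsto[of "\<lambda>_. t" t] by (cases "t = 0") (auto simp flip: last_before_eq)

lemma lo_0: "\<forall>\<^sub>F n in sequentially. lo n 0 = 0"
  using eventually_kk_pos
proof eventually_elim
  case (elim n)
  then show ?case using tp_less[of 0 1 n] by (intro lo_unique) auto
qed

lemma eventually_lo_const:
  "t \<ge> 0 \<Longrightarrow> \<forall>\<^sub>F n in sequentially. lo n t < kk n \<and> tp n (lo n t) \<le> t \<and> t < tp n (Suc (lo n t))"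
  using eventually_lo[of "\<lambda>_. t" t] by simp

lemma eventually_lb_const:
  "t > 0 \<Longrightarrow> \<forall>\<^sub>F n in sequentially. lb n t < kk n \<and> tp n (lb n t) < t \<and> t \<le> tp n (Suc (lb n t))"
  using eventually_lb[of "\<lambda>_. t" t] by simp

lemma last_before_le_lo: "t \<ge> 0 \<Longrightarrow> \<forall>\<^sub>F n in sequentially. last_before \<pi> n t \<le> tp n (lo n t)"
proof (cases "t = 0")
  case False
  assume "t \<ge> 0"
  with False eventually_lo_const[of t] eventually_lb_const[of t] have
    "\<forall>\<^sub>F n in sequentially. lo n t < kk n \<and> tp n (lo n t) \<le> t \<and> t < tp n (Suc (lo n t))"
    "\<forall>\<^sub>F n in sequentially. lb n t < kk n \<and> tp n (lb n t) < t \<and> t \<le> tp n (Suc (lb n t))" by auto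
  then show ?thesis unfolding last_before_eq
  proof eventually_elim
    case (elim n)
    then have "lb n t < Suc (lo n t)" using tp_less_iff[of "lb n t" n "Suc (lo n t)"] by simp
    then show ?case using elim by (intro tp_le) auto
  qed
qed (use lo_0 in \<open>auto elim!: eventually_mono\<close>)

text \<open>The point before \<open>t'\<^sub>n\<close> is a partition time strictly below
  \<open>t'\<^sub>n\<close> that still tends to \<open>t\<close>; it serves as the reference
  sequence for left limits. Truncated subtraction is harmless because \<open>lb n t\<close> is
  eventually positive.\<close>

lemma lb_pred:
  assumes t: "t > 0"
  shows "\<forall>\<^sub>F n in sequentially. 0 < lb n t \<and> lb n t < kk n" "(\<lambda>n. tp n (lb n t - 1)) \<longlonglongrightarrow> t"
proof -
  have kk: "\<forall>\<^sub>F n in sequentially. lb n t < kk n"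
    using eventually_lb[of "\<lambda>_. t" t] t by (auto elim: eventually_mono)
  have l: "(\<lambda>n. tp n (lb n t)) \<longlonglongrightarrow> t" using lb_tendsto[of "\<lambda>_. t" t] t by simp
  have "\<forall>\<^sub>F n in sequentially. 0 < tp n (lb n t)" by (rule order_tendstoD(1)[OF l t])
  then have pos: "\<forall>\<^sub>F n in sequentially. 0 < lb n t" by eventually_elim (metis gr0I less_irrefl tp_0)
  then show "\<forall>\<^sub>F n in sequentially. 0 < lb n t \<and> lb n t < kk n" using kk by eventually_elim simp
  show "(\<lambda>n. tp n (lb n t - 1)) \<longlonglongrightarrow> t"
  proof (rule mesh_pred)
    show "\<forall>\<^sub>F n in sequentially. lb n t - 1 < kk n" using kk by eventually_elim simp
    show "(\<lambda>n. tp n (Suc (lb n t - 1))) \<longlonglongrightarrow> t"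
      using l by (rule Lim_transform_eventually) (use pos in \<open>eventually_elim, simp\<close>)
  qed
qed

lemma tp_lb_nonneg [simp]: "0 \<le> tp n (lb n t)"
  by (intro tp_nonneg lb_le)

lemma last_before_less: "t > 0 \<Longrightarrow> last_before \<pi> n t < t"
  unfolding last_before_def by (subst Max_less_iff) auto

lemma last_before_le: "t \<ge> 0 \<Longrightarrow> last_before \<pi> n t \<le> t"
  using last_before_less[of t n] by (cases "t = 0") auto

section \<open>The piecewise constant approximations\<close>

definition dx :: "'m::finite path \<Rightarrow> nat \<Rightarrow> nat \<Rightarrow> real ^ 'm" where
  "dx x n i = x (tp n (Suc i)) - x (tp n i)"

lemma pw_const_eq:
  assumes "i < kk n" "tp n i \<le> s" "s < tp n (Suc i)"
  shows "pw_const \<pi> n x s = x (tp n (Suc i))"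
proof -
  have "indicat_real {tp n j..<tp n (Suc j)} s *\<^sub>R x (tp n (Suc j)) = (if j = i then x (tp n (Suc i)) else 0)"
    if "j < kk n" for j
  proof -
    have "s \<in> {tp n j..<tp n (Suc j)} \<longleftrightarrow> j = i"
      using lo_unique[OF assms] lo_unique[OF that, of s] assms by fastforce
    then show ?thesis by (simp add: indicator_def)
  qed
  then have "(\<Sum>j<kk n. indicat_real {tp n j..<tp n (Suc j)} s *\<^sub>R x (tp n (Suc j)))
     = (\<Sum>j<kk n. if j = i then x (tp n (Suc i)) else 0)" by (intro sum.cong) auto
  then show ?thesis using assms(1) unfolding pw_const_def tp_def kk_def by simp
qed

lemma pw_const_neg: "s < 0 \<Longrightarrow> pw_const \<pi> n x s = 0"
proof -
  assume s: "s < 0"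
  have "indicat_real {tp n j..<tp n (Suc j)} s *\<^sub>R x (tp n (Suc j)) = 0" if "j < kk n" for j
    using s tp_nonneg[of j n] that by auto
  then have "(\<Sum>j<kk n. indicat_real {tp n j..<tp n (Suc j)} s *\<^sub>R x (tp n (Suc j))) = 0"
    by (intro sum.neutral) auto
  then show ?thesis unfolding pw_const_def tp_def kk_def by simp
qed

lemma stop_pw_const:
  assumes "i < kk n" "tp n i \<le> u" "u < tp n (Suc i)"
  shows "stop u (pw_const \<pi> n x) = stop (tp n i) (pw_const \<pi> n x)"
proof
  fix s
  show "stop u (pw_const \<pi> n x) s = stop (tp n i) (pw_const \<pi> n x) s"
    using pw_const_eq[OF assms(1), of _ x] assms tp_less[of i "Suc i" n] by (cases "s \<le> tp n i") (auto simp: stop_def min_def)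
qed

lemma left_lim_pw_const:
  assumes "i < kk n" "tp n i < u" "u \<le> tp n (Suc i)"
  shows "left_lim (pw_const \<pi> n x) u = x (tp n (Suc i))"
  using pw_const_eq[OF assms(1), of _ x] assms tp_nonneg[of i n]
  by (intro left_lim_const[of u "tp n i"]) auto

lemma stop_left_pw_const:
  assumes "i < kk n" "tp n i < u" "u \<le> tp n (Suc i)"
  shows "stop_left u (pw_const \<pi> n x) = stop (tp n i) (pw_const \<pi> n x)"
proof
  fix s
  show "stop_left u (pw_const \<pi> n x) s = stop (tp n i) (pw_const \<pi> n x) s"
    using pw_const_eq[OF assms(1), of _ x] assms tp_less[of i "Suc i" n] left_lim_pw_const[OF assms, of x]
    by (cases "s \<le> tp n i") (auto simp: stop_def stop_left_def min_def)
qed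

text \<open>\<open>x\<^sup>n\<close> takes the value of \<open>x\<close> at the right end of each
  interval, so its jump at a partition point is the increment of \<open>x\<close> over the interval
  that begins there. Index 0 is excluded: \<open>x\<^sup>n\<close> does not jump at time 0.\<close>

lemma jump_pw_const:
  assumes "Suc i < kk n"
  shows "jump (pw_const \<pi> n x) (tp n (Suc i)) = dx x n (Suc i)"
  using assms left_lim_pw_const[of i n "tp n (Suc i)" x] pw_const_eq[of "Suc i" n "tp n (Suc i)" x]
  by (auto simp: jump_def dx_def tp_less)

lemma stop_Suc_pw_const:
  assumes "Suc i < kk n"
  shows "stop (tp n (Suc i)) (pw_const \<pi> n x) =
    bump (tp n (Suc i)) (dx x n (Suc i)) (stop (tp n i) (pw_const \<pi> n x))"
  using stop_eq_bump[of "tp n (Suc i)" "pw_const \<pi> n x"] stop_left_pw_const[of i n "tp n (Suc i)" x]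
    jump_pw_const[OF assms, of x] assms by (simp add: tp_less)

text \<open>Before \<open>t\<^sub>i\<close> the path \<open>x\<^sup>n\<close> depends on \<open>x(t\<^sub>1), \<dots>, x(t\<^sub>i)\<close> only; this fails for \<open>i = 0\<close>,
  where \<open>x\<^sup>n\<^sub>0\<^sub>- = x(t\<^sub>1)\<close>.\<close>

lemma stop_left_pw_const_cong:
  assumes "0 < i" "i \<le> kk n" "\<And>s. 0 \<le> s \<Longrightarrow> s \<le> tp n i \<Longrightarrow> x s = y s"
  shows "stop_left (tp n i) (pw_const \<pi> n x) = stop_left (tp n i) (pw_const \<pi> n y)"
proof -
  have pw: "pw_const \<pi> n x s = pw_const \<pi> n y s" if s: "s < tp n i" for s
  proof (cases "s < 0")
    case False
    have "tp n i \<le> tp n (kk n)" using assms by (intro tp_le) auto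
    then have l: "lo n s < kk n" "tp n (lo n s) \<le> s" "s < tp n (Suc (lo n s))"
      using lo_props[of s n] s False by auto
    then have "lo n s < i" using s assms(2) tp_less_iff[of "lo n s" n i] by auto
    then have "x (tp n (Suc (lo n s))) = y (tp n (Suc (lo n s)))"
      using assms by (intro assms(3) tp_nonneg tp_le) auto
    then show ?thesis using pw_const_eq[OF l, of x] pw_const_eq[OF l, of y] by simp
  qed (simp add: pw_const_neg)
  have "0 < tp n i" using assms tp_less[of 0 i n] by simp
  then have "left_lim (pw_const \<pi> n x) (tp n i) = left_lim (pw_const \<pi> n y) (tp n i)"
    using pw by (intro left_lim_cong[of _ 0]) auto
  then show ?thesis using pw by (auto simp: stop_left_def)
qed

end

section \<open>Quadratic variation along partitions\<close>

lemma tendsto_at_right_sequence: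
  fixes f :: "real \<Rightarrow> 'b::metric_space"
  assumes f: "(f \<longlongrightarrow> f t) (at_right t)" and u: "u \<longlonglongrightarrow> t" "\<forall>\<^sub>F n in sequentially. t \<le> u n"
  shows "(\<lambda>n. f (u n)) \<longlonglongrightarrow> f t"
proof (rule tendstoI)
  fix e :: real assume e: "e > 0"
  obtain b where b: "b > t" "\<And>y. t < y \<Longrightarrow> y < b \<Longrightarrow> dist (f y) (f t) < e"
    using tendstoD[OF f e] unfolding eventually_at_right_field by auto
  have "\<forall>\<^sub>F n in sequentially. u n < b" by (rule order_tendstoD(2)[OF u(1) b(1)])
  then show "\<forall>\<^sub>F n in sequentially. dist (f (u n)) (f t) < e" using u(2)
  proof eventually_elim
    case (elim n)
    then show ?case using b(2)[of "u n"] e by (cases "u n = t") auto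
  qed
qed

lemma tendsto_at_left_sequence:
  fixes f :: "real \<Rightarrow> 'b::metric_space"
  assumes f: "(f \<longlongrightarrow> l) (at_left t)" and u: "u \<longlonglongrightarrow> t" "\<forall>\<^sub>F n in sequentially. u n < t"
  shows "(\<lambda>n. f (u n)) \<longlonglongrightarrow> l"
  by (rule filterlim_compose[OF f]) (use u in \<open>auto simp: filterlim_at elim: eventually_mono\<close>)

section \<open>Rank-one matrices and their quadratic forms\<close>

definition outer :: "real ^ 'm::finite \<Rightarrow> real ^ 'm ^ 'm" where
  "outer d = (\<chi> j k. d $ j * d $ k)"

lemma inner_outer: "A \<bullet> outer d = d \<bullet> (A *v d)"
  by (simp add: outer_def inner_vec_def matrix_vector_mult_def sum_distrib_left algebra_simps)

lemma outer_inner_mat_1: "outer d \<bullet> mat 1 = (norm d)\<^sup>2"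
  by (simp add: inner_commute[of "outer d"] inner_outer power2_norm_eq_inner)

lemma norm_outer: "norm (outer d) = (norm d)\<^sup>2"
proof -
  have "outer d *v d = (d \<bullet> d) *\<^sub>R d"
    by (simp add: outer_def inner_vec_def matrix_vector_mult_def vec_eq_iff sum_distrib_left sum_distrib_right algebra_simps)
  then have "outer d \<bullet> outer d = (d \<bullet> d)\<^sup>2" by (simp add: inner_outer power2_eq_square)
  then show ?thesis by (simp add: norm_eq_sqrt_inner)
qed

lemma outer_0 [simp]: "outer 0 = 0"
  by (simp add: outer_def vec_eq_iff)

lemma outer_eq_0_iff [simp]: "outer d = 0 \<longleftrightarrow> d = 0"
  by (metis norm_outer norm_eq_zero power_eq_0_iff zero_neq_numeral outer_0)

lemma tendsto_outer [tendsto_intros]: "(f \<longlongrightarrow> d) A \<Longrightarrow> ((\<lambda>n. outer (f n)) \<longlongrightarrow> outer d) A"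
  unfolding outer_def by (intro tendsto_intros)

text \<open>Pairing a squared increment with \<open>outer c\<close> gives the square of its
  component along \<open>c\<close>: a nonnegative weight, as the quantile argument requires.\<close>

lemma outer_inner_outer: "outer d \<bullet> outer c = (d \<bullet> c)\<^sup>2"
proof -
  have "outer d *v c = (d \<bullet> c) *\<^sub>R d"
    by (simp add: outer_def inner_vec_def matrix_vector_mult_def vec_eq_iff sum_distrib_left sum_distrib_right algebra_simps)
  then show ?thesis using inner_outer[of "outer d" c] by (simp add: power2_eq_square inner_commute[of c d])
qed

section \<open>Squared increments near a fixed time\<close>

locale qv_path = partitions \<pi> for \<pi> :: "nat \<Rightarrow> real list" +
  fixes x :: "'m::finite path" and V :: "real \<Rightarrow> real ^ 'm ^ 'm"
  assumes cadlag_x: "cadlag x" and J1: "J1_lim (quad_sum \<pi> x) V"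
begin

lemma cadlag_V: "cadlag V"
  using J1 by (simp add: J1_lim_def)

lemma x_right: "0 \<le> t \<Longrightarrow> (x \<longlongrightarrow> x t) (at_right t)"
  using cadlag_x by (simp add: cadlag_def)

lemma V_right: "0 \<le> t \<Longrightarrow> (V \<longlongrightarrow> V t) (at_right t)"
  using cadlag_V by (simp add: cadlag_def)

lemma quad_sum_eq: "quad_sum \<pi> x n u = (\<Sum>i | i < kk n \<and> tp n i \<le> u. outer (dx x n i))"
  by (simp add: quad_sum_def kk_def tp_def dx_def outer_def Let_def)

lemma quad_sum_lo:
  assumes "i < kk n" "tp n i \<le> u" "u < tp n (Suc i)"
  shows "quad_sum \<pi> x n u = (\<Sum>j<Suc i. outer (dx x n j))"
proof -
  have "{j. j < kk n \<and> tp n j \<le> u} = {..<Suc i}"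
  proof (intro set_eqI iffI)
    fix j assume j: "j \<in> {j. j < kk n \<and> tp n j \<le> u}"
    then have "tp n j < tp n (Suc i)" using assms by auto
    then show "j \<in> {..<Suc i}" using j assms tp_less_iff[of j n "Suc i"] by auto
  next
    fix j assume j: "j \<in> {..<Suc i}"
    then have "tp n j \<le> tp n i" using assms by (intro tp_le) auto
    then show "j \<in> {j. j < kk n \<and> tp n j \<le> u}" using j assms by auto
  qed
  then show ?thesis by (simp add: quad_sum_eq)
qed

lemma quad_sum_tp: "i < kk n \<Longrightarrow> quad_sum \<pi> x n (tp n i) = (\<Sum>j<Suc i. outer (dx x n j))"
  by (rule quad_sum_lo) (auto simp: tp_less)

lemma dx_continuous:
  assumes i: "\<forall>\<^sub>F n in sequentially. i n < kk n" "(\<lambda>n. tp n (i n)) \<longlonglongrightarrow> t"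
    and t: "t > 0" "jump x t = 0"
  shows "(\<lambda>n. dx x n (i n)) \<longlonglongrightarrow> 0"
proof -
  have "(x \<longlongrightarrow> x t) (at_left t)" using left_lim_tendsto[OF cadlag_x t(1)] t(2) by (simp add: jump_def)
  then have "isCont x t" using x_right t unfolding isCont_def by (simp add: filterlim_split_at)
  then have "(\<lambda>n. x (tp n (Suc (i n)))) \<longlonglongrightarrow> x t" "(\<lambda>n. x (tp n (i n))) \<longlonglongrightarrow> x t"
    using isCont_tendsto_compose mesh_Suc[OF i] i by blast+
  from tendsto_diff[OF this] show ?thesis by (simp add: dx_def)
qed

lemma dx_right:
  assumes i: "\<forall>\<^sub>F n in sequentially. i n < kk n" "(\<lambda>n. tp n (i n)) \<longlonglongrightarrow> t"
    and t: "t \<ge> 0" "\<forall>\<^sub>F n in sequentially. t \<le> tp n (i n)"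
  shows "(\<lambda>n. dx x n (i n)) \<longlonglongrightarrow> 0"
proof -
  have "\<forall>\<^sub>F n in sequentially. t \<le> tp n (Suc (i n))"
    using t(2) i(1) by eventually_elim (meson Suc_leI lessI less_imp_le order_trans tp_less)
  then have "(\<lambda>n. x (tp n (Suc (i n)))) \<longlonglongrightarrow> x t" "(\<lambda>n. x (tp n (i n))) \<longlonglongrightarrow> x t"
    using mesh_Suc[OF i] i t x_right[OF t(1)] by (auto intro!: tendsto_at_right_sequence)
  from tendsto_diff[OF this] show ?thesis by (simp add: dx_def)
qed

text \<open>The interval with index \<open>lb n t\<close> starts strictly before \<open>t\<close>
  and ends at or after \<open>t\<close>, so its increment captures exactly the jump.\<close>

lemma dx_lb:
  assumes t: "t > 0"
  shows "(\<lambda>n. dx x n (lb n t)) \<longlonglongrightarrow> jump x t"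
proof -
  have ev: "\<forall>\<^sub>F n in sequentially. lb n t < kk n \<and> tp n (lb n t) < t \<and> t \<le> tp n (Suc (lb n t))"
    using eventually_lb[of "\<lambda>_. t" t] t by simp
  have l: "(\<lambda>n. tp n (lb n t)) \<longlonglongrightarrow> t" using lb_tendsto[of "\<lambda>_. t" t] t by simp
  have "(\<lambda>n. x (tp n (lb n t))) \<longlonglongrightarrow> left_lim x t"
    using left_lim_tendsto[OF cadlag_x t] l by (rule tendsto_at_left_sequence) (use ev in \<open>auto elim: eventually_mono\<close>)
  moreover have "(\<lambda>n. x (tp n (Suc (lb n t)))) \<longlonglongrightarrow> x t"
    using ev t by (intro tendsto_at_right_sequence[OF x_right] mesh_Suc l) (auto elim: eventually_mono)
  ultimately show ?thesis unfolding dx_def jump_def by (intro tendsto_diff)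
qed

text \<open>Near \<open>t\<close>, values of \<open>x\<close> on one side are close to each other.
  Hence a large increment over a short interval near \<open>t\<close> can only come from an interval
  that straddles \<open>t\<close>.\<close>

lemma dx_small_on_either_side:
  assumes t: "t > 0" and e: "e > 0"
  shows "\<exists>\<eta>>0. \<forall>a b. t - \<eta> < a \<longrightarrow> a \<le> b \<longrightarrow> b < t + \<eta> \<longrightarrow> (t \<le> a \<or> b < t) \<longrightarrow> norm (x b - x a) < e"
proof -
  obtain r where r: "r > t" "\<And>y. t < y \<Longrightarrow> y < r \<Longrightarrow> dist (x y) (x t) < e / 2"
    using tendstoD[OF x_right, of t "e/2"] t e unfolding eventually_at_right_field by auto
  obtain l where l: "l < t" "\<And>y. l < y \<Longrightarrow> y < t \<Longrightarrow> dist (x y) (left_lim x t) < e / 2"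
    using tendstoD[OF left_lim_tendsto[OF cadlag_x t], of "e/2"] e unfolding eventually_at_left_field by auto
  have r': "dist (x y) (x t) < e / 2" if "t \<le> y" "y < r" for y
    using r(2)[of y] that e by (cases "y = t") auto
  have "norm (x b - x a) < e" if "t - min (r - t) (t - l) < a" "a \<le> b" "b < t + min (r - t) (t - l)" "t \<le> a \<or> b < t" for a b
    using that(4)
  proof
    assume "t \<le> a"
    then have "dist (x b) (x t) < e / 2" "dist (x a) (x t) < e / 2"
      using that by (intro r'; linarith)+
    then show ?thesis using dist_triangle2[of "x b" "x a" "x t"] by (simp add: dist_norm)
  next
    assume "b < t"
    then have "dist (x b) (left_lim x t) < e / 2" "dist (x a) (left_lim x t) < e / 2"
      using that by (intro l(2); linarith)+
    then show ?thesis using dist_triangle2[of "x b" "x a" "left_lim x t"] by (simp add: dist_norm)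
  qed
  then show ?thesis using r(1) l(1) by (intro exI[of _ "min (r - t) (t - l)"]) auto
qed

lemma time_change:
  obtains l where "\<And>n. strict_mono_on {0..} (l n)" "\<And>n u. 0 \<le> u \<Longrightarrow> \<exists>s\<ge>0. l n s = u"
    "\<And>n s. 0 \<le> s \<Longrightarrow> 0 \<le> l n s"
    "\<And>e. e > 0 \<Longrightarrow> \<forall>\<^sub>F n in sequentially. \<forall>s\<ge>0. \<bar>l n s - s\<bar> < e"
    "\<And>e T. e > 0 \<Longrightarrow> \<forall>\<^sub>F n in sequentially. \<forall>s\<in>{0..T}. dist (quad_sum \<pi> x n (l n s)) (V s) < e"
proof -
  obtain l where l: "\<And>n. l n \<in> time_changes" "uniform_limit {0..} l (\<lambda>s. s) sequentially"
    "\<And>T. T \<ge> 0 \<Longrightarrow> uniform_limit {0..T} (\<lambda>n s. quad_sum \<pi> x n (l n s)) V sequentially"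
    using J1 unfolding J1_lim_def by blast
  have "\<forall>\<^sub>F n in sequentially. \<forall>s\<in>{0..T}. dist (quad_sum \<pi> x n (l n s)) (V s) < e" if "e > 0" for e T
    using uniform_limitD[OF l(3)[of T] that] by (cases "T \<ge> 0") auto
  moreover have "\<forall>\<^sub>F n in sequentially. \<forall>s\<ge>0. \<bar>l n s - s\<bar> < e" if "e > 0" for e
    using uniform_limitD[OF l(2) that] by (auto elim!: eventually_mono simp: dist_real_def)
  moreover have "\<exists>s\<ge>0. l n s = u" if "0 \<le> u" for n u
  proof -
    have "u \<in> l n ` {0..}" using l(1)[of n] that by (simp add: time_changes_def)
    then show ?thesis by auto
  qed
  moreover have "0 \<le> l n s" if "0 \<le> s" for n s
  proof -
    have "l n s \<in> l n ` {0..}" using that by auto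
    then show ?thesis using l(1)[of n] by (simp add: time_changes_def)
  qed
  ultimately show thesis using l(1) by (intro that[of l]) (auto simp: time_changes_def)
qed

text \<open>J1 convergence speaks of \<open>quad_sum\<close> only after a time change
  \<open>l n\<close>. If \<open>V\<close> is continuous at \<open>t\<close>, the time change does
  not matter. If \<open>V\<close> jumps at \<open>t\<close>, the jump of \<open>quad_sum\<close>
  must come from an interval of the partition straddling \<open>t\<close>, and such an interval
  starts at \<open>t'\<^sub>n\<close>; so \<open>t'\<^sub>n\<close> is the exact border between the
  two limits.\<close>

lemma quad_sum_limits:
  assumes t: "t > 0" and u: "u \<longlonglongrightarrow> t" "\<forall>\<^sub>F n in sequentially. 0 \<le> u n"
  shows "\<forall>\<^sub>F n in sequentially. last_before \<pi> n t \<le> u n \<Longrightarrow> (\<lambda>n. quad_sum \<pi> x n (u n)) \<longlonglongrightarrow> V t"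
    and "\<forall>\<^sub>F n in sequentially. u n < last_before \<pi> n t \<Longrightarrow> (\<lambda>n. quad_sum \<pi> x n (u n)) \<longlonglongrightarrow> left_lim V t"
proof -
  let ?q = "quad_sum \<pi> x" and ?Vm = "left_lim V t"
  obtain l where l: "\<And>n. strict_mono_on {0..} (l n)" "\<And>n u. 0 \<le> u \<Longrightarrow> \<exists>s\<ge>0. l n s = u"
    "\<And>n s. 0 \<le> s \<Longrightarrow> 0 \<le> l n s"
    "\<And>e. e > 0 \<Longrightarrow> \<forall>\<^sub>F n in sequentially. \<forall>s\<ge>0. \<bar>l n s - s\<bar> < e"
    "\<And>e T. e > 0 \<Longrightarrow> \<forall>\<^sub>F n in sequentially. \<forall>s\<in>{0..T}. dist (?q n (l n s)) (V s) < e"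
    by (rule time_change) (rule that)
  have l_less: "l n a < l n b \<longleftrightarrow> a < b" if "0 \<le> a" "0 \<le> b" for n a b
    using strict_mono_on_less[OF l(1)] that by simp
  \<comment> \<open>\<open>k n\<close> inverts the time change \<open>l n\<close>, so
    \<open>quad_sum\<close> at \<open>u\<close> is compared with \<open>V\<close> at
    \<open>k n u\<close>.\<close>
  define k where "k n u = (SOME s. 0 \<le> s \<and> l n s = u)" for n u
  have k: "0 \<le> k n u \<and> l n (k n u) = u" if "0 \<le> u" for n u
    unfolding k_def using l(2)[OF that, of n] by (rule someI_ex)
  have k_lim: "(\<lambda>n. k n (u n)) \<longlonglongrightarrow> t" "(\<lambda>n. dist (?q n (u n)) (V (k n (u n)))) \<longlonglongrightarrow> 0"
    if u: "u \<longlonglongrightarrow> t" "\<forall>\<^sub>F n in sequentially. 0 \<le> u n" for u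
  proof -
    have diff: "(\<lambda>n. u n - k n (u n)) \<longlonglongrightarrow> 0"
    proof (rule tendstoI)
      fix e :: real assume "e > 0"
      from l(4)[OF this] u(2) show "\<forall>\<^sub>F n in sequentially. dist (u n - k n (u n)) 0 < e"
      proof eventually_elim
        case (elim n)
        then have "\<bar>l n (k n (u n)) - k n (u n)\<bar> < e" using k by blast
        then show ?case using k[of "u n" n] elim by (simp add: dist_real_def)
      qed
    qed
    from tendsto_diff[OF u(1) this] show lim: "(\<lambda>n. k n (u n)) \<longlonglongrightarrow> t" by simp
    show "(\<lambda>n. dist (?q n (u n)) (V (k n (u n)))) \<longlonglongrightarrow> 0"
    proof (rule tendstoI)
      fix e :: real assume "e > 0"
      have "\<forall>\<^sub>F n in sequentially. k n (u n) < t + 1" by (rule order_tendstoD(2)[OF lim]) simp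
      with l(5)[OF \<open>e > 0\<close>, of "t + 1"] u(2)
      have "\<forall>\<^sub>F n in sequentially. dist (?q n (u n)) (V (k n (u n))) < e"
      proof eventually_elim
        case (elim n)
        then have "k n (u n) \<in> {0..t + 1}" "l n (k n (u n)) = u n" using k[of "u n" n] by auto
        then show ?case using elim(1) by metis
      qed
      then show "\<forall>\<^sub>F n in sequentially. dist (dist (?q n (u n)) (V (k n (u n)))) 0 < e" by simp
    qed
  qed
  have transfer: "(\<lambda>n. ?q n (u n)) \<longlonglongrightarrow> L"
    if u: "u \<longlonglongrightarrow> t" "\<forall>\<^sub>F n in sequentially. 0 \<le> u n" and L: "(\<lambda>n. V (k n (u n))) \<longlonglongrightarrow> L" for u L
  proof -
    have "(\<lambda>n. ?q n (u n) - V (k n (u n))) \<longlonglongrightarrow> 0"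
      using k_lim(2)[OF u] by (simp add: dist_norm tendsto_norm_zero_iff)
    from tendsto_add[OF this L] show ?thesis by simp
  qed
  have V_left: "(V \<longlongrightarrow> ?Vm) (at_left t)" by (rule left_lim_tendsto[OF cadlag_V t])
  have right: "(\<lambda>n. ?q n (u n)) \<longlonglongrightarrow> V t"
    if u: "u \<longlonglongrightarrow> t" "\<forall>\<^sub>F n in sequentially. 0 \<le> u n" and ge: "\<forall>\<^sub>F n in sequentially. l n t \<le> u n" for u
  proof (rule transfer[OF u tendsto_at_right_sequence[OF V_right k_lim(1)[OF u]]])
    show "\<forall>\<^sub>F n in sequentially. t \<le> k n (u n)"
      using ge u(2) by eventually_elim (use l_less k t in \<open>metis less_imp_le not_less\<close>)
  qed (use t in simp)
  have left: "(\<lambda>n. ?q n (u n)) \<longlonglongrightarrow> ?Vm"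
    if u: "u \<longlonglongrightarrow> t" "\<forall>\<^sub>F n in sequentially. 0 \<le> u n" and ge: "\<forall>\<^sub>F n in sequentially. u n < l n t" for u
  proof (rule transfer[OF u tendsto_at_left_sequence[OF V_left k_lim(1)[OF u]]])
    show "\<forall>\<^sub>F n in sequentially. k n (u n) < t"
      using ge u(2) by eventually_elim (use l_less k t in \<open>metis less_imp_le\<close>)
  qed
  define p where "p n = l n t" for n
  have p: "p \<longlonglongrightarrow> t" "\<And>n. 0 \<le> p n"
  proof -
    show "p \<longlonglongrightarrow> t"
    proof (rule tendstoI)
      fix e :: real assume "e > 0"
      from l(4)[OF this] show "\<forall>\<^sub>F n in sequentially. dist (p n) t < e"
        by eventually_elim (use t in \<open>auto simp: p_def dist_real_def\<close>)
    qed
    show "0 \<le> p n" for n using l(3) t by (simp add: p_def)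
  qed
  \<comment> \<open>At a jump of \<open>V\<close> the time change eventually sends \<open>t\<close>
    exactly to \<open>t'\<^sub>n\<close>. With \<open>i n\<close> the last index whose point is at
    most \<open>l n t\<close>, it is shown that \<open>l n t\<close> is this point and that the
    interval starting there straddles \<open>t\<close>.\<close>
  have *: "\<forall>\<^sub>F n in sequentially. l n t = last_before \<pi> n t" if ne: "V t \<noteq> ?Vm"
  proof -
    define i where "i n = lo n (p n)" for n
    have i: "\<forall>\<^sub>F n in sequentially. i n < kk n \<and> tp n (i n) \<le> p n \<and> p n < tp n (Suc (i n))"
      unfolding i_def using p by (intro eventually_lo) auto
    then have i_kk: "\<forall>\<^sub>F n in sequentially. i n < kk n" by (auto elim: eventually_mono)
    have ti: "(\<lambda>n. tp n (i n)) \<longlonglongrightarrow> t"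
      unfolding i_def using p by (intro lo_tendsto) auto
    have ti0: "\<forall>\<^sub>F n in sequentially. 0 \<le> tp n (i n)"
      using i_kk by eventually_elim (auto intro: tp_nonneg)
    have qp: "(\<lambda>n. ?q n (p n)) \<longlonglongrightarrow> V t"
      by (rule right[OF p(1)]) (use p(2) in \<open>simp_all add: p_def\<close>)
    define d where "d = dist (V t) ?Vm"
    have d: "d > 0" using ne by (simp add: d_def)
    then have d4: "d / 4 > 0" by simp
    obtain \<eta> where \<eta>: "\<eta> < t" "\<And>s. \<eta> < s \<Longrightarrow> s < t \<Longrightarrow> dist (V s) ?Vm < d / 4"
      using tendstoD[OF V_left, of "d/4"] d unfolding eventually_at_left_field by auto
    \<comment> \<open>Otherwise \<open>quad_sum\<close> is constant from \<open>tp n (i n)\<close>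
      to \<open>l n t\<close>, although the inverse time of \<open>tp n (i n)\<close> lies before
      \<open>t\<close>, where \<open>V\<close> is close to its left limit. Three errors of
      \<open>d / 4\<close> cannot cover the distance \<open>d\<close>.\<close>
    have eq: "\<forall>\<^sub>F n in sequentially. tp n (i n) = p n"
      using i ti0 tendstoD[OF qp d4] order_tendstoD(2)[OF k_lim(2)[OF ti ti0] d4]
        order_tendstoD(1)[OF k_lim(1)[OF ti ti0] \<eta>(1)]
    proof eventually_elim
      case (elim n)
      show ?case
      proof (rule ccontr)
        assume "tp n (i n) \<noteq> p n"
        then have "tp n (i n) < l n t" using elim by (simp add: p_def)
        then have "k n (tp n (i n)) < t" using l_less[of "k n (tp n (i n))" t n] k[of "tp n (i n)" n] elim t by simp
        then have "dist (V (k n (tp n (i n)))) ?Vm < d / 4" using elim \<eta>(2) by auto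
        moreover have "?q n (p n) = ?q n (tp n (i n))"
          using elim by (subst (1 2) quad_sum_lo[of "i n"]) (auto simp: tp_less)
        then have "dist (?q n (p n)) (V (k n (tp n (i n)))) < d / 4" using elim by simp
        ultimately have "dist (V t) ?Vm < d / 4 + d / 4 + d / 4"
          using elim dist_triangle[of "V t" ?Vm "?q n (p n)"] dist_commute[of "V t" "?q n (p n)"]
            dist_triangle[of "?q n (p n)" ?Vm "V (k n (tp n (i n)))"] by linarith
        then show False using d by (simp add: d_def)
      qed
    qed
    have "\<forall>\<^sub>F n in sequentially. 0 < tp n (i n)" by (rule order_tendstoD(1)[OF ti t])
    then have ipos: "\<forall>\<^sub>F n in sequentially. 0 < i n" by eventually_elim (metis gr0I less_irrefl tp_0)
    have tj: "(\<lambda>n. tp n (i n - 1)) \<longlonglongrightarrow> t"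
    proof (rule mesh_pred)
      show "\<forall>\<^sub>F n in sequentially. i n - 1 < kk n" using i_kk by eventually_elim simp
      show "(\<lambda>n. tp n (Suc (i n - 1))) \<longlonglongrightarrow> t"
        using ti by (rule Lim_transform_eventually) (use ipos in \<open>eventually_elim, simp\<close>)
    qed
    have "(\<lambda>n. ?q n (tp n (i n - 1))) \<longlonglongrightarrow> ?Vm"
    proof (rule left[OF tj])
      show "\<forall>\<^sub>F n in sequentially. 0 \<le> tp n (i n - 1)"
        using i_kk by eventually_elim (auto intro: tp_nonneg)
      show "\<forall>\<^sub>F n in sequentially. tp n (i n - 1) < l n t"
        using eq i_kk ipos
      proof eventually_elim
        case (elim n)
        then have "tp n (i n - 1) < tp n (i n)" by (intro tp_less) auto
        then show ?case using elim by (simp add: p_def)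
      qed
    qed
    from tendsto_diff[OF qp this] have "(\<lambda>n. outer (dx x n (i n))) \<longlonglongrightarrow> V t - ?Vm"
    proof (rule Lim_transform_eventually)
      show "\<forall>\<^sub>F n in sequentially. ?q n (p n) - ?q n (tp n (i n - 1)) = outer (dx x n (i n))"
        using eq i_kk ipos
      proof eventually_elim
        case (elim n)
        then show ?case by (simp flip: elim(1) add: quad_sum_tp)
      qed
    qed
    then have lim: "(\<lambda>n. (norm (dx x n (i n)))\<^sup>2) \<longlonglongrightarrow> d"
      unfolding d_def dist_norm by (drule_tac tendsto_norm) (simp add: norm_outer)
    \<comment> \<open>The increment with index \<open>i n\<close> has squared norm tending to
      \<open>d > 0\<close>, whereas near \<open>t\<close> an interval not straddling
      \<open>t\<close> has an increment of squared norm below \<open>d / 2\<close>.\<close>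
    obtain h where h: "h > 0" "\<And>a b. t - h < a \<Longrightarrow> a \<le> b \<Longrightarrow> b < t + h \<Longrightarrow> (t \<le> a \<or> b < t) \<Longrightarrow> norm (x b - x a) < sqrt (d / 2)"
      using dx_small_on_either_side[OF t, of "sqrt (d / 2)"] d by auto
    have "\<forall>\<^sub>F n in sequentially. d / 2 < (norm (dx x n (i n)))\<^sup>2"
      using d by (intro order_tendstoD(1)[OF lim]) auto
    moreover have "\<forall>\<^sub>F n in sequentially. t - h < tp n (i n)"
      using h by (intro order_tendstoD(1)[OF ti]) auto
    moreover have "\<forall>\<^sub>F n in sequentially. tp n (Suc (i n)) < t + h"
      using h by (intro order_tendstoD(2)[OF mesh_Suc[OF i_kk ti]]) auto
    ultimately show ?thesis
      using eq i_kk
    proof eventually_elim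
      case (elim n)
      have "tp n (i n) < t \<and> t \<le> tp n (Suc (i n))"
      proof (rule ccontr)
        assume "\<not> ?thesis"
        then have "norm (dx x n (i n)) < sqrt (d / 2)"
          unfolding dx_def using elim tp_less[of "i n" "Suc (i n)" n] by (intro h(2)) auto
        then have "(norm (dx x n (i n)))\<^sup>2 < d / 2"
          using d by (metis norm_ge_zero real_sqrt_le_iff real_sqrt_power not_le real_sqrt_abs abs_norm_cancel)
        then show False using elim by simp
      qed
      then have "lb n t = i n" using elim by (intro lb_unique) auto
      then show ?case using elim by (simp add: last_before_eq p_def)
    qed
  qed
  have cont: "(\<lambda>n. ?q n (u n)) \<longlonglongrightarrow> V t" if eq: "V t = ?Vm"
  proof -
    have "isCont V t" using V_left V_right[of t] t eq unfolding isCont_def by (simp add: filterlim_split_at)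
    then show ?thesis using k_lim(1)[OF u] isCont_tendsto_compose by (intro transfer[OF u]) blast
  qed
  show "(\<lambda>n. ?q n (u n)) \<longlonglongrightarrow> V t" if "\<forall>\<^sub>F n in sequentially. last_before \<pi> n t \<le> u n"
  proof (cases "V t = ?Vm")
    case False
    from *[OF this] that have "\<forall>\<^sub>F n in sequentially. l n t \<le> u n" by eventually_elim simp
    then show ?thesis by (rule right[OF u])
  qed (rule cont)
  show "(\<lambda>n. ?q n (u n)) \<longlonglongrightarrow> ?Vm" if "\<forall>\<^sub>F n in sequentially. u n < last_before \<pi> n t"
  proof (cases "V t = ?Vm")
    case False
    from *[OF this] that have "\<forall>\<^sub>F n in sequentially. u n < l n t" by eventually_elim simp
    then show ?thesis by (rule left[OF u])
  qed (use cont in simp)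
qed

text \<open>At time 0 there is no left side to distinguish: the time change is close to the identity
  and \<open>V\<close> is right-continuous.\<close>

lemma quad_sum_limit_0:
  assumes u: "u \<longlonglongrightarrow> 0" "\<forall>\<^sub>F n in sequentially. 0 \<le> u n"
  shows "(\<lambda>n. quad_sum \<pi> x n (u n)) \<longlonglongrightarrow> V 0"
proof (rule tendstoI)
  fix e :: real assume e: "e > 0"
  obtain l where l: "\<And>n u. 0 \<le> u \<Longrightarrow> \<exists>s\<ge>0. l n s = u"
    "\<And>e. e > 0 \<Longrightarrow> \<forall>\<^sub>F n in sequentially. \<forall>s\<ge>0. \<bar>l n s - s\<bar> < e"
    "\<And>e T. e > 0 \<Longrightarrow> \<forall>\<^sub>F n in sequentially. \<forall>s\<in>{0..T}. dist (quad_sum \<pi> x n (l n s)) (V s) < e"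
    by (rule time_change) (rule that)
  obtain b where b: "b > 0" "\<And>y. 0 < y \<Longrightarrow> y < b \<Longrightarrow> dist (V y) (V 0) < e / 2"
    using tendstoD[OF V_right, of 0 "e/2"] e unfolding eventually_at_right_field by auto
  have b': "dist (V y) (V 0) < e / 2" if "0 \<le> y" "y < b" for y
    using b(2)[of y] that e by (cases "y = 0") auto
  have "\<forall>\<^sub>F n in sequentially. u n < b / 2" using b by (intro order_tendstoD(2)[OF u(1)]) auto
  moreover have "\<forall>\<^sub>F n in sequentially. \<forall>s\<ge>0. \<bar>l n s - s\<bar> < b / 2" using b by (intro l(2)) auto
  moreover have "\<forall>\<^sub>F n in sequentially. \<forall>s\<in>{0..b}. dist (quad_sum \<pi> x n (l n s)) (V s) < e / 2"
    using e by (intro l(3)) auto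
  ultimately show "\<forall>\<^sub>F n in sequentially. dist (quad_sum \<pi> x n (u n)) (V 0) < e"
    using u(2)
  proof eventually_elim
    case (elim n)
    then obtain s where s: "s \<ge> 0" "l n s = u n" using l(1) by blast
    have "\<bar>l n s - s\<bar> < b / 2" using elim s by blast
    then have sb: "s < b" using elim s by linarith
    then have "s \<in> {0..b}" using s by simp
    then have "dist (quad_sum \<pi> x n (l n s)) (V s) < e / 2" using elim by blast
    then show ?case using b'[OF s(1) sb] s dist_triangle[of "quad_sum \<pi> x n (u n)" "V 0" "V s"] by simp
  qed
qed

text \<open>J1 convergence in general gives pointwise limits only at continuity points of the limit.
  Here they hold at jumps as well, because \<open>t\<close> itself is never before
  \<open>t'\<^sub>n\<close>.\<close>

lemma quad_sum_tendsto:
  assumes "t \<ge> 0"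
  shows "(\<lambda>n. quad_sum \<pi> x n t) \<longlonglongrightarrow> V t"
proof (cases "t = 0")
  case True
  then show ?thesis using quad_sum_limit_0[of "\<lambda>_. 0"] by simp
next
  case False
  then have "\<forall>\<^sub>F n in sequentially. lb n t < kk n \<and> tp n (lb n t) < t \<and> t \<le> tp n (Suc (lb n t))"
    using eventually_lb[of "\<lambda>_. t" t] assms by simp
  then have "\<forall>\<^sub>F n in sequentially. last_before \<pi> n t \<le> t"
    by eventually_elim (simp add: last_before_eq)
  then show ?thesis using False assms by (intro quad_sum_limits(1)) auto
qed

text \<open>At time 0 the sum consists of the square of the first increment alone, which vanishes in
  the limit because \<open>x\<close> is right-continuous at 0.\<close>

lemma V_0: "V 0 = 0"
proof -
  have ev: "\<forall>\<^sub>F n in sequentially. 0 < kk n"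
    by (rule eventually_kk_pos)
  then have "(\<lambda>n. dx x n 0) \<longlonglongrightarrow> 0" using dx_right[of "\<lambda>_. 0" 0] by simp
  from tendsto_outer[OF this] have "(\<lambda>n. outer (dx x n 0)) \<longlonglongrightarrow> 0" by simp
  moreover have "(\<lambda>n. outer (dx x n 0)) \<longlonglongrightarrow> V 0"
    using quad_sum_tendsto[of 0]
    by (rule Lim_transform_eventually) (use ev in \<open>auto elim!: eventually_mono dest: quad_sum_tp\<close>)
  ultimately show ?thesis using LIMSEQ_unique by blast
qed

text \<open>The sums before and after index \<open>lb n t\<close> are the values of
  \<open>quad_sum\<close> at the partition point preceding \<open>t'\<^sub>n\<close> and at
  \<open>t'\<^sub>n\<close>, which lie on opposite sides of the jump of \<open>V\<close>.\<close>

lemma cumulative_lb: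
  assumes t: "t > 0"
  shows "(\<lambda>n. \<Sum>i<lb n t. outer (dx x n i)) \<longlonglongrightarrow> left_lim V t"
    "(\<lambda>n. \<Sum>i<Suc (lb n t). outer (dx x n i)) \<longlonglongrightarrow> V t"
proof -
  note lb = lb_pred[OF t]
  have nonneg: "\<forall>\<^sub>F n in sequentially. 0 \<le> tp n (lb n t - 1)"
    using lb(1) by eventually_elim (auto intro: tp_nonneg)
  have "\<forall>\<^sub>F n in sequentially. tp n (lb n t - 1) < last_before \<pi> n t"
    using lb(1) unfolding last_before_eq by eventually_elim (auto intro: tp_less)
  from quad_sum_limits(2)[OF t lb(2) nonneg this]
  show "(\<lambda>n. \<Sum>i<lb n t. outer (dx x n i)) \<longlonglongrightarrow> left_lim V t"
  proof (rule Lim_transform_eventually)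
    show "\<forall>\<^sub>F n in sequentially. quad_sum \<pi> x n (tp n (lb n t - 1)) = (\<Sum>i<lb n t. outer (dx x n i))"
      using lb(1)
    proof eventually_elim
      case (elim n)
      then show ?case using quad_sum_tp[of "lb n t - 1" n] by (simp add: less_imp_diff_less)
    qed
  qed
  have "(\<lambda>n. quad_sum \<pi> x n (last_before \<pi> n t)) \<longlonglongrightarrow> V t"
    using t last_before_tendsto last_before_nonneg by (intro quad_sum_limits(1)) auto
  then show "(\<lambda>n. \<Sum>i<Suc (lb n t). outer (dx x n i)) \<longlonglongrightarrow> V t"
    by (rule Lim_transform_eventually) (use lb(1) in eventually_elim, simp add: quad_sum_tp last_before_eq)
qed

lemma jump_V:
  assumes t: "t > 0"
  shows "V t - left_lim V t = outer (jump x t)"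
proof -
  have "(\<lambda>n. outer (dx x n (lb n t))) \<longlonglongrightarrow> V t - left_lim V t"
    using tendsto_diff[OF cumulative_lb(2,1)[OF t]] by simp
  then show ?thesis using tendsto_outer[OF dx_lb[OF t]] LIMSEQ_unique by blast
qed

text \<open>A J1 limit is recovered from pointwise limits at nonnegative times, so the definite
  description in \<open>quad_var\<close> denotes it.\<close>

lemma V_unique:
  assumes "J1_lim (quad_sum \<pi> x) W"
  shows "W = V"
proof
  interpret W: qv_path \<pi> x W using assms cadlag_x by unfold_locales
  fix t
  show "W t = V t"
  proof (cases "t \<ge> 0")
    case True
    then show ?thesis using quad_sum_tendsto W.quad_sum_tendsto LIMSEQ_unique by blast
  next
    case False
    then show ?thesis using cadlag_V W.cadlag_V by (simp add: cadlag_def)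
  qed
qed

lemma quad_var_eq: "quad_var \<pi> x = V"
  unfolding quad_var_def using J1 V_unique by (rule the_equality)

section \<open>Bounds and limits for weighted sums of squared increments\<close>

lemma quad_bounded:
  obtains B where "B \<ge> 0"
    "\<forall>\<^sub>F n in sequentially. \<forall>j<kk n. tp n j \<le> T \<longrightarrow> (\<Sum>i<Suc j. (norm (dx x n i))\<^sup>2) \<le> B"
proof -
  define T' where "T' = max T 0"
  define B where "B = norm (V T' \<bullet> mat 1) + 1"
  have "(\<lambda>n. quad_sum \<pi> x n T' \<bullet> mat 1) \<longlonglongrightarrow> V T' \<bullet> mat 1"
    by (intro tendsto_intros quad_sum_tendsto) (simp add: T'_def)
  then have "\<forall>\<^sub>F n in sequentially. quad_sum \<pi> x n T' \<bullet> mat 1 < B"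
    by (rule order_tendstoD(2)) (auto simp: B_def)
  then have "\<forall>\<^sub>F n in sequentially. \<forall>j<kk n. tp n j \<le> T \<longrightarrow> (\<Sum>i<Suc j. (norm (dx x n i))\<^sup>2) \<le> B"
  proof eventually_elim
    case (elim n)
    show ?case
    proof (intro allI impI)
      fix j assume j: "j < kk n" "tp n j \<le> T"
      have "tp n i \<le> T'" if "i < Suc j" for i
        using j that tp_le[of i j n] by (auto simp: T'_def)
      then have "(\<Sum>i<Suc j. (norm (dx x n i))\<^sup>2) \<le> (\<Sum>i | i < kk n \<and> tp n i \<le> T'. (norm (dx x n i))\<^sup>2)"
        using j by (intro sum_mono2) auto
      also have "\<dots> = quad_sum \<pi> x n T' \<bullet> mat 1"
        by (simp add: quad_sum_eq inner_sum_left outer_inner_mat_1)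
      finally show "(\<Sum>i<Suc j. (norm (dx x n i))\<^sup>2) \<le> B" using elim by simp
    qed
  qed
  then show thesis by (rule that[rotated]) (simp add: B_def)
qed

text \<open>The quantile limit for the weights \<open>outer (dx x n i) \<bullet> B\<close>. Off
  \<open>D\<close> the coefficients converge along every index sequence with positive weight whose
  times converge. On \<open>D\<close> they are required only where \<open>V \<bullet> B\<close>
  jumps, and only at index \<open>lb n s\<close>, on which that jump accumulates.\<close>

lemma weighted_sum_convergent:
  fixes \<phi> :: "nat \<Rightarrow> nat \<Rightarrow> real"
  assumes t: "t \<ge> 0" and B: "\<And>d. 0 \<le> outer d \<bullet> B"
    and \<phi>: "\<forall>\<^sub>F n in sequentially. \<forall>i. 0 < i \<and> i < kk n \<and> tp n i \<le> t \<longrightarrow> \<bar>\<phi> n i\<bar> \<le> C"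
    and D: "countable D"
    and h2: "\<And>s i. 0 < s \<Longrightarrow> s \<le> t \<Longrightarrow> s \<notin> D \<Longrightarrow> (\<lambda>n. tp n (i n)) \<longlonglongrightarrow> s \<Longrightarrow>
       \<forall>\<^sub>F n in sequentially. 0 < i n \<and> i n < kk n \<and> tp n (i n) \<le> t \<and> outer (dx x n (i n)) \<bullet> B > 0 \<Longrightarrow>
       (\<lambda>n. \<phi> n (i n)) \<longlonglongrightarrow> \<phi>l s"
    and h1: "\<And>s. s \<in> D \<Longrightarrow> 0 < s \<Longrightarrow> s \<le> t \<Longrightarrow> left_lim V s \<bullet> B < V s \<bullet> B \<Longrightarrow>
       (\<lambda>n. \<phi> n (lb n s)) \<longlonglongrightarrow> \<phi>l s"
  shows "convergent (\<lambda>n. \<Sum>i=1..lo n t. \<phi> n i * (outer (dx x n i) \<bullet> B))"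
proof -
  have ev_lo: "\<forall>\<^sub>F n in sequentially. lo n t < kk n \<and> tp n (lo n t) \<le> t \<and> t < tp n (Suc (lo n t))"
    using eventually_lo_const[OF t] .
  obtain n0 where n0: "\<And>n. n \<ge> n0 \<Longrightarrow> lo n t < kk n \<and> tp n (lo n t) \<le> t \<and> t < tp n (Suc (lo n t))"
    "\<And>n i. n \<ge> n0 \<Longrightarrow> 0 < i \<and> i < kk n \<and> tp n i \<le> t \<Longrightarrow> \<bar>\<phi> n i\<bar> \<le> C"
    using eventually_conj[OF ev_lo \<phi>] unfolding eventually_sequentially by blast
  \<comment> \<open>For small \<open>n\<close> the sum is made empty, so that eventual properties
    hold for every \<open>n\<close>. Below, \<open>\<psi>\<close> sets the coefficient of index 0 to
    0, since \<open>\<phi>\<close> is controlled for positive indices only.\<close>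
  define J where "J n = (if n \<ge> n0 then Suc (lo n t) else 0)" for n
  define \<psi> where "\<psi> n i = (if i = 0 then 0 else \<phi> n i)" for n i :: nat
  define w where "w n i = outer (dx x n i) \<bullet> B" for n i
  have J: "n \<ge> n0" "i < kk n" "tp n i \<le> t" if "i < J n" for n i
  proof -
    show n: "n \<ge> n0" using that by (auto simp: J_def split: if_splits)
    show "i < kk n" using n0(1)[OF n] that by (auto simp: J_def split: if_splits)
    have "tp n i \<le> tp n (lo n t)" using n0(1)[OF n] that n by (intro tp_le) (auto simp: J_def)
    then show "tp n i \<le> t" using n0(1)[OF n] by simp
  qed
  have J': "i < J n" if "n \<ge> n0" "i < kk n" "tp n i \<le> t" for n i
  proof -
    have "tp n i < tp n (Suc (lo n t))" using n0(1)[OF that(1)] that by simp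
    then show ?thesis using n0(1)[OF that(1)] that tp_less_iff[of i n "Suc (lo n t)"] by (auto simp: J_def)
  qed
  have ev_n0: "\<forall>\<^sub>F n in sequentially. n \<ge> n0" by (rule eventually_ge_at_top)
  have "convergent (\<lambda>n. \<Sum>i<J n. \<psi> n i * w n i)"
  proof (rule quantile_convergent[where T = t and s = tp and Q = "\<lambda>u. V u \<bullet> B"
        and Qm = "\<lambda>u. left_lim V u \<bullet> B" and C = "\<bar>C\<bar>" and D = D and \<phi>l = \<phi>l])
    show "tp n i \<le> tp n j" if "i \<le> j" "j < J n" for n i j
      using that J(2)[of j n] by (intro tp_le) auto
    show "0 \<le> tp n i \<and> tp n i \<le> t" if "i < J n" for n i
      using J[OF that] tp_nonneg[of i n] by simp
    show "0 \<le> w n i" for n i using B by (simp add: w_def)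
    show "\<bar>\<psi> n i\<bar> \<le> \<bar>C\<bar>" if "i < J n" for n i
      using J[OF that] n0(2)[of n i] by (cases "i = 0") (auto simp: \<psi>_def)
    show "(\<lambda>n. \<Sum>i<J n. if tp n i \<le> u then w n i else 0) \<longlonglongrightarrow> V u \<bullet> B" if u: "0 \<le> u" "u \<le> t" for u
    proof (rule Lim_transform_eventually)
      show "(\<lambda>n. quad_sum \<pi> x n u \<bullet> B) \<longlonglongrightarrow> V u \<bullet> B"
        by (intro tendsto_intros quad_sum_tendsto u)
      show "\<forall>\<^sub>F n in sequentially. quad_sum \<pi> x n u \<bullet> B = (\<Sum>i<J n. if tp n i \<le> u then w n i else 0)"
        using ev_n0
      proof eventually_elim
        case (elim n)
        have "{i. i < kk n \<and> tp n i \<le> u} = {i \<in> {..<J n}. tp n i \<le> u}"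
          using J J'[OF elim] u by (auto intro: order_trans)
        then show ?case
          unfolding quad_sum_eq inner_sum_left w_def
          by (subst sum.inter_filter[symmetric]) auto
      qed
    qed
    show "V 0 \<bullet> B = 0" by (simp add: V_0)
    show "((\<lambda>u. V u \<bullet> B) \<longlongrightarrow> V s \<bullet> B) (at_right s)" if "0 \<le> s" for s
      by (intro tendsto_intros V_right that)
    show "((\<lambda>u. V u \<bullet> B) \<longlongrightarrow> left_lim V s \<bullet> B) (at_left s)" if "0 < s" for s
      by (intro tendsto_intros left_lim_tendsto cadlag_V that)
    show "(\<lambda>n. \<psi> n (i n)) \<longlonglongrightarrow> \<phi>l s" if s: "0 < s" "s \<le> t" "s \<notin> D" "(\<lambda>n. tp n (i n)) \<longlonglongrightarrow> s"
      and ev: "\<forall>\<^sub>F n in sequentially. i n < J n \<and> 0 < w n (i n)" for s i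
    proof -
      have "\<forall>\<^sub>F n in sequentially. 0 < tp n (i n)" by (rule order_tendstoD(1)[OF s(4,1)])
      then have pos: "\<forall>\<^sub>F n in sequentially. 0 < i n" by eventually_elim (metis gr0I less_irrefl tp_0)
      have "(\<lambda>n. \<phi> n (i n)) \<longlonglongrightarrow> \<phi>l s"
      proof (rule h2[OF s])
        show "\<forall>\<^sub>F n in sequentially. 0 < i n \<and> i n < kk n \<and> tp n (i n) \<le> t \<and> outer (dx x n (i n)) \<bullet> B > 0"
          using ev pos by eventually_elim (use J in \<open>auto simp: w_def\<close>)
      qed
      then show ?thesis
        by (rule Lim_transform_eventually) (use pos in \<open>auto elim!: eventually_mono simp: \<psi>_def\<close>)
    qed
    show "\<exists>k. (\<forall>\<^sub>F n in sequentially. k n < J n) \<and> (\<lambda>n. \<Sum>i<k n. w n i) \<longlonglongrightarrow> left_lim V s \<bullet> B \<and>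
        (\<lambda>n. \<Sum>i<Suc (k n). w n i) \<longlonglongrightarrow> V s \<bullet> B \<and> (\<lambda>n. \<psi> n (k n)) \<longlonglongrightarrow> \<phi>l s"
      if s: "s \<in> D" "0 < s" "s \<le> t" "left_lim V s \<bullet> B < V s \<bullet> B" for s
    proof (intro exI conjI)
      have "\<forall>\<^sub>F n in sequentially. lb n s < kk n \<and> tp n (lb n s) < s \<and> s \<le> tp n (Suc (lb n s))"
        using eventually_lb[of "\<lambda>_. s" s] s by simp
      then show "\<forall>\<^sub>F n in sequentially. lb n s < J n"
        using ev_n0 by eventually_elim (use J' s in auto)
      show "(\<lambda>n. \<Sum>i<lb n s. w n i) \<longlonglongrightarrow> left_lim V s \<bullet> B"
        "(\<lambda>n. \<Sum>i<Suc (lb n s). w n i) \<longlonglongrightarrow> V s \<bullet> B"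
        using tendsto_inner[OF cumulative_lb(1)[OF s(2)] tendsto_const, of B]
          tendsto_inner[OF cumulative_lb(2)[OF s(2)] tendsto_const, of B]
        by (simp_all add: inner_sum_left w_def inner_add_left)
      show "(\<lambda>n. \<psi> n (lb n s)) \<longlonglongrightarrow> \<phi>l s"
        using h1[OF s]
        by (rule Lim_transform_eventually) (use lb_pred(1)[OF s(2)] in \<open>auto elim!: eventually_mono simp: \<psi>_def\<close>)
    qed
  qed (use t D in auto)
  then obtain L where "(\<lambda>n. \<Sum>i<J n. \<psi> n i * w n i) \<longlonglongrightarrow> L" unfolding convergent_def by blast
  then have "(\<lambda>n. \<Sum>i=1..lo n t. \<phi> n i * (outer (dx x n i) \<bullet> B)) \<longlonglongrightarrow> L"
  proof (rule Lim_transform_eventually)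
    show "\<forall>\<^sub>F n in sequentially. (\<Sum>i<J n. \<psi> n i * w n i) = (\<Sum>i=1..lo n t. \<phi> n i * (outer (dx x n i) \<bullet> B))"
      using ev_n0
    proof eventually_elim
      case (elim n)
      have "(\<Sum>i<J n. \<psi> n i * w n i) = (\<Sum>i=1..lo n t. \<psi> n i * w n i)"
        using elim by (intro sum.mono_neutral_right) (auto simp: J_def \<psi>_def)
      also have "\<dots> = (\<Sum>i=1..lo n t. \<phi> n i * (outer (dx x n i) \<bullet> B))"
        by (intro sum.cong) (auto simp: \<psi>_def w_def)
      finally show ?case .
    qed
  qed
  then show ?thesis by (rule convergentI)
qed

text \<open>The left limits of \<open>f\<close> are full limits off a countable set. On that set the
  index \<open>lb n s\<close> has time \<open>t'\<^sub>n\<close>, to which the assumed left limits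
  apply.\<close>

lemma matrix_sum_convergent:
  fixes f :: "nat \<Rightarrow> real \<Rightarrow> real ^ 'm ^ 'm"
  assumes t: "t \<ge> 0"
    and bd: "\<forall>\<^sub>F n in sequentially. \<forall>u\<in>{0..t}. norm (f n u) \<le> K"
    and left: "\<And>u s. s > 0 \<Longrightarrow> u \<longlonglongrightarrow> s \<Longrightarrow> \<forall>\<^sub>F n in sequentially. 0 \<le> u n \<and> u n \<le> last_before \<pi> n s \<Longrightarrow>
       (\<lambda>n. f n (u n)) \<longlonglongrightarrow> l s"
  shows "convergent (\<lambda>n. \<Sum>i=1..lo n t. f n (tp n i) \<bullet> outer (dx x n i))"
proof -
  obtain D where D: "countable D" "\<And>u s. s > 0 \<Longrightarrow> s \<notin> D \<Longrightarrow> u \<longlonglongrightarrow> s \<Longrightarrow> (\<lambda>n. f n (u n)) \<longlonglongrightarrow> l s"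
    by (rule left_limits_imp_limits_off_countable[of "last_before \<pi>" f l,
        OF last_before_tendsto[OF less_imp_le] last_before_nonneg left]) (assumption+, rule that)
  have conv: "convergent (\<lambda>n. \<Sum>i=1..lo n t. f n (tp n i) $ j $ k * (outer (dx x n i) \<bullet> outer c))" for j k c
  proof (rule weighted_sum_convergent[where D = D and \<phi>l = "\<lambda>s. l s $ j $ k" and C = K])
    show "0 \<le> outer d \<bullet> outer c" for d by (simp add: outer_inner_outer)
    show "\<forall>\<^sub>F n in sequentially. \<forall>i. 0 < i \<and> i < kk n \<and> tp n i \<le> t \<longrightarrow> \<bar>f n (tp n i) $ j $ k\<bar> \<le> K"
      using bd
    proof eventually_elim
      case (elim n)
      show ?case
      proof (intro allI impI)
        fix i assume i: "0 < i \<and> i < kk n \<and> tp n i \<le> t"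
        then have "norm (f n (tp n i)) \<le> K" using elim tp_nonneg[of i n] by auto
        then show "\<bar>f n (tp n i) $ j $ k\<bar> \<le> K"
          using component_le_norm_cart[of "f n (tp n i) $ j" k] Finite_Cartesian_Product.norm_nth_le[of "f n (tp n i)" j] by simp
      qed
    qed
    show "(\<lambda>n. f n (tp n (i n)) $ j $ k) \<longlonglongrightarrow> l s $ j $ k"
      if "0 < s" "s \<notin> D" "(\<lambda>n. tp n (i n)) \<longlonglongrightarrow> s" for s i
      by (intro tendsto_intros D(2) that)
    show "(\<lambda>n. f n (tp n (lb n s)) $ j $ k) \<longlonglongrightarrow> l s $ j $ k" if "0 < s" for s
      using that lb_tendsto[of "\<lambda>_. s" s]
      by (intro tendsto_intros left) (auto simp: last_before_eq)
  qed (use t D in auto)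
  \<comment> \<open>Polarization writes \<open>d $ j * d $ k\<close> through squares along
    \<open>axis j 1 + axis k 1\<close> and \<open>axis j 1 - axis k 1\<close>, so only nonnegative
    scalar weights remain.\<close>
  have eq: "f n (tp n i) \<bullet> outer (dx x n i) = (\<Sum>j\<in>UNIV. \<Sum>k\<in>UNIV.
      (1/4) * (f n (tp n i) $ j $ k * (outer (dx x n i) \<bullet> outer (axis j 1 + axis k 1))) -
      (1/4) * (f n (tp n i) $ j $ k * (outer (dx x n i) \<bullet> outer (axis j 1 - axis k 1))))" for n i
  proof -
    have "f n (tp n i) \<bullet> outer d = (\<Sum>j\<in>UNIV. \<Sum>k\<in>UNIV. f n (tp n i) $ j $ k * (d $ j * d $ k))" for d
      by (simp add: inner_vec_def outer_def)
    moreover have "d $ j * d $ k = (1/4) * (outer d \<bullet> outer (axis j 1 + axis k 1)) - (1/4) * (outer d \<bullet> outer (axis j 1 - axis k 1))"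
      for d :: "real ^ 'm" and j k
      by (simp add: outer_inner_outer inner_add_right inner_diff_right inner_axis power2_eq_square algebra_simps)
    ultimately show ?thesis by (simp add: algebra_simps)
  qed
  have "(\<Sum>i=1..lo n t. f n (tp n i) \<bullet> outer (dx x n i)) = (\<Sum>j\<in>UNIV. \<Sum>k\<in>UNIV.
      (1/4) * (\<Sum>i=1..lo n t. f n (tp n i) $ j $ k * (outer (dx x n i) \<bullet> outer (axis j 1 + axis k 1))) -
      (1/4) * (\<Sum>i=1..lo n t. f n (tp n i) $ j $ k * (outer (dx x n i) \<bullet> outer (axis j 1 - axis k 1))))" for n
    unfolding eq sum_distrib_left sum_subtractf[symmetric]
    by (rule trans[OF sum.swap]) (rule sum.cong[OF refl], rule sum.swap)
  then show ?thesis
    by (simp only:) (intro convergent_sum convergent_diff convergent_mult convergent_const conv)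
qed

text \<open>The passage from left limits to full limits, applied to the constant sequence
  \<open>x\<close> with \<open>p n t\<close> slightly below \<open>t\<close>: off a countable set
  the left limit of \<open>x\<close> is a two-sided limit and equals the value.\<close>

lemma jumps_countable: "countable {s. s > 0 \<and> jump x s \<noteq> 0}"
proof -
  obtain D where D: "countable D"
    "\<And>u t. t > 0 \<Longrightarrow> t \<notin> D \<Longrightarrow> u \<longlonglongrightarrow> t \<Longrightarrow> (\<lambda>n. x (u n)) \<longlonglongrightarrow> left_lim x t"
  proof (rule left_limits_imp_limits_off_countable[where p = "\<lambda>n t. max 0 (t - inverse (real (Suc n)))" and f = "\<lambda>_. x" and l = "left_lim x"])
    show "(\<lambda>n. max 0 (t - inverse (real (Suc n)))) \<longlonglongrightarrow> t" if "t > 0" for t :: real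
    proof -
      have "(\<lambda>n. max 0 (t - inverse (real (Suc n)))) \<longlonglongrightarrow> max 0 (t - 0)"
        by (intro tendsto_intros LIMSEQ_inverse_real_of_nat)
      then show ?thesis using that by simp
    qed
    show "(\<lambda>n. x (u n)) \<longlonglongrightarrow> left_lim x t"
      if "t > 0" "u \<longlonglongrightarrow> t" "\<forall>\<^sub>F n in sequentially. 0 \<le> u n \<and> u n \<le> max 0 (t - inverse (real (Suc n)))" for u t
    proof (rule tendsto_at_left_sequence[OF left_lim_tendsto[OF cadlag_x] that(2)])
      show "\<forall>\<^sub>F n in sequentially. u n < t"
        using that(3)
      proof eventually_elim
        case (elim n)
        have "max 0 (t - inverse (real (Suc n))) < t" using that(1) by simp
        then show ?case using elim by linarith
      qed
    qed (use that in auto)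
  qed auto
  have "s \<in> D" if "s > 0" "jump x s \<noteq> 0" for s
  proof (rule ccontr)
    assume "s \<notin> D"
    then have "(\<lambda>n. x s) \<longlonglongrightarrow> left_lim x s" using D(2)[OF that(1), of "\<lambda>_. s"] by simp
    then show False using that(2) by (simp add: LIMSEQ_const_iff jump_def)
  qed
  then show ?thesis by (intro countable_subset[OF _ D(1)]) auto
qed

lemma dx_bounded:
  obtains b where "b > 0" "\<forall>\<^sub>F n in sequentially. \<forall>i<kk n. tp n i \<le> T \<longrightarrow> norm (dx x n i) \<le> b"
proof -
  obtain B where B: "B \<ge> 0" "\<forall>\<^sub>F n in sequentially. \<forall>j<kk n. tp n j \<le> T \<longrightarrow> (\<Sum>i<Suc j. (norm (dx x n i))\<^sup>2) \<le> B"
    by (rule quad_bounded) (rule that)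
  have "\<forall>\<^sub>F n in sequentially. \<forall>i<kk n. tp n i \<le> T \<longrightarrow> norm (dx x n i) \<le> sqrt B + 1"
    using B(2)
  proof eventually_elim
    case (elim n)
    show ?case
    proof (intro allI impI)
      fix i assume i: "i < kk n" "tp n i \<le> T"
      have "(norm (dx x n i))\<^sup>2 \<le> (\<Sum>i<Suc i. (norm (dx x n i))\<^sup>2)"
        by (rule member_le_sum) auto
      also have "\<dots> \<le> B" using elim i by blast
      finally show "norm (dx x n i) \<le> sqrt B + 1" using real_le_rsqrt by fastforce
    qed
  qed
  then show thesis using B by (intro that[of "sqrt B + 1"]) (auto intro: add_nonneg_pos)
qed

text \<open>\<open>R\<close> is split into its quadratic part and \<open>\<phi>\<close> times the
  squared norm, where \<open>\<phi>\<close> is at most \<open>\<omega>\<close> of the norm. Where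
  \<open>x\<close> is continuous the increments vanish, and \<open>\<phi>\<close> with them; at a
  jump \<open>\<phi>\<close> converges at index \<open>lb n s\<close> because \<open>R\<close>,
  \<open>f\<close> and the increment all do.\<close>

lemma remainder_sum_convergent:
  fixes f :: "nat \<Rightarrow> real \<Rightarrow> real ^ 'm ^ 'm" and R :: "nat \<Rightarrow> nat \<Rightarrow> real"
  assumes t: "t \<ge> 0"
    and bd: "\<forall>\<^sub>F n in sequentially. \<forall>u\<in>{0..t}. norm (f n u) \<le> K"
    and left: "\<And>u s. s > 0 \<Longrightarrow> u \<longlonglongrightarrow> s \<Longrightarrow> \<forall>\<^sub>F n in sequentially. 0 \<le> u n \<and> u n \<le> last_before \<pi> n s \<Longrightarrow>
       (\<lambda>n. f n (u n)) \<longlonglongrightarrow> l s"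
    and \<omega>: "\<And>s. s \<ge> 0 \<Longrightarrow> 0 \<le> \<omega> s" "mono_on {0..} \<omega>" "(\<omega> \<longlongrightarrow> 0) (at_right 0)"
    and R: "\<forall>\<^sub>F n in sequentially. \<forall>i. 0 < i \<and> i < kk n \<and> tp n i \<le> t \<longrightarrow>
       \<bar>R n i - 1/2 * (f n (tp n i) \<bullet> outer (dx x n i))\<bar> \<le> \<omega> (norm (dx x n i)) * (norm (dx x n i))\<^sup>2"
    and J: "\<And>s. 0 < s \<Longrightarrow> s \<le> t \<Longrightarrow> (\<lambda>n. R n (lb n s)) \<longlonglongrightarrow> J s"
  shows "convergent (\<lambda>n. \<Sum>i=1..lo n t. R n i)"
proof -
  define \<rho> where "\<rho> n i = R n i - 1/2 * (f n (tp n i) \<bullet> outer (dx x n i))" for n i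
  define D where "D = {s. s > 0 \<and> jump x s \<noteq> 0}"
  define \<phi> where "\<phi> n i = \<rho> n i / (norm (dx x n i))\<^sup>2" for n i
  obtain b where b: "b > 0" "\<forall>\<^sub>F n in sequentially. \<forall>i<kk n. tp n i \<le> t \<longrightarrow> norm (dx x n i) \<le> b"
    by (rule dx_bounded) (rule that)
  have \<phi>_le: "\<bar>\<phi> n i\<bar> \<le> \<omega> (norm (dx x n i))"
    if "\<bar>\<rho> n i\<bar> \<le> \<omega> (norm (dx x n i)) * (norm (dx x n i))\<^sup>2" for n i
    using that \<omega>(1)[of "norm (dx x n i)"] by (cases "dx x n i = 0") (auto simp: \<phi>_def divide_le_eq)
  have "convergent (\<lambda>n. \<Sum>i=1..lo n t. \<phi> n i * (outer (dx x n i) \<bullet> mat 1))"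
  proof (rule weighted_sum_convergent[where D = D and C = "\<omega> b" and
      \<phi>l = "\<lambda>s. if s \<in> D then (J s - 1/2 * (l s \<bullet> outer (jump x s))) / (norm (jump x s))\<^sup>2 else 0"])
    show "0 \<le> outer d \<bullet> mat 1" for d :: "real ^ 'm" by (simp add: outer_inner_mat_1)
    show "\<forall>\<^sub>F n in sequentially. \<forall>i. 0 < i \<and> i < kk n \<and> tp n i \<le> t \<longrightarrow> \<bar>\<phi> n i\<bar> \<le> \<omega> b"
      using R b(2)
    proof eventually_elim
      case (elim n)
      show ?case
      proof (intro allI impI)
        fix i assume i: "0 < i \<and> i < kk n \<and> tp n i \<le> t"
        then have "\<bar>\<phi> n i\<bar> \<le> \<omega> (norm (dx x n i))" using elim(1) by (intro \<phi>_le) (simp add: \<rho>_def)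
        also have "\<dots> \<le> \<omega> b" using elim(2) i b(1) by (intro mono_onD[OF \<omega>(2)]) auto
        finally show "\<bar>\<phi> n i\<bar> \<le> \<omega> b" .
      qed
    qed
    show "countable D" unfolding D_def by (rule jumps_countable)
    show "(\<lambda>n. \<phi> n (i n)) \<longlonglongrightarrow> (if s \<in> D then (J s - 1/2 * (l s \<bullet> outer (jump x s))) / (norm (jump x s))\<^sup>2 else 0)"
      if s: "0 < s" "s \<notin> D" "(\<lambda>n. tp n (i n)) \<longlonglongrightarrow> s"
        and ev: "\<forall>\<^sub>F n in sequentially. 0 < i n \<and> i n < kk n \<and> tp n (i n) \<le> t \<and> 0 < outer (dx x n (i n)) \<bullet> mat 1"
      for s i
    proof -
      have "(\<lambda>n. dx x n (i n)) \<longlonglongrightarrow> 0"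
        using s ev by (intro dx_continuous[of i s]) (auto simp: D_def elim: eventually_mono)
      then have "(\<lambda>n. norm (dx x n (i n))) \<longlonglongrightarrow> 0" by (rule tendsto_norm_zero)
      \<comment> \<open>\<open>\<omega>\<close> is known to vanish only along positive arguments
        decreasing to 0; the positive weight rules out zero increments.\<close>
      then have "filterlim (\<lambda>n. norm (dx x n (i n))) (at_right 0) sequentially"
        using ev by (auto simp: filterlim_at outer_inner_mat_1 elim: eventually_mono)
      from filterlim_compose[OF \<omega>(3) this] have lim: "(\<lambda>n. \<omega> (norm (dx x n (i n)))) \<longlonglongrightarrow> 0" .
      have "(\<lambda>n. \<phi> n (i n)) \<longlonglongrightarrow> 0"
      proof (rule Lim_null_comparison[OF _ lim])
        show "\<forall>\<^sub>F n in sequentially. norm (\<phi> n (i n)) \<le> \<omega> (norm (dx x n (i n)))"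
          using R ev
        proof eventually_elim
          case (elim n)
          then show ?case using \<phi>_le[of n "i n"] by (simp add: \<rho>_def)
        qed
      qed
      then show ?thesis using s by simp
    qed
    show "(\<lambda>n. \<phi> n (lb n s)) \<longlonglongrightarrow> (if s \<in> D then (J s - 1/2 * (l s \<bullet> outer (jump x s))) / (norm (jump x s))\<^sup>2 else 0)"
      if s: "s \<in> D" "0 < s" "s \<le> t" for s
    proof -
      have "(\<lambda>n. f n (tp n (lb n s))) \<longlonglongrightarrow> l s"
        using s lb_tendsto[of "\<lambda>_. s" s]
        by (intro left) (auto simp: last_before_eq)
      then have "(\<lambda>n. \<phi> n (lb n s)) \<longlonglongrightarrow> (J s - 1/2 * (l s \<bullet> outer (jump x s))) / (norm (jump x s))\<^sup>2"
        unfolding \<phi>_def \<rho>_def using s by (intro tendsto_intros J dx_lb) (auto simp: D_def)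
      then show ?thesis using s by simp
    qed
  qed (rule t)
  moreover have "convergent (\<lambda>n. \<Sum>i=1..lo n t. f n (tp n i) \<bullet> outer (dx x n i))"
    using t bd left by (rule matrix_sum_convergent)
  ultimately obtain L1 L2 where L: "(\<lambda>n. \<Sum>i=1..lo n t. \<phi> n i * (outer (dx x n i) \<bullet> mat 1)) \<longlonglongrightarrow> L1"
    "(\<lambda>n. \<Sum>i=1..lo n t. f n (tp n i) \<bullet> outer (dx x n i)) \<longlonglongrightarrow> L2" unfolding convergent_def by blast
  have "(\<lambda>n. (\<Sum>i=1..lo n t. \<phi> n i * (outer (dx x n i) \<bullet> mat 1)) +
      1/2 * (\<Sum>i=1..lo n t. f n (tp n i) \<bullet> outer (dx x n i))) \<longlonglongrightarrow> L1 + 1/2 * L2"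
    by (intro tendsto_intros L)
  then have "(\<lambda>n. \<Sum>i=1..lo n t. R n i) \<longlonglongrightarrow> L1 + 1/2 * L2"
  proof (rule Lim_transform_eventually)
    have ev_lo: "\<forall>\<^sub>F n in sequentially. lo n t < kk n \<and> tp n (lo n t) \<le> t \<and> t < tp n (Suc (lo n t))"
      using eventually_lo_const[OF t] .
    show "\<forall>\<^sub>F n in sequentially. (\<Sum>i=1..lo n t. \<phi> n i * (outer (dx x n i) \<bullet> mat 1)) +
        1/2 * (\<Sum>i=1..lo n t. f n (tp n i) \<bullet> outer (dx x n i)) = (\<Sum>i=1..lo n t. R n i)"
      using R ev_lo
    proof eventually_elim
      case (elim n)
      have "\<phi> n i * (outer (dx x n i) \<bullet> mat 1) + 1/2 * (f n (tp n i) \<bullet> outer (dx x n i)) = R n i"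
        if i: "i \<in> {1..lo n t}" for i
      proof -
        have "tp n i \<le> tp n (lo n t)" using i elim by (intro tp_le) auto
        then have "\<bar>\<rho> n i\<bar> \<le> \<omega> (norm (dx x n i)) * (norm (dx x n i))\<^sup>2"
          using elim i by (auto simp: \<rho>_def)
        \<comment> \<open>For a zero increment the estimate forces \<open>\<rho> n i = 0\<close>, in
          agreement with the division by zero in \<open>\<phi>\<close>.\<close>
        then have "\<phi> n i * (norm (dx x n i))\<^sup>2 = \<rho> n i"
          by (cases "dx x n i = 0") (auto simp: \<phi>_def)
        then show ?thesis by (simp add: outer_inner_mat_1 \<rho>_def)
      qed
      then show ?case by (simp add: sum_distrib_left flip: sum.distrib)
    qed
  qed
  then show ?thesis by (rule convergentI)
qed

end

section \<open>Calculus of functionals\<close>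

lemma at_within_atLeast: "at t within {t..} = at_right (t::real)"
  by (rule at_within_nhd[where S = UNIV]) auto

lemma left_contD:
  assumes "left_cont \<pi> \<Omega> G" "x \<in> \<Omega>" "0 \<le> t"
  shows "((\<lambda>s. G s (stop s x)) \<longlongrightarrow> G t (stop_left t x)) (at t within {0..<t})"
    and "\<And>u. u \<longlonglongrightarrow> t \<Longrightarrow> \<forall>\<^sub>F n in sequentially. 0 \<le> u n \<and> u n \<le> last_before \<pi> n t \<Longrightarrow>
      (\<lambda>n. G (u n) (stop_left (u n) (pw_const \<pi> n x))) \<longlonglongrightarrow> G t (stop_left t x)"
    and "\<And>u. u \<longlonglongrightarrow> t \<Longrightarrow> \<forall>\<^sub>F n in sequentially. 0 \<le> u n \<and> u n < last_before \<pi> n t \<Longrightarrow>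
      (\<lambda>n. G (u n) (stop (u n) (pw_const \<pi> n x))) \<longlonglongrightarrow> G t (stop_left t x)"
  using assms unfolding left_cont_def by auto

lemma right_contD:
  assumes "right_cont \<pi> \<Omega> G" "x \<in> \<Omega>" "0 \<le> t"
  shows "((\<lambda>s. G s (stop s x)) \<longlongrightarrow> G t (stop t x)) (at_right t)"
    and "\<And>u. u \<longlonglongrightarrow> t \<Longrightarrow> \<forall>\<^sub>F n in sequentially. last_before \<pi> n t \<le> u n \<Longrightarrow>
      (\<lambda>n. G (u n) (stop (u n) (pw_const \<pi> n x))) \<longlonglongrightarrow> G t (stop t x)"
    and "\<And>u. u \<longlonglongrightarrow> t \<Longrightarrow> \<forall>\<^sub>F n in sequentially. last_before \<pi> n t < u n \<Longrightarrow>
      (\<lambda>n. G (u n) (stop_left (u n) (pw_const \<pi> n x))) \<longlonglongrightarrow> G t (stop t x)"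
  using assms unfolding right_cont_def at_within_atLeast by auto

text \<open>A linear functional \<open>D\<close> is the inner product with
  \<open>adjoint D 1\<close>; uniqueness of the derivative makes the definite description in
  \<open>vert_grad\<close> denote this vector.\<close>

lemma GDERIV_vert_grad:
  assumes "(\<lambda>e. F t (bump t e y)) differentiable (at 0)"
  shows "GDERIV (\<lambda>e. F t (bump t e y)) 0 :> vert_grad F t y"
proof -
  obtain D where D: "((\<lambda>e. F t (bump t e y)) has_derivative D) (at 0)"
    using assms unfolding differentiable_def by blast
  then have "linear D" by (rule has_derivative_linear)
  then have "D = (\<lambda>h. h \<bullet> adjoint D 1)" by (auto simp: adjoint_works)
  then have g: "GDERIV (\<lambda>e. F t (bump t e y)) 0 :> adjoint D 1"
    unfolding gderiv_def using D by simp
  have "g = adjoint D 1" if "GDERIV (\<lambda>e. F t (bump t e y)) 0 :> g" for g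
  proof -
    have "(\<lambda>h. h \<bullet> g) = (\<lambda>h. h \<bullet> adjoint D 1)"
      using that g unfolding gderiv_def by (rule has_derivative_unique)
    then show ?thesis by (simp only: fun_eq_iff vector_eq_ldot)
  qed
  with g show ?thesis unfolding vert_grad_def by (rule theI)
qed

lemma vert_grad_eqI: "GDERIV (\<lambda>e. F t (bump t e y)) 0 :> g \<Longrightarrow> vert_grad F t y = g"
proof -
  assume g: "GDERIV (\<lambda>e. F t (bump t e y)) 0 :> g"
  then have "(\<lambda>e. F t (bump t e y)) differentiable (at 0)"
    unfolding gderiv_def differentiable_def by blast
  then have "(\<lambda>h. h \<bullet> vert_grad F t y) = (\<lambda>h. h \<bullet> g)"
    using GDERIV_vert_grad g unfolding gderiv_def by (blast intro: has_derivative_unique)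
  then show ?thesis by (simp only: fun_eq_iff vector_eq_ldot)
qed

section \<open>Taylor expansion in space and integration in time\<close>

locale ito_setting = partitions \<pi> for \<pi> :: "nat \<Rightarrow> real list" +
  fixes \<Omega> :: "('m::finite path) set"
    and \<U> :: "real \<Rightarrow> 'm path \<Rightarrow> (real ^ 'm) set"
    and F :: "real \<Rightarrow> 'm path \<Rightarrow> real"
  assumes generic: "generic \<pi> \<Omega>" and Q_paths: "\<Omega> \<subseteq> Q_paths \<pi>"
    and nbhds: "jump_nbhds \<Omega> \<U>" and C12: "C12 \<pi> \<Omega> \<U> F"
begin

lemma F_left: "left_cont \<pi> \<Omega> F" and F_right: "right_cont \<pi> \<Omega> F"
  and hor_diff: "hor_differentiable \<Omega> F" and vert_diff: "vert_differentiable \<Omega> F"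
  and vert_diff2: "vert_differentiable \<Omega> (vert_grad F)"
  and hor_right: "right_cont \<pi> \<Omega> (hor_deriv F)" and hor_bdd: "locally_bdd \<pi> \<Omega> (hor_deriv F)"
  and grad_left: "left_cont \<pi> \<Omega> (pre (vert_grad F))"
  and hess_left: "left_cont \<pi> \<Omega> (pre (vert_hess F))"
  and hess_bdd: "locally_bdd \<pi> \<Omega> (pre (vert_hess F))"
  and hess_modulus: "vert_modulus \<pi> \<Omega> \<U> (vert_hess F)"
  using C12 unfolding C12_def continuous_fun_def by auto

lemma cadlag: "x \<in> \<Omega> \<Longrightarrow> cadlag x"
  using generic unfolding generic_def by auto

lemma stop_in: assumes "x \<in> \<Omega>" "0 \<le> t" shows "stop t x \<in> \<Omega>"
proof -
  obtain U where U: "0 \<in> interior U" "\<And>e. e \<in> U \<Longrightarrow> bump t e (stop t x) \<in> \<Omega>"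
    using generic assms unfolding generic_def by meson
  show ?thesis using U(2)[of 0] U(1) interior_subset by auto
qed

text \<open>Genericity admits the bump \<open>- jump x t\<close> of the path stopped at
  \<open>t\<close>, and this bump removes the jump.\<close>

lemma stop_left_in: assumes "x \<in> \<Omega>" "0 \<le> t" shows "stop_left t x \<in> \<Omega>"
proof -
  obtain U where U: "- jump x t \<in> U" "\<And>e. e \<in> U \<Longrightarrow> bump t e (stop t x) \<in> \<Omega>"
    using generic assms unfolding generic_def by meson
  then show ?thesis by (simp add: stop_left_eq_bump)
qed

lemma LamI: "y \<in> \<Omega> \<Longrightarrow> 0 \<le> t \<Longrightarrow> stop t y = y \<Longrightarrow> (t, y) \<in> Lam \<Omega>"
  unfolding Lam_def by (metis (mono_tags, lifting) mem_Collect_eq)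

lemma stop_Lam: "x \<in> \<Omega> \<Longrightarrow> 0 \<le> t \<Longrightarrow> (t, stop t x) \<in> Lam \<Omega>"
  by (auto simp: Lam_def)

lemma stop_left_Lam: "x \<in> \<Omega> \<Longrightarrow> 0 \<le> t \<Longrightarrow> (t, stop_left t x) \<in> Lam \<Omega>"
  by (intro LamI stop_left_in stop_stop_left)

lemma LamE:
  assumes "(t, y) \<in> Lam \<Omega>"
  obtains "0 \<le> t" "y \<in> \<Omega>" "stop t y = y"
  using assms stop_in by (auto simp: Lam_def)

lemma eventually_pw_in: "x \<in> \<Omega> \<Longrightarrow> T > 0 \<Longrightarrow> \<forall>\<^sub>F n in sequentially. stop T (pw_const \<pi> n x) \<in> \<Omega>"
  using generic unfolding generic_def eventually_sequentially by blast

lemma bump_in: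
  assumes "w \<in> \<Omega>" "0 \<le> t" "e \<in> \<U> t (stop t w)"
  shows "bump t e (stop_left t w) \<in> \<Omega>" "(t, bump t e (stop_left t w)) \<in> Lam \<Omega>"
proof -
  have "\<forall>e\<in>\<U> t (stop t w). bump t e (stop_left t (stop t w)) \<in> \<Omega>"
    using nbhds stop_Lam[OF assms(1,2)] unfolding jump_nbhds_def by blast
  then show 1: "bump t e (stop_left t w) \<in> \<Omega>" using assms by (simp add: stop_left_stop)
  show "(t, bump t e (stop_left t w)) \<in> Lam \<Omega>"
    using 1 assms by (intro LamI) (simp_all add: stop_bump)
qed

text \<open>By convexity the segment from the path before its jump to the path after it stays in the
  admissible set, as a Taylor expansion across the jump needs.\<close>

lemma scaled_jump_in:
  assumes "w \<in> \<Omega>" "0 \<le> t" "0 \<le> \<theta>" "\<theta> \<le> 1"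
  shows "\<theta> *\<^sub>R jump w t \<in> \<U> t (stop t w)"
proof -
  have U: "convex (\<U> t (stop t w))" "0 \<in> interior (\<U> t (stop t w))" "jump (stop t w) t \<in> \<U> t (stop t w)"
    using nbhds stop_Lam[OF assms(1,2)] unfolding jump_nbhds_def by blast+
  have 0: "0 \<in> \<U> t (stop t w)" using U(2) interior_subset by blast
  have "(1 - \<theta>) *\<^sub>R 0 + \<theta> *\<^sub>R jump w t \<in> \<U> t (stop t w)"
    using convexD[OF U(1) 0, of "jump w t" "1 - \<theta>" \<theta>] U(3) assms by (simp add: jump_stop)
  then show ?thesis by simp
qed

text \<open>Taylor's formula with Lagrange remainder in the parameter \<open>\<theta>\<close> from 0
  to 1, along the paths that carry only the fraction \<open>\<theta>\<close> of the jump.\<close>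

lemma taylor_jump:
  assumes w: "w \<in> \<Omega>" "0 \<le> t"
  defines "d \<equiv> jump w t" and "y \<equiv> stop_left t w"
  obtains \<theta> where "0 \<le> \<theta>" "\<theta> \<le> 1"
    "F t (stop t w) - F t y - vert_grad F t y \<bullet> d = 1/2 * (vert_hess F t (bump t (\<theta> *\<^sub>R d) y) \<bullet> outer d)"
proof -
  define b where "b \<theta> = bump t (\<theta> *\<^sub>R d) y" for \<theta>
  have b_Lam: "(t, b \<theta>) \<in> Lam \<Omega>" if "0 \<le> \<theta>" "\<theta> \<le> 1" for \<theta>
    unfolding b_def y_def d_def by (intro bump_in scaled_jump_in w that)
  \<comment> \<open>Vertical derivatives are taken at bump 0, so the derivative at parameter
    \<open>\<theta>\<close> is obtained by taking \<open>b \<theta>\<close> as the new base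
    path.\<close>
  have b_bump: "bump t ((s - \<theta>) *\<^sub>R d) (b \<theta>) = b s" for s \<theta>
    by (simp add: b_def bump_bump scaleR_diff_left)
  have lin: "((\<lambda>s. (s - \<theta>) *\<^sub>R d) has_derivative (\<lambda>h. h *\<^sub>R d)) (at \<theta>)" for \<theta>
    by (auto intro!: derivative_eq_intros)
  have D1: "((\<lambda>s. F t (b s)) has_real_derivative vert_grad F t (b \<theta>) \<bullet> d) (at \<theta>)" if "0 \<le> \<theta>" "\<theta> \<le> 1" for \<theta>
  proof -
    have "(\<lambda>e. F t (bump t e (b \<theta>))) differentiable (at 0)"
      using vert_diff b_Lam[OF that] unfolding vert_differentiable_def by blast
    then have "((\<lambda>e. F t (bump t e (b \<theta>))) has_derivative (\<lambda>h. h \<bullet> vert_grad F t (b \<theta>))) (at ((\<theta> - \<theta>) *\<^sub>R d))"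
      using GDERIV_vert_grad unfolding gderiv_def by simp
    from has_derivative_compose[OF lin this]
    have "((\<lambda>s. F t (b s)) has_derivative (\<lambda>h. (h *\<^sub>R d) \<bullet> vert_grad F t (b \<theta>))) (at \<theta>)"
      unfolding b_bump .
    then show ?thesis
      by (rule has_derivative_imp_has_field_derivative) (simp add: inner_commute)
  qed
  have D2: "((\<lambda>s. vert_grad F t (b s) \<bullet> d) has_real_derivative vert_hess F t (b \<theta>) \<bullet> outer d) (at \<theta>)"
    if "0 \<le> \<theta>" "\<theta> \<le> 1" for \<theta>
  proof -
    have "(\<lambda>e. vert_grad F t (bump t e (b \<theta>))) differentiable (at 0)"
      using vert_diff2 b_Lam[OF that] unfolding vert_differentiable_def by blast
    then have "((\<lambda>e. vert_grad F t (bump t e (b \<theta>))) has_derivative (\<lambda>h. vert_hess F t (b \<theta>) *v h)) (at ((\<theta> - \<theta>) *\<^sub>R d))"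
      unfolding vert_hess_def by (simp add: jacobian_works)
    from has_derivative_compose[OF lin this]
    have "((\<lambda>s. vert_grad F t (b s)) has_derivative (\<lambda>h. vert_hess F t (b \<theta>) *v (h *\<^sub>R d))) (at \<theta>)"
      unfolding b_bump .
    then have "((\<lambda>s. vert_grad F t (b s) \<bullet> d) has_derivative (\<lambda>h. (vert_hess F t (b \<theta>) *v (h *\<^sub>R d)) \<bullet> d)) (at \<theta>)"
      by (rule has_derivative_inner_left)
    then show ?thesis
      by (rule has_derivative_imp_has_field_derivative) (simp add: inner_outer[of "vert_hess F t (b \<theta>)" d] inner_commute[of _ d] matrix_vector_mult_scaleR)
  qed
  define diff :: "nat \<Rightarrow> real \<Rightarrow> real" where "diff m s = (if m = 0 then F t (b s) else if m = 1 then vert_grad F t (b s) \<bullet> d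
      else vert_hess F t (b s) \<bullet> outer d)" for m s
  have "diff 0 = (\<lambda>s. F t (b s))" "diff (Suc 0) = (\<lambda>s. vert_grad F t (b s) \<bullet> d)"
    "diff (Suc (Suc 0)) = (\<lambda>s. vert_hess F t (b s) \<bullet> outer d)" by (auto simp: diff_def)
  note diff_eqs = this
  have "\<exists>\<theta>>0. \<theta> < 1 \<and> F t (b 1) = (\<Sum>m<2. diff m 0 / fact m * 1 ^ m) + diff 2 \<theta> / fact 2 * 1 ^ 2"
  proof (rule Maclaurin)
    show "\<forall>m t. m < 2 \<and> 0 \<le> t \<and> t \<le> 1 \<longrightarrow> (diff m has_real_derivative diff (Suc m) t) (at t)"
      using D1 D2 by (auto simp: diff_eqs less_Suc_eq numeral_2_eq_2)
  qed (auto simp: diff_def)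
  then obtain \<theta> where \<theta>: "0 < \<theta>" "\<theta> < 1" "F t (b 1) = (\<Sum>m<2. diff m 0 / fact m * 1 ^ m) + diff 2 \<theta> / fact 2 * 1 ^ 2"
    by blast
  have "b 1 = stop t w" by (simp add: b_def d_def y_def stop_eq_bump[of t w])
  moreover have "b 0 = y" by (simp add: b_def)
  ultimately have "F t (stop t w) - F t y - vert_grad F t y \<bullet> d = 1/2 * (vert_hess F t (bump t (\<theta> *\<^sub>R d) y) \<bullet> outer d)"
    using \<theta>(3) by (simp add: diff_def numeral_2_eq_2 b_def)
  then show thesis using \<theta> by (intro that) auto
qed

lemma hor_right_deriv:
  assumes "w \<in> \<Omega>" "0 \<le> s" "stop s w = w"
  shows "((\<lambda>s. F s w) has_vector_derivative hor_deriv F s w) (at_right s)"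
proof -
  obtain L where L: "(hor_quot F s w \<longlongrightarrow> L) (at_right 0)"
    using hor_diff LamI[OF assms] unfolding hor_differentiable_def by blast
  then have "hor_deriv F s w = L" unfolding hor_deriv_def by (intro tendsto_Lim) auto
  then have "(hor_quot F s w \<longlongrightarrow> hor_deriv F s w) (at_right 0)" using L by simp
  then have "((\<lambda>r. (F (r + s) w - F s w) / (r + s - s)) \<longlongrightarrow> hor_deriv F s w) (at_right 0)"
    unfolding hor_quot_def by (simp add: add.commute)
  then have "((\<lambda>r. (F r w - F s w) / (r - s)) \<longlongrightarrow> hor_deriv F s w) (at_right s)"
    by (subst filterlim_at_right_to_0)
  then show ?thesis
    by (simp add: has_real_derivative_iff_has_vector_derivative[symmetric] has_field_derivative_iff)
qed

text \<open>A path constant from \<open>a\<close> on is unchanged by stopping at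
  \<open>r \<ge> a\<close> and by stopping just before \<open>r > a\<close>, so both one-sided
  conditions on \<open>F\<close> concern the time variable alone.\<close>

lemma hor_continuous:
  assumes w: "w \<in> \<Omega>" "0 \<le> a" "stop a w = w"
  shows "continuous_on {a..b} (\<lambda>s. F s w)"
  unfolding continuous_on_eq_continuous_within
proof
  fix s assume s: "s \<in> {a..b}"
  have st: "stop r w = w" if "r \<ge> a" for r using stop_mono[OF w(3) that] .
  have "((\<lambda>r. F r (stop r w)) \<longlongrightarrow> F s (stop s w)) (at_right s)"
    using right_contD(1)[OF F_right w(1)] s w by auto
  moreover have "\<forall>\<^sub>F r in at_right s. F r (stop r w) = F r w"
    using eventually_at_right_less[of s] by eventually_elim (use st s in auto)
  ultimately have right: "((\<lambda>r. F r w) \<longlongrightarrow> F s w) (at_right s)"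
    using st s by (auto intro: Lim_transform_eventually)
  show "continuous (at s within {a..b}) (\<lambda>s. F s w)"
  proof (cases "s = a")
    case True
    have "at a within {a..b} \<le> at_right a"
      unfolding at_within_atLeast[symmetric] by (rule at_le) auto
    then show ?thesis using right True unfolding continuous_within by (blast intro: tendsto_mono)
  next
    case False
    then have as: "a < s" using s by auto
    have "((\<lambda>r. F r (stop r w)) \<longlongrightarrow> F s (stop_left s w)) (at s within {0..<s})"
      using left_contD(1)[OF F_left w(1)] as w by auto
    moreover have "at s within {0..<s} = at_left s" using as w(2)
      by (intro at_within_nhd[where S = "{0<..}"]) auto
    moreover have "stop_left s w = w" using as w by (intro stop_left_const) auto
    ultimately have "((\<lambda>r. F r (stop r w)) \<longlongrightarrow> F s w) (at_left s)" by simp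
    moreover have "\<forall>\<^sub>F r in at_left s. F r (stop r w) = F r w"
      using eventually_at_left_real[OF as] by eventually_elim (use st in auto)
    ultimately have "((\<lambda>r. F r w) \<longlongrightarrow> F s w) (at_left s)" by (rule Lim_transform_eventually)
    then have "isCont (\<lambda>r. F r w) s" using right unfolding isCont_def by (simp add: filterlim_split_at)
    then show ?thesis by (rule continuous_at_imp_continuous_at_within)
  qed
qed

text \<open>Up to the right end of a partition interval the stopped \<open>x\<^sup>n\<close> is one
  fixed path \<open>w\<close>. So \<open>F s w\<close> minus the integral of the horizontal
  derivative is continuous with right derivative 0, hence constant; just before the right end the
  path is still \<open>w\<close>.\<close>

lemma hor_integral:
  assumes z: "stop T z \<in> \<Omega>" and j: "j < kk n" "z = pw_const \<pi> n x" "tp n (Suc j) \<le> T"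
    and bd: "\<And>s. s \<in> {0..T} \<Longrightarrow> \<bar>hor_deriv F s (stop s z)\<bar> \<le> K"
  shows "F (tp n (Suc j)) (stop_left (tp n (Suc j)) z) - F (tp n j) (stop (tp n j) z) =
    integral {0..tp n (Suc j)} (\<lambda>s. hor_deriv F s (stop s z)) - integral {0..tp n j} (\<lambda>s. hor_deriv F s (stop s z))"
proof -
  define g where "g s = hor_deriv F s (stop s z)" for s
  define a where "a = tp n j"
  define b where "b = tp n (Suc j)"
  define w where "w = stop a z"
  have ab: "0 \<le> a" "a < b" "b \<le> T" using j by (auto simp: a_def b_def intro: tp_nonneg tp_less)
  have w_in: "w \<in> \<Omega>" using stop_in[OF z, of a] ab by (simp add: w_def min_def)
  have w_stop: "stop a w = w" by (simp add: w_def)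
  have w_eq: "stop s z = w" if "a \<le> s" "s < b" for s
    using stop_pw_const[of j n s x] that j by (simp add: w_def a_def b_def)
  have rc: "(g \<longlongrightarrow> g s) (at_right s)" if s: "0 \<le> s" "s < T" for s
  proof -
    have "((\<lambda>r. hor_deriv F r (stop r (stop T z))) \<longlongrightarrow> hor_deriv F s (stop s (stop T z))) (at_right s)"
      using right_contD(1)[OF hor_right z s(1)] .
    moreover have "\<forall>\<^sub>F r in at_right s. hor_deriv F r (stop r (stop T z)) = g r"
      using eventually_at_right_real[OF s(2)] by eventually_elim (simp add: g_def min_def)
    ultimately show ?thesis using s by (auto simp: g_def intro: Lim_transform_eventually)
  qed
  have int: "g integrable_on {0..T}"
    by (rule right_cont_bounded_integrable[where K = K]) (use rc bd in \<open>auto simp: g_def\<close>)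
  have cont: "continuous_on {a..b} (\<lambda>s. F s w - integral {0..s} g)"
  proof (intro continuous_intros hor_continuous w_in w_stop ab)
    have "continuous_on {0..T} (\<lambda>s. integral {0..s} g)" by (rule indefinite_integral_continuous_1[OF int])
    then show "continuous_on {a..b} (\<lambda>s. integral {0..s} g)" by (rule continuous_on_subset) (use ab in auto)
  qed
  have "F b w - integral {0..b} g = F a w - integral {0..a} g"
  proof (rule right_deriv_zero_imp_const[OF _ cont, where D = "{}"])
    fix s assume s: "s \<in> {a..<b} - {}"
    have "stop s w = w" using stop_mono[OF w_stop] s by simp
    then have 1: "((\<lambda>s. F s w) has_vector_derivative hor_deriv F s w) (at_right s)"
      using s ab by (intro hor_right_deriv w_in) auto
    have 2: "((\<lambda>u. integral {0..u} g) has_vector_derivative g s) (at_right s)"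
      using s ab by (intro integral_right_deriv[OF int] rc) auto
    have "g s = hor_deriv F s w" using s w_eq by (simp add: g_def)
    then show "((\<lambda>s. F s w - integral {0..s} g) has_vector_derivative 0) (at_right s)"
      using has_vector_derivative_diff[OF 1 2] by simp
  qed (use ab in auto)
  moreover have "stop_left b z = w"
    using stop_left_pw_const[of j n b x] ab j by (simp add: w_def a_def b_def)
  ultimately show ?thesis
    unfolding a_def[symmetric] b_def[symmetric] w_def[symmetric] g_def[symmetric] by simp
qed

end

section \<open>The pathwise change of variable formula\<close>

context ito_setting
begin

definition gterm :: "'m path \<Rightarrow> nat \<Rightarrow> nat \<Rightarrow> real" where
  "gterm y n i = vert_grad F (tp n i) (stop_left (tp n i) (pw_const \<pi> n y)) \<bullet> dx y n i"

text \<open>The sum starts at index 1 so that it matches the jumps of \<open>x\<^sup>n\<close>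
  exactly; the increment with index 0 is already part of the initial value of
  \<open>x\<^sup>n\<close>.\<close>

definition gsum :: "'m path \<Rightarrow> nat \<Rightarrow> nat \<Rightarrow> real" where
  "gsum y n j = (\<Sum>i=1..j. gterm y n i)"

end

section \<open>Telescoping along one path\<close>

locale ito_path = ito_setting \<pi> \<Omega> \<U> F for \<pi> and \<Omega> :: "('m::finite path) set" and \<U> F +
  fixes x :: "'m path" and V :: "real \<Rightarrow> real ^ 'm ^ 'm"
  assumes x_in: "x \<in> \<Omega>" and J1_x: "J1_lim (quad_sum \<pi> x) V"

sublocale ito_path \<subseteq> qv_path \<pi> x V
  using cadlag[OF x_in] J1_x by unfold_locales

context ito_path
begin

abbreviation z :: "nat \<Rightarrow> 'm path" where "z n \<equiv> pw_const \<pi> n x"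

definition hn :: "nat \<Rightarrow> real \<Rightarrow> real" where "hn n s = hor_deriv F s (stop s (z n))"
definition h :: "real \<Rightarrow> real" where "h s = hor_deriv F s (stop s x)"
definition Hn :: "nat \<Rightarrow> real \<Rightarrow> real ^ 'm ^ 'm" where "Hn n s = vert_hess F s (stop_left s (z n))"
text \<open>For positive \<open>i\<close>, the remainder of the first-order Taylor expansion of
  \<open>F\<close> across the jump of \<open>x\<^sup>n\<close> at \<open>tp n i\<close>.\<close>

definition R :: "nat \<Rightarrow> nat \<Rightarrow> real" where
  "R n i = F (tp n i) (stop (tp n i) (z n)) - F (tp n i) (stop_left (tp n i) (z n)) - gterm x n i"

lemma quad_sum_limit_ge:
  assumes "t \<ge> 0" "u \<longlonglongrightarrow> t" "\<forall>\<^sub>F n in sequentially. 0 \<le> u n"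
    "\<forall>\<^sub>F n in sequentially. last_before \<pi> n t \<le> u n"
  shows "(\<lambda>n. quad_sum \<pi> x n (u n)) \<longlonglongrightarrow> V t"
  using assms quad_sum_limits(1)[of t u] quad_sum_limit_0[of u] by (cases "t = 0") auto

lemma hn_bounded:
  assumes "T \<ge> 0"
  obtains K where "\<forall>\<^sub>F n in sequentially. stop T (z n) \<in> \<Omega> \<and> (\<forall>s\<in>{0..T}. \<bar>hn n s\<bar> \<le> K)"
  using hor_bdd x_in assms unfolding locally_bdd_def eventually_sequentially hn_def
  by (metis real_norm_def)

lemma Hn_bounded:
  assumes "T \<ge> 0"
  obtains K where "\<forall>\<^sub>F n in sequentially. \<forall>s\<in>{0..T}. norm (Hn n s) \<le> K"
proof -
  obtain n0 K where K: "\<And>n s. n \<ge> n0 \<Longrightarrow> s \<in> {0..T} \<Longrightarrow> norm (pre (vert_hess F) s (stop s (z n))) \<le> K"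
    using hess_bdd x_in assms unfolding locally_bdd_def by meson
  have "pre (vert_hess F) s (stop s (z n)) = Hn n s" if "s \<in> {0..T}" for n s
    using that by (simp add: pre_def Hn_def stop_left_stop)
  then have "\<forall>\<^sub>F n in sequentially. \<forall>s\<in>{0..T}. norm (Hn n s) \<le> K"
    using K unfolding eventually_sequentially by metis
  then show thesis by (rule that)
qed

lemma hn_tendsto: "s \<ge> 0 \<Longrightarrow> (\<lambda>n. hn n s) \<longlonglongrightarrow> h s"
  unfolding hn_def h_def using last_before_le by (intro right_contD(2)[OF hor_right x_in]) auto

lemma h_right: "s \<ge> 0 \<Longrightarrow> (h \<longlongrightarrow> h s) (at_right s)"
  unfolding h_def by (rule right_contD(1)[OF hor_right x_in])

lemma hn_right:
  assumes "stop T (z n) \<in> \<Omega>" "0 \<le> s" "s < T"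
  shows "(hn n \<longlongrightarrow> hn n s) (at_right s)"
proof -
  have "((\<lambda>r. hor_deriv F r (stop r (stop T (z n)))) \<longlongrightarrow> hor_deriv F s (stop s (stop T (z n)))) (at_right s)"
    by (rule right_contD(1)[OF hor_right assms(1,2)])
  moreover have "\<forall>\<^sub>F r in at_right s. hor_deriv F r (stop r (stop T (z n))) = hn n r"
    using eventually_at_right_real[OF assms(3)] by eventually_elim (simp add: hn_def min_def)
  ultimately show ?thesis using assms(2,3) by (auto simp: hn_def intro: Lim_transform_eventually)
qed

lemma h_integrable: assumes "T \<ge> 0" shows "h integrable_on {0..T}"
proof -
  obtain K where K: "\<forall>\<^sub>F n in sequentially. stop T (z n) \<in> \<Omega> \<and> (\<forall>s\<in>{0..T}. \<bar>hn n s\<bar> \<le> K)"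
    using assms by (rule hn_bounded)
  show ?thesis
  proof (rule right_cont_bounded_integrable)
    show "norm (h s) \<le> K" if "0 \<le> s" "s \<le> T" for s
    proof (rule tendsto_upperbound[OF tendsto_norm[OF hn_tendsto[OF that(1)]]])
      show "\<forall>\<^sub>F n in sequentially. norm (hn n s) \<le> K" using K by eventually_elim (use that in auto)
    qed simp
  qed (rule h_right)
qed

text \<open>Dominated convergence on the fixed interval \<open>{0..t}\<close>, plus an error from
  the moving endpoint of at most \<open>K\<close> times its distance to \<open>t\<close>. The bound
  is taken up to \<open>t + 1\<close> to cover endpoints beyond \<open>t\<close>.\<close>

lemma integral_hn_tendsto:
  assumes t: "t \<ge> 0" and j: "\<forall>\<^sub>F n in sequentially. j n < kk n" "(\<lambda>n. tp n (j n)) \<longlonglongrightarrow> t"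
  shows "(\<lambda>n. integral {0..tp n (j n)} (hn n)) \<longlonglongrightarrow> integral {0..t} h"
proof -
  define T where "T = t + 1"
  have T: "T \<ge> 0" "t < T" using t by (auto simp: T_def)
  obtain K where K: "\<forall>\<^sub>F n in sequentially. stop T (z n) \<in> \<Omega> \<and> (\<forall>s\<in>{0..T}. \<bar>hn n s\<bar> \<le> K)"
    using T(1) by (rule hn_bounded)
  obtain n0 where n0: "\<And>n. n \<ge> n0 \<Longrightarrow> stop T (z n) \<in> \<Omega>" "\<And>n s. n \<ge> n0 \<Longrightarrow> s \<in> {0..T} \<Longrightarrow> \<bar>hn n s\<bar> \<le> K"
    using K unfolding eventually_sequentially by blast
  have int: "hn n integrable_on {0..u}" if "n \<ge> n0" "u \<le> T" for n u
  proof -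
    have "hn n integrable_on {0..T}"
      by (rule right_cont_bounded_integrable[where K = K, OF hn_right[OF n0(1)[OF that(1)]]])
        (use n0(2) that in auto)
    then show ?thesis by (rule integrable_on_subinterval) (use that in auto)
  qed
  have "(\<lambda>n. integral {0..t} (hn (n + n0))) \<longlonglongrightarrow> integral {0..t} h"
  proof (rule dominated_convergence(2)[where h = "\<lambda>_. K"])
    show "hn (k + n0) integrable_on {0..t}" for k using int T by auto
    show "norm (hn (k + n0) s) \<le> K" if "s \<in> {0..t}" for k s using n0(2)[of "k + n0" s] that T by auto
    show "(\<lambda>k. hn (k + n0) s) \<longlonglongrightarrow> h s" if "s \<in> {0..t}" for s
      using hn_tendsto[of s] that by (intro LIMSEQ_ignore_initial_segment) auto
  qed auto
  then have 1: "(\<lambda>n. integral {0..t} (hn n)) \<longlonglongrightarrow> integral {0..t} h"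
    by (rule LIMSEQ_offset)
  have lim: "(\<lambda>n. K * \<bar>tp n (j n) - t\<bar>) \<longlonglongrightarrow> 0"
    using j(2) by (auto intro!: tendsto_eq_intros)
  have 2: "(\<lambda>n. integral {0..tp n (j n)} (hn n) - integral {0..t} (hn n)) \<longlonglongrightarrow> 0"
  proof (rule Lim_null_comparison[OF _ lim])
    have "\<forall>\<^sub>F n in sequentially. tp n (j n) < T" by (rule order_tendstoD(2)[OF j(2) T(2)])
    then show "\<forall>\<^sub>F n in sequentially. norm (integral {0..tp n (j n)} (hn n) - integral {0..t} (hn n)) \<le> K * \<bar>tp n (j n) - t\<bar>"
      using j(1) eventually_ge_at_top[of n0]
    proof eventually_elim
      case (elim n)
      have diff: "\<bar>integral {0..b} (hn n) - integral {0..a} (hn n)\<bar> \<le> K * (b - a)" if "0 \<le> a" "a \<le> b" "b \<le> T" for a b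
      proof -
        have i: "hn n integrable_on {a..b}" by (rule integrable_on_subinterval[OF int[of n b]]) (use elim that in auto)
        have "integral {0..a} (hn n) + integral {a..b} (hn n) = integral {0..b} (hn n)"
          using that int[of n b] elim by (intro Henstock_Kurzweil_Integration.integral_combine) auto
        moreover have "norm (integral {a..b} (hn n)) \<le> integral {a..b} (\<lambda>_. K)"
          using n0(2)[of n] elim that i by (intro integral_norm_bound_integral) auto
        ultimately show ?thesis using that by (simp add: mult.commute)
      qed
      have "0 \<le> tp n (j n)" using elim by (intro tp_nonneg) auto
      then show ?case
        using diff[of t "tp n (j n)"] diff[of "tp n (j n)" t] elim t T by (cases "t \<le> tp n (j n)") (auto simp: abs_minus_commute)
    qed
  qed
  from tendsto_add[OF 2 1] show ?thesis by simp
qed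

text \<open>Between partition points \<open>F\<close> changes by the integral of the horizontal
  derivative, at a partition point by the gradient term plus \<open>R\<close>; the identity is
  solved for the gradient terms.\<close>

lemma telescope:
  assumes T: "stop T (z n) \<in> \<Omega>" "\<And>s. s \<in> {0..T} \<Longrightarrow> \<bar>hn n s\<bar> \<le> K"
  shows "j < kk n \<Longrightarrow> tp n j \<le> T \<Longrightarrow> gsum x n j = F (tp n j) (stop (tp n j) (z n)) - F 0 (stop 0 (z n)) -
    integral {0..tp n j} (hn n) - (\<Sum>i=1..j. R n i)"
proof (induction j)
  case 0
  then show ?case by (simp add: gsum_def)
next
  case (Suc j)
  have less: "tp n j < tp n (Suc j)" using Suc.prems by (intro tp_less) auto
  have "F (tp n (Suc j)) (stop_left (tp n (Suc j)) (z n)) - F (tp n j) (stop (tp n j) (z n)) =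
    integral {0..tp n (Suc j)} (hn n) - integral {0..tp n j} (hn n)"
    unfolding hn_def by (rule hor_integral[OF T(1) _ refl]) (use Suc.prems T(2) in \<open>auto simp: hn_def\<close>)
  moreover have "gsum x n (Suc j) = gsum x n j + gterm x n (Suc j)" by (simp add: gsum_def)
  ultimately show ?case using Suc.IH Suc.prems less by (simp add: R_def)
qed

lemma Hn_left:
  assumes "s > 0" "u \<longlonglongrightarrow> s" "\<forall>\<^sub>F n in sequentially. 0 \<le> u n \<and> u n \<le> last_before \<pi> n s"
  shows "(\<lambda>n. Hn n (u n)) \<longlonglongrightarrow> vert_hess F s (stop_left s x)"
proof -
  have "(\<lambda>n. pre (vert_hess F) (u n) (stop_left (u n) (z n))) \<longlonglongrightarrow> pre (vert_hess F) s (stop_left s x)"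
    using assms by (intro left_contD(2)[OF hess_left x_in]) auto
  moreover have "\<forall>\<^sub>F n in sequentially. pre (vert_hess F) (u n) (stop_left (u n) (z n)) = Hn n (u n)"
    using assms(3) by eventually_elim (simp add: pre_def Hn_def)
  ultimately show ?thesis using assms(1) by (auto simp: pre_def intro: Lim_transform_eventually)
qed

lemma gterm_lb:
  assumes "s > 0"
  shows "(\<lambda>n. gterm x n (lb n s)) \<longlonglongrightarrow> vert_grad F s (stop_left s x) \<bullet> jump x s"
proof -
  have "(\<lambda>n. pre (vert_grad F) (tp n (lb n s)) (stop_left (tp n (lb n s)) (z n))) \<longlonglongrightarrow> pre (vert_grad F) s (stop_left s x)"
    using assms lb_tendsto[of "\<lambda>_. s" s] by (intro left_contD(2)[OF grad_left x_in]) (auto simp: last_before_eq)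
  then show ?thesis using assms unfolding gterm_def pre_def
    by (intro tendsto_intros dx_lb) simp_all
qed

text \<open>The time \<open>t'\<^sub>n\<close> is admissible both in the left condition for the path
  before its jump and in the right condition for the path after it. So the jump of \<open>F\<close>
  along \<open>x\<^sup>n\<close> at \<open>t'\<^sub>n\<close> tends to the jump of \<open>F\<close>
  along \<open>x\<close> at \<open>s\<close>.\<close>

lemma R_lb:
  assumes "s > 0"
  shows "(\<lambda>n. R n (lb n s)) \<longlonglongrightarrow> F s (stop s x) - F s (stop_left s x) - vert_grad F s (stop_left s x) \<bullet> jump x s"
  unfolding R_def using assms lb_tendsto[of "\<lambda>_. s" s]
  by (intro tendsto_diff gterm_lb right_contD(2)[OF F_right x_in] left_contD(2)[OF F_left x_in])
    (auto simp: last_before_eq)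

text \<open>The Lagrange form evaluates the Hessian at a fraction of the jump, and the modulus of
  vertical continuity compares this with the Hessian before the jump. Its radius \<open>b\<close> is
  a common bound for the increments up to \<open>T\<close>.\<close>

lemma R_estimate:
  assumes "T \<ge> 0"
  obtains \<omega> where "\<And>s. s \<ge> 0 \<Longrightarrow> 0 \<le> \<omega> s" "mono_on {0..} \<omega>" "(\<omega> \<longlongrightarrow> 0) (at_right 0)"
    "\<forall>\<^sub>F n in sequentially. \<forall>i. 0 < i \<and> i < kk n \<and> tp n i \<le> T \<longrightarrow>
       \<bar>R n i - 1/2 * (Hn n (tp n i) \<bullet> outer (dx x n i))\<bar> \<le> \<omega> (norm (dx x n i)) * (norm (dx x n i))\<^sup>2"
proof -
  obtain b where b: "b > 0" "\<forall>\<^sub>F n in sequentially. \<forall>i<kk n. tp n i \<le> T \<longrightarrow> norm (dx x n i) \<le> b"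
    by (rule dx_bounded) (rule that)
  obtain \<omega> where \<omega>: "\<And>s. s \<ge> 0 \<Longrightarrow> 0 \<le> \<omega> s" "mono_on {0..} \<omega>" "(\<omega> \<longlongrightarrow> 0) (at_right 0)"
    and mod: "\<forall>\<^sub>F n in sequentially. \<forall>t\<in>{0..T}. \<forall>a \<in> \<U> t (stop t (z n)) \<inter> cball 0 b. \<forall>c \<in> \<U> t (stop t (z n)) \<inter> cball 0 b.
      norm (vert_hess F t (bump t a (stop_left t (z n))) - vert_hess F t (bump t c (stop_left t (z n)))) \<le> \<omega> (norm (a - c))"
    using hess_modulus x_in assms b(1) unfolding vert_modulus_def by blast
  have T': "\<forall>\<^sub>F n in sequentially. stop (T + 1) (z n) \<in> \<Omega>"
    using x_in assms by (intro eventually_pw_in) auto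
  have "\<forall>\<^sub>F n in sequentially. \<forall>i. 0 < i \<and> i < kk n \<and> tp n i \<le> T \<longrightarrow>
       \<bar>R n i - 1/2 * (Hn n (tp n i) \<bullet> outer (dx x n i))\<bar> \<le> \<omega> (norm (dx x n i)) * (norm (dx x n i))\<^sup>2"
    using b(2) mod T'
  proof eventually_elim
    case (elim n)
    show ?case
    proof (intro allI impI)
      fix i assume i: "0 < i \<and> i < kk n \<and> tp n i \<le> T"
      define t where "t = tp n i"
      \<comment> \<open>Genericity puts only stopped versions of \<open>x\<^sup>n\<close> into
        \<open>\<Omega>\<close>. Stopping at \<open>T + 1\<close>, a positive time after
        \<open>t\<close>, leaves the path up to and around \<open>t\<close> unchanged.\<close>
      define w where "w = stop (T + 1) (z n)"
      define d where "d = dx x n i"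
      have t: "0 \<le> t" "t \<le> T" using i by (auto simp: t_def intro: tp_nonneg)
      have "jump w t = jump (z n) t" using t jump_stop[of t w] jump_stop[of t "z n"] by (simp add: w_def min_def)
      also have "\<dots> = d" using jump_pw_const[of "i - 1" n x] i by (simp add: t_def d_def)
      finally have jump: "jump w t = d" .
      have sw: "stop t w = stop t (z n)" "stop_left t w = stop_left t (z n)"
        using t by (simp_all add: w_def min_def stop_left_stop)
      have w_in: "w \<in> \<Omega>" using elim by (simp add: w_def)
      obtain \<theta> where \<theta>: "0 \<le> \<theta>" "\<theta> \<le> 1"
        "F t (stop t w) - F t (stop_left t w) - vert_grad F t (stop_left t w) \<bullet> jump w t =
          1/2 * (vert_hess F t (bump t (\<theta> *\<^sub>R jump w t) (stop_left t w)) \<bullet> outer (jump w t))"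
        using w_in t(1) by (rule taylor_jump)
      then have R: "R n i = 1/2 * (vert_hess F t (bump t (\<theta> *\<^sub>R d) (stop_left t (z n))) \<bullet> outer d)"
        unfolding jump sw by (simp add: R_def gterm_def t_def d_def)
      define A where "A = vert_hess F t (bump t (\<theta> *\<^sub>R d) (stop_left t (z n))) - vert_hess F t (bump t 0 (stop_left t (z n)))"
      have db: "norm d \<le> b" using elim(1) i by (simp add: d_def)
      have "\<theta> *\<^sub>R d \<in> \<U> t (stop t (z n))" "0 *\<^sub>R d \<in> \<U> t (stop t (z n))"
        using scaled_jump_in[OF w_in t(1) \<theta>(1,2)] scaled_jump_in[OF w_in t(1), of 0] unfolding jump sw by auto
      moreover have \<theta>d: "norm (\<theta> *\<^sub>R d) \<le> norm d" using \<theta> by (simp add: mult_left_le_one_le)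
      ultimately have mem: "\<theta> *\<^sub>R d \<in> \<U> t (stop t (z n)) \<inter> cball 0 b" "0 \<in> \<U> t (stop t (z n)) \<inter> cball 0 b"
        using db b(1) by (auto simp: mem_cball dist_norm)
      have "t \<in> {0..T}" using t by simp
      from bspec[OF bspec[OF bspec[OF elim(2) this] mem(1)] mem(2)]
      have "norm A \<le> \<omega> (norm (\<theta> *\<^sub>R d - 0))" unfolding A_def .
      also have "\<dots> \<le> \<omega> (norm d)" using \<theta>d by (intro mono_onD[OF \<omega>(2)]) auto
      finally have A: "norm A \<le> \<omega> (norm d)" .
      have "\<bar>R n i - 1/2 * (Hn n t \<bullet> outer d)\<bar> = 1/2 * \<bar>A \<bullet> outer d\<bar>"
        by (simp add: R A_def Hn_def inner_diff_left abs_if)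
      also have "\<dots> \<le> \<bar>A \<bullet> outer d\<bar>" by simp
      also have "\<dots> \<le> norm A * norm (outer d)" by (rule Cauchy_Schwarz_ineq2)
      also have "\<dots> \<le> \<omega> (norm d) * (norm d)\<^sup>2" unfolding norm_outer using A by (rule mult_right_mono) simp
      finally show "\<bar>R n i - 1/2 * (Hn n (tp n i) \<bullet> outer (dx x n i))\<bar> \<le> \<omega> (norm (dx x n i)) * (norm (dx x n i))\<^sup>2"
        by (simp add: t_def d_def)
    qed
  qed
  with \<omega> show thesis by (rule that)
qed

text \<open>The constant adds the modulus at the largest increment to the bound on the
  Hessian.\<close>

lemma R_bounded:
  assumes "T \<ge> 0"
  obtains C where "C \<ge> 0" "\<forall>\<^sub>F n in sequentially. \<forall>i. 0 < i \<and> i < kk n \<and> tp n i \<le> T \<longrightarrow>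
    \<bar>R n i\<bar> \<le> C * (norm (dx x n i))\<^sup>2"
proof -
  obtain b where b: "b > 0" "\<forall>\<^sub>F n in sequentially. \<forall>i<kk n. tp n i \<le> T \<longrightarrow> norm (dx x n i) \<le> b"
    by (rule dx_bounded) (rule that)
  obtain K where K: "\<forall>\<^sub>F n in sequentially. \<forall>s\<in>{0..T}. norm (Hn n s) \<le> K"
    using assms by (rule Hn_bounded)
  obtain \<omega> where \<omega>: "\<And>s. s \<ge> 0 \<Longrightarrow> 0 \<le> \<omega> s" "mono_on {0..} \<omega>" "(\<omega> \<longlongrightarrow> 0) (at_right 0)"
    "\<forall>\<^sub>F n in sequentially. \<forall>i. 0 < i \<and> i < kk n \<and> tp n i \<le> T \<longrightarrow>
       \<bar>R n i - 1/2 * (Hn n (tp n i) \<bullet> outer (dx x n i))\<bar> \<le> \<omega> (norm (dx x n i)) * (norm (dx x n i))\<^sup>2"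
    using assms by (rule R_estimate) (rule that)
  have "\<forall>\<^sub>F n in sequentially. \<forall>i. 0 < i \<and> i < kk n \<and> tp n i \<le> T \<longrightarrow>
    \<bar>R n i\<bar> \<le> (\<omega> b + \<bar>K\<bar>) * (norm (dx x n i))\<^sup>2"
    using b(2) K \<omega>(4)
  proof eventually_elim
    case (elim n)
    show ?case
    proof (intro allI impI)
      fix i assume i: "0 < i \<and> i < kk n \<and> tp n i \<le> T"
      define d where "d = dx x n i"
      have "\<bar>Hn n (tp n i) \<bullet> outer d\<bar> \<le> norm (Hn n (tp n i)) * (norm d)\<^sup>2"
        using Cauchy_Schwarz_ineq2[of "Hn n (tp n i)" "outer d"] by (simp add: norm_outer)
      also have "\<dots> \<le> \<bar>K\<bar> * (norm d)\<^sup>2"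
      proof (rule mult_right_mono)
        have "norm (Hn n (tp n i)) \<le> K" using elim(2) i tp_nonneg[of i n] by auto
        then show "norm (Hn n (tp n i)) \<le> \<bar>K\<bar>" by simp
      qed simp
      finally have 1: "\<bar>Hn n (tp n i) \<bullet> outer d\<bar> \<le> \<bar>K\<bar> * (norm d)\<^sup>2" .
      have "\<omega> (norm d) \<le> \<omega> b" using elim(1) i b(1) by (intro mono_onD[OF \<omega>(2)]) (auto simp: d_def)
      then have "\<omega> (norm d) * (norm d)\<^sup>2 \<le> \<omega> b * (norm d)\<^sup>2" by (rule mult_right_mono) simp
      moreover have "\<bar>R n i - 1/2 * (Hn n (tp n i) \<bullet> outer d)\<bar> \<le> \<omega> (norm d) * (norm d)\<^sup>2"
        using elim(3) i by (simp add: d_def)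
      ultimately have "\<bar>R n i\<bar> \<le> \<omega> b * (norm d)\<^sup>2 + \<bar>K\<bar> * (norm d)\<^sup>2"
        using 1 by linarith
      then show "\<bar>R n i\<bar> \<le> (\<omega> b + \<bar>K\<bar>) * (norm (dx x n i))\<^sup>2" by (simp add: d_def algebra_simps)
    qed
  qed
  moreover have "\<omega> b + \<bar>K\<bar> \<ge> 0" using \<omega>(1)[of b] b(1) by simp
  ultimately show thesis using that by blast
qed

definition r :: "real \<Rightarrow> real" where "r t = lim (\<lambda>n. \<Sum>i=1..lo n t. R n i)"

lemma R_sum_lo:
  assumes "t \<ge> 0"
  shows "(\<lambda>n. \<Sum>i=1..lo n t. R n i) \<longlonglongrightarrow> r t"
proof -
  obtain \<omega> where \<omega>: "\<And>s. s \<ge> 0 \<Longrightarrow> 0 \<le> \<omega> s" "mono_on {0..} \<omega>" "(\<omega> \<longlongrightarrow> 0) (at_right 0)"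
    "\<forall>\<^sub>F n in sequentially. \<forall>i. 0 < i \<and> i < kk n \<and> tp n i \<le> t \<longrightarrow>
       \<bar>R n i - 1/2 * (Hn n (tp n i) \<bullet> outer (dx x n i))\<bar> \<le> \<omega> (norm (dx x n i)) * (norm (dx x n i))\<^sup>2"
    using assms by (rule R_estimate) (rule that)
  obtain K where K: "\<forall>\<^sub>F n in sequentially. \<forall>s\<in>{0..t}. norm (Hn n s) \<le> K"
    using assms by (rule Hn_bounded)
  have "convergent (\<lambda>n. \<Sum>i=1..lo n t. R n i)"
    by (rule remainder_sum_convergent[OF assms K Hn_left \<omega> R_lb]) simp_all
  then show ?thesis unfolding r_def by (simp add: convergent_LIMSEQ_iff)
qed

text \<open>Remainders are dominated by squared increments, so two index sequences with
  asymptotically equal \<open>quad_sum\<close> have asymptotically equal remainder sums. Convergence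
  is then needed for one sequence only.\<close>

lemma R_sum_diff:
  assumes j: "\<forall>\<^sub>F n in sequentially. j n < kk n \<and> tp n (j n) \<le> T"
    and k: "\<forall>\<^sub>F n in sequentially. k n < kk n \<and> tp n (k n) \<le> T"
    and q: "(\<lambda>n. quad_sum \<pi> x n (tp n (j n)) - quad_sum \<pi> x n (tp n (k n))) \<longlonglongrightarrow> 0"
  shows "(\<lambda>n. (\<Sum>i=1..j n. R n i) - (\<Sum>i=1..k n. R n i)) \<longlonglongrightarrow> 0"
proof -
  have "\<forall>\<^sub>F n :: nat in sequentially. 0 \<le> T"
    using j
  proof eventually_elim
    case (elim n)
    then show ?case using tp_nonneg[of "j n" n] by simp
  qed
  then have T: "T \<ge> 0" by simp
  obtain C where C: "C \<ge> 0" "\<forall>\<^sub>F n in sequentially. \<forall>i. 0 < i \<and> i < kk n \<and> tp n i \<le> T \<longrightarrow>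
      \<bar>R n i\<bar> \<le> C * (norm (dx x n i))\<^sup>2" using T by (rule R_bounded) (rule that)
  have lim: "(\<lambda>n. C * \<bar>(quad_sum \<pi> x n (tp n (j n)) - quad_sum \<pi> x n (tp n (k n))) \<bullet> mat 1\<bar>) \<longlonglongrightarrow> 0"
    using tendsto_mult[OF tendsto_const[of C] tendsto_rabs[OF tendsto_inner[OF q tendsto_const[of "mat 1"]]]] by simp
  show ?thesis
  proof (rule Lim_null_comparison[OF _ lim])
    show "\<forall>\<^sub>F n in sequentially. norm ((\<Sum>i=1..j n. R n i) - (\<Sum>i=1..k n. R n i)) \<le>
        C * \<bar>(quad_sum \<pi> x n (tp n (j n)) - quad_sum \<pi> x n (tp n (k n))) \<bullet> mat 1\<bar>"
      using j k C(2)
    proof eventually_elim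
      case (elim n)
      have *: "\<bar>(\<Sum>i=1..b. R n i) - (\<Sum>i=1..a. R n i)\<bar> \<le>
          C * \<bar>(quad_sum \<pi> x n (tp n b) - quad_sum \<pi> x n (tp n a)) \<bullet> mat 1\<bar>"
        if ab: "a \<le> b" "b < kk n" "tp n b \<le> T" for a b
      proof -
        have "(\<Sum>i=1..b. R n i) - (\<Sum>i=1..a. R n i) = (\<Sum>i\<in>{a<..b}. R n i)"
        proof -
          have "{1..b} = {1..a} \<union> {a<..b}" using ab(1) by auto
          then show ?thesis by (simp add: sum.union_disjoint disjoint_iff)
        qed
        moreover have "(quad_sum \<pi> x n (tp n b) - quad_sum \<pi> x n (tp n a)) = (\<Sum>i\<in>{a<..b}. outer (dx x n i))"
        proof -
          have "{..<Suc b} = {..<Suc a} \<union> {a<..b}" using ab(1) by auto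
          then show ?thesis using ab by (simp add: quad_sum_tp sum.union_disjoint disjoint_iff del: sum.lessThan_Suc)
        qed
        moreover have "\<bar>\<Sum>i\<in>{a<..b}. R n i\<bar> \<le> (\<Sum>i\<in>{a<..b}. C * (norm (dx x n i))\<^sup>2)"
        proof (rule order_trans[OF sum_abs sum_mono])
          fix i assume i: "i \<in> {a<..b}"
          then have "tp n i \<le> tp n b" using ab by (intro tp_le) auto
          then show "\<bar>R n i\<bar> \<le> C * (norm (dx x n i))\<^sup>2" using elim(3) i ab by auto
        qed
        moreover have "(\<Sum>i\<in>{a<..b}. C * (norm (dx x n i))\<^sup>2) = C * ((\<Sum>i\<in>{a<..b}. outer (dx x n i)) \<bullet> mat 1)"
          by (simp add: inner_sum_left outer_inner_mat_1 sum_distrib_left)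
        moreover have "C * ((\<Sum>i\<in>{a<..b}. outer (dx x n i)) \<bullet> mat 1) \<le> C * \<bar>(\<Sum>i\<in>{a<..b}. outer (dx x n i)) \<bullet> mat 1\<bar>"
          using C(1) by (intro mult_left_mono) auto
        ultimately show ?thesis by simp
      qed
      show ?case
      proof (cases "j n \<le> k n")
        case True
        have "(quad_sum \<pi> x n (tp n (j n)) - quad_sum \<pi> x n (tp n (k n))) \<bullet> mat 1 =
          - ((quad_sum \<pi> x n (tp n (k n)) - quad_sum \<pi> x n (tp n (j n))) \<bullet> mat 1)" by (simp add: inner_diff_left)
        then show ?thesis using *[OF True] elim by (simp add: abs_minus_commute)
      next
        case False
        then show ?thesis using *[of "k n" "j n"] elim by simp
      qed
    qed
  qed
qed

text \<open>The change of variable formula solved for the integral: the candidate limit of the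
  gradient sums, later identified with \<open>I x t\<close>.\<close>

definition m :: "real \<Rightarrow> real" where
  "m t = F t (stop t x) - F 0 (stop 0 x) - integral {0..t} h - r t"

lemma eventually_telescope:
  assumes j: "\<forall>\<^sub>F n in sequentially. j n < kk n" "(\<lambda>n. tp n (j n)) \<longlonglongrightarrow> t"
  shows "\<forall>\<^sub>F n in sequentially. F (tp n (j n)) (stop (tp n (j n)) (z n)) - F 0 (stop 0 (z n)) -
    integral {0..tp n (j n)} (hn n) - (\<Sum>i=1..j n. R n i) = gsum x n (j n)"
proof -
  define T where "T = max 0 (t + 1)"
  have "T \<ge> 0" by (simp add: T_def)
  then obtain K where K: "\<forall>\<^sub>F n in sequentially. stop T (z n) \<in> \<Omega> \<and> (\<forall>s\<in>{0..T}. \<bar>hn n s\<bar> \<le> K)"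
    by (rule hn_bounded)
  have "\<forall>\<^sub>F n in sequentially. tp n (j n) < t + 1" by (rule order_tendstoD(2)[OF j(2)]) simp
  with K j(1) show ?thesis
    by eventually_elim (subst telescope[where T = T and K = K], auto simp: T_def)
qed

lemma F_initial: "(\<lambda>n. F 0 (stop 0 (z n))) \<longlonglongrightarrow> F 0 (stop 0 x)"
  by (rule right_contD(2)[OF F_right x_in]) auto

text \<open>The remainder sums converge at index \<open>lo n t\<close>, and any sequence of times
  tending to \<open>t\<close> and not before \<open>t'\<^sub>n\<close> carries asymptotically the
  same squared increments. The continuity of \<open>M\<close> rests on this freedom in
  \<open>j\<close>.\<close>

lemma gsum_tendsto:
  assumes t: "t \<ge> 0" and j: "\<forall>\<^sub>F n in sequentially. j n < kk n" "(\<lambda>n. tp n (j n)) \<longlonglongrightarrow> t"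
    and ge: "\<forall>\<^sub>F n in sequentially. last_before \<pi> n t \<le> tp n (j n)"
  shows "(\<lambda>n. gsum x n (j n)) \<longlonglongrightarrow> m t"
proof -
  have lo: "\<forall>\<^sub>F n in sequentially. lo n t < kk n \<and> tp n (lo n t) \<le> t \<and> t < tp n (Suc (lo n t))"
    using eventually_lo_const[OF t] .
  have lo_t: "(\<lambda>n. tp n (lo n t)) \<longlonglongrightarrow> t" using lo_tendsto[of "\<lambda>_. t" t] t by simp
  have nonneg: "\<forall>\<^sub>F n in sequentially. 0 \<le> tp n (i n)" if "\<forall>\<^sub>F n in sequentially. i n < kk n" for i
    using that by eventually_elim (auto intro: tp_nonneg)
  have q1: "(\<lambda>n. quad_sum \<pi> x n (tp n (j n))) \<longlonglongrightarrow> V t"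
    by (rule quad_sum_limit_ge[OF t j(2) nonneg[OF j(1)] ge])
  have q2: "(\<lambda>n. quad_sum \<pi> x n (tp n (lo n t))) \<longlonglongrightarrow> V t"
    using quad_sum_tendsto[OF t]
  proof (rule Lim_transform_eventually)
    show "\<forall>\<^sub>F n in sequentially. quad_sum \<pi> x n t = quad_sum \<pi> x n (tp n (lo n t))"
      using lo by eventually_elim (use quad_sum_lo quad_sum_tp in auto)
  qed
  have "(\<lambda>n. (\<Sum>i=1..j n. R n i) - (\<Sum>i=1..lo n t. R n i)) \<longlonglongrightarrow> 0"
  proof (rule R_sum_diff[where T = "t + 1"])
    have "\<forall>\<^sub>F n in sequentially. tp n (j n) < t + 1" by (rule order_tendstoD(2)[OF j(2)]) simp
    with j(1) show "\<forall>\<^sub>F n in sequentially. j n < kk n \<and> tp n (j n) \<le> t + 1" by eventually_elim auto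
    show "\<forall>\<^sub>F n in sequentially. lo n t < kk n \<and> tp n (lo n t) \<le> t + 1" using lo by eventually_elim auto
    show "(\<lambda>n. quad_sum \<pi> x n (tp n (j n)) - quad_sum \<pi> x n (tp n (lo n t))) \<longlonglongrightarrow> 0"
      using tendsto_diff[OF q1 q2] by simp
  qed
  from tendsto_add[OF this R_sum_lo[OF t]] have Rj: "(\<lambda>n. \<Sum>i=1..j n. R n i) \<longlonglongrightarrow> r t" by simp
  have "(\<lambda>n. F (tp n (j n)) (stop (tp n (j n)) (z n))) \<longlonglongrightarrow> F t (stop t x)"
    by (rule right_contD(2)[OF F_right x_in t j(2) ge])
  from tendsto_diff[OF tendsto_diff[OF tendsto_diff[OF this F_initial] integral_hn_tendsto[OF t j]] Rj]
  show ?thesis unfolding m_def by (rule Lim_transform_eventually[OF _ eventually_telescope[OF j]])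
qed

text \<open>Sums up to index \<open>lb n t\<close> have the full limit, and dropping their last term
  removes the gradient times the jump. Any other sequence strictly before \<open>t'\<^sub>n\<close>
  is compared with \<open>lb n t - 1\<close>: along both, \<open>F\<close> and
  \<open>quad_sum\<close> tend to the same left limits.\<close>

lemma gsum_tendsto_left:
  assumes t: "t > 0" and j: "\<forall>\<^sub>F n in sequentially. j n < kk n" "(\<lambda>n. tp n (j n)) \<longlonglongrightarrow> t"
    and less: "\<forall>\<^sub>F n in sequentially. tp n (j n) < last_before \<pi> n t"
  shows "(\<lambda>n. gsum x n (j n)) \<longlonglongrightarrow> m t - vert_grad F t (stop_left t x) \<bullet> jump x t"
proof -
  note lb = lb_pred[OF t]
  have lb_t: "(\<lambda>n. tp n (lb n t)) \<longlonglongrightarrow> t" using lb_tendsto[of "\<lambda>_. t" t] t by simp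
  have k: "\<forall>\<^sub>F n in sequentially. lb n t - 1 < kk n" using lb(1) by eventually_elim auto
  have k_less: "\<forall>\<^sub>F n in sequentially. tp n (lb n t - 1) < last_before \<pi> n t"
    using lb(1) unfolding last_before_eq by eventually_elim (auto intro: tp_less)
  have nonneg: "\<forall>\<^sub>F n in sequentially. 0 \<le> tp n (i n)" if "\<forall>\<^sub>F n in sequentially. i n < kk n" for i
    using that by eventually_elim (auto intro: tp_nonneg)
  have "(\<lambda>n. gsum x n (lb n t)) \<longlonglongrightarrow> m t"
    using lb(1) t lb_t by (intro gsum_tendsto) (auto simp: last_before_eq elim: eventually_mono)
  from tendsto_diff[OF this gterm_lb[OF t]]
  have "(\<lambda>n. gsum x n (lb n t - 1)) \<longlonglongrightarrow> m t - vert_grad F t (stop_left t x) \<bullet> jump x t"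
  proof (rule Lim_transform_eventually)
    show "\<forall>\<^sub>F n in sequentially. gsum x n (lb n t) - gterm x n (lb n t) = gsum x n (lb n t - 1)"
      using lb(1)
    proof eventually_elim
      case (elim n)
      then obtain i where "lb n t = Suc i" by (metis Suc_pred)
      then show ?case by (simp add: gsum_def)
    qed
  qed
  moreover have "(\<lambda>n. gsum x n (j n) - gsum x n (lb n t - 1)) \<longlonglongrightarrow> 0"
  proof -
    have q: "(\<lambda>n. quad_sum \<pi> x n (tp n (j n)) - quad_sum \<pi> x n (tp n (lb n t - 1))) \<longlonglongrightarrow> 0"
      using tendsto_diff[OF quad_sum_limits(2)[OF t j(2) nonneg[OF j(1)] less]
        quad_sum_limits(2)[OF t lb(2) nonneg[OF k] k_less]] by simp
    have "(\<lambda>n. (\<Sum>i=1..j n. R n i) - (\<Sum>i=1..lb n t - 1. R n i)) \<longlonglongrightarrow> 0"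
    proof (rule R_sum_diff[where T = "t + 1", OF _ _ q])
      have "\<forall>\<^sub>F n in sequentially. tp n (j n) < t + 1" by (rule order_tendstoD(2)[OF j(2)]) simp
      with j(1) show "\<forall>\<^sub>F n in sequentially. j n < kk n \<and> tp n (j n) \<le> t + 1" by eventually_elim auto
      have "\<forall>\<^sub>F n in sequentially. tp n (lb n t - 1) < t + 1" by (rule order_tendstoD(2)[OF lb(2)]) simp
      with k show "\<forall>\<^sub>F n in sequentially. lb n t - 1 < kk n \<and> tp n (lb n t - 1) \<le> t + 1" by eventually_elim auto
    qed
    note Rd = this
    have F: "(\<lambda>n. F (tp n (i n)) (stop (tp n (i n)) (z n))) \<longlonglongrightarrow> F t (stop_left t x)"
      if "(\<lambda>n. tp n (i n)) \<longlonglongrightarrow> t" "\<forall>\<^sub>F n in sequentially. i n < kk n" "\<forall>\<^sub>F n in sequentially. tp n (i n) < last_before \<pi> n t" for i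
      using t nonneg[OF that(2)] that(3) by (intro left_contD(3)[OF F_left x_in _ that(1)]) (auto elim: eventually_elim2)
    note E = tendsto_diff[OF F integral_hn_tendsto[OF less_imp_le[OF t]]]
    have "(\<lambda>n. ((F (tp n (j n)) (stop (tp n (j n)) (z n)) - integral {0..tp n (j n)} (hn n)) -
        (F (tp n (lb n t - 1)) (stop (tp n (lb n t - 1)) (z n)) - integral {0..tp n (lb n t - 1)} (hn n))) -
        ((\<Sum>i=1..j n. R n i) - (\<Sum>i=1..lb n t - 1. R n i))) \<longlonglongrightarrow> 0"
      using tendsto_diff[OF tendsto_diff[OF E[OF j(2,1) less j] E[OF lb(2) k k_less k lb(2)]] Rd] by simp
    then show ?thesis
    proof (rule Lim_transform_eventually)
      show "\<forall>\<^sub>F n in sequentially. ((F (tp n (j n)) (stop (tp n (j n)) (z n)) - integral {0..tp n (j n)} (hn n)) -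
        (F (tp n (lb n t - 1)) (stop (tp n (lb n t - 1)) (z n)) - integral {0..tp n (lb n t - 1)} (hn n))) -
        ((\<Sum>i=1..j n. R n i) - (\<Sum>i=1..lb n t - 1. R n i)) = gsum x n (j n) - gsum x n (lb n t - 1)"
        using eventually_telescope[OF j] eventually_telescope[OF k lb(2)] by eventually_elim linarith
    qed
  qed
  ultimately have "(\<lambda>n. gsum x n (lb n t - 1) + (gsum x n (j n) - gsum x n (lb n t - 1))) \<longlonglongrightarrow>
      m t - vert_grad F t (stop_left t x) \<bullet> jump x t + 0" by (rule tendsto_add)
  then show ?thesis by simp
qed

end

section \<open>The integral as a class M functional\<close>

context partitions
begin

text \<open>The conditions along the paths \<open>x\<^sup>n\<close> imply those along \<open>x\<close> itself, by diagonal sequences.\<close>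

lemma continuous_funI:
  fixes G :: "real \<Rightarrow> 'm::finite path \<Rightarrow> 'b::metric_space"
  assumes lc: "\<And>x t u. x \<in> \<Omega> \<Longrightarrow> 0 \<le> t \<Longrightarrow> u \<longlonglongrightarrow> t \<Longrightarrow>
       \<forall>\<^sub>F n in sequentially. 0 \<le> u n \<and> u n \<le> last_before \<pi> n t \<Longrightarrow>
       (\<lambda>n. G (u n) (stop_left (u n) (pw_const \<pi> n x))) \<longlonglongrightarrow> G t (stop_left t x)"
    and ld: "\<And>x t u. x \<in> \<Omega> \<Longrightarrow> 0 < t \<Longrightarrow> u \<longlonglongrightarrow> t \<Longrightarrow>
       \<forall>\<^sub>F n in sequentially. 0 \<le> u n \<and> u n < last_before \<pi> n t \<Longrightarrow>
       (\<lambda>n. G (u n) (stop (u n) (pw_const \<pi> n x))) \<longlonglongrightarrow> G t (stop_left t x)"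
    and rc: "\<And>x t u. x \<in> \<Omega> \<Longrightarrow> 0 \<le> t \<Longrightarrow> u \<longlonglongrightarrow> t \<Longrightarrow>
       \<forall>\<^sub>F n in sequentially. last_before \<pi> n t \<le> u n \<Longrightarrow>
       (\<lambda>n. G (u n) (stop (u n) (pw_const \<pi> n x))) \<longlonglongrightarrow> G t (stop t x)"
    and rd: "\<And>x t u. x \<in> \<Omega> \<Longrightarrow> 0 \<le> t \<Longrightarrow> u \<longlonglongrightarrow> t \<Longrightarrow>
       \<forall>\<^sub>F n in sequentially. last_before \<pi> n t < u n \<Longrightarrow>
       (\<lambda>n. G (u n) (stop_left (u n) (pw_const \<pi> n x))) \<longlonglongrightarrow> G t (stop t x)"
  shows "continuous_fun \<pi> \<Omega> G"
proof -
  have path_stop: "(\<lambda>n. G s (stop s (pw_const \<pi> n x))) \<longlonglongrightarrow> G s (stop s x)"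
    if "x \<in> \<Omega>" "0 \<le> s" for x s
    using that last_before_le by (intro rc) auto
  \<comment> \<open>The value at \<open>x\<^sub>s\<^sub>-\<close> is a limit of values along
    \<open>x\<^sup>n\<close> at the last partition times before \<open>s\<close>, so bounds along
    \<open>x\<^sup>n\<close> that are uniform near \<open>t\<close> pass to
    \<open>x\<close>.\<close>
  have path_left: "(\<lambda>n. G (last_before \<pi> n s) (stop_left (last_before \<pi> n s) (pw_const \<pi> n x))) \<longlonglongrightarrow> G s (stop_left s x)"
    if "x \<in> \<Omega>" "0 \<le> s" for x s
    using that last_before_tendsto last_before_nonneg by (intro lc) auto
  have near_left: "\<forall>\<^sub>F n in sequentially. t - \<eta> < last_before \<pi> n s \<and> last_before \<pi> n s < t \<and>
      last_before \<pi> n s \<le> last_before \<pi> n t \<and> s < last_before \<pi> n t"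
    if s: "0 \<le> s" "t - \<eta> < s" "s < t" for s t \<eta>
  proof -
    have "\<forall>\<^sub>F n in sequentially. t - \<eta> < last_before \<pi> n s"
      using s last_before_tendsto by (intro order_tendstoD(1)[OF last_before_tendsto]) auto
    moreover have "\<forall>\<^sub>F n in sequentially. s < last_before \<pi> n t"
      using s by (intro order_tendstoD(1)[OF last_before_tendsto]) auto
    ultimately show ?thesis
    proof eventually_elim
      case (elim n)
      then show ?case using last_before_le[of s n] s by auto
    qed
  qed
  have near_right: "\<forall>\<^sub>F n in sequentially. t < last_before \<pi> n s \<and> last_before \<pi> n s < t + \<eta>"
    if s: "0 \<le> t" "t < s" "s < t + \<eta>" for s t \<eta>
    using s by (auto intro!: eventually_conj order_tendstoD[OF last_before_tendsto])
  \<comment> \<open>Strict bounds become weak in the limit, hence the intermediate tolerance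
    \<open>e2\<close>.\<close>
  have limit_close: "dist l L < e"
    if "f \<longlonglongrightarrow> l" "\<forall>\<^sub>F n in sequentially. dist (f n) L < e2" "0 < e2" "e2 < e" for f :: "nat \<Rightarrow> 'b" and l L e e2
  proof -
    have "dist l L \<le> e2"
      by (rule tendsto_upperbound[OF tendsto_dist[OF that(1) tendsto_const]])
        (use that(2) in \<open>auto elim: eventually_mono\<close>)
    then show ?thesis using that(4) by simp
  qed
  have "((\<lambda>s. G s (stop_left s x)) \<longlongrightarrow> G t (stop_left t x)) (at t within {0..t})" if x: "x \<in> \<Omega>" "0 \<le> t" for x t
  proof (rule tendstoI)
    fix e :: real assume e: "e > 0"
    obtain e2 where e2: "0 < e2" "e2 < e" using dense[OF e] by blast
    obtain \<eta> N where \<eta>: "\<eta> > 0" "\<And>n u. n \<ge> N \<Longrightarrow> \<bar>u - t\<bar> < \<eta> \<Longrightarrow> 0 \<le> u \<and> u \<le> last_before \<pi> n t \<Longrightarrow>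
        dist (G u (stop_left u (pw_const \<pi> n x))) (G t (stop_left t x)) < e2"
      by (rule sequence_condition_uniformE[where P = "\<lambda>n u. 0 \<le> u \<and> u \<le> last_before \<pi> n t" and
          f = "\<lambda>n u. G u (stop_left u (pw_const \<pi> n x))" and l = "G t (stop_left t x)", OF e2(1) last_before_tendsto[OF x(2)] _ lc[OF x]]) (simp add: last_before_nonneg, assumption+, rule that)
    have "dist (G s (stop_left s x)) (G t (stop_left t x)) < e" if s: "s \<in> {0..t}" "s \<noteq> t" "dist s t < \<eta>" for s
    proof (rule limit_close[OF path_left[OF x(1)] _ e2])
      have "0 \<le> s" "t - \<eta> < s" "s < t" using s by (auto simp: dist_real_def)
      from near_left[OF this] eventually_ge_at_top[of N]
      show "\<forall>\<^sub>F n in sequentially. dist (G (last_before \<pi> n s) (stop_left (last_before \<pi> n s) (pw_const \<pi> n x))) (G t (stop_left t x)) < e2"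
        by eventually_elim (rule \<eta>(2), use last_before_nonneg in auto)
    qed (use s in auto)
    then show "\<forall>\<^sub>F s in at t within {0..t}. dist (G s (stop_left s x)) (G t (stop_left t x)) < e"
      unfolding eventually_at using \<eta>(1) by blast
  qed
  moreover have "((\<lambda>s. G s (stop s x)) \<longlongrightarrow> G t (stop_left t x)) (at t within {0..<t})" if x: "x \<in> \<Omega>" "0 \<le> t" for x t
  proof (cases "t = 0")
    case False
    then have t: "t > 0" using x by simp
    show ?thesis
    proof (rule tendstoI)
      fix e :: real assume e: "e > 0"
    obtain e2 where e2: "0 < e2" "e2 < e" using dense[OF e] by blast
      have base: "\<forall>\<^sub>F n in sequentially. 0 \<le> tp n (lb n t - 1) \<and> tp n (lb n t - 1) < last_before \<pi> n t"
        using lb_pred(1)[OF t] unfolding last_before_eq by eventually_elim (auto intro: tp_less tp_nonneg)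
      obtain \<eta> N where \<eta>: "\<eta> > 0" "\<And>n u. n \<ge> N \<Longrightarrow> \<bar>u - t\<bar> < \<eta> \<Longrightarrow> 0 \<le> u \<and> u < last_before \<pi> n t \<Longrightarrow>
          dist (G u (stop u (pw_const \<pi> n x))) (G t (stop_left t x)) < e2"
        by (rule sequence_condition_uniformE[where P = "\<lambda>n u. 0 \<le> u \<and> u < last_before \<pi> n t" and
            f = "\<lambda>n u. G u (stop u (pw_const \<pi> n x))" and l = "G t (stop_left t x)", OF e2(1) lb_pred(2)[OF t] base ld[OF x(1) t]]) (assumption+, rule that)
      have "dist (G s (stop s x)) (G t (stop_left t x)) < e" if s: "s \<in> {0..<t}" "dist s t < \<eta>" for s
      proof (rule limit_close[OF path_stop[OF x(1)] _ e2])
        have s': "0 \<le> s" "t - \<eta> < s" "s < t" using s by (auto simp: dist_real_def)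
        from near_left[OF this] eventually_ge_at_top[of N]
        show "\<forall>\<^sub>F n in sequentially. dist (G s (stop s (pw_const \<pi> n x))) (G t (stop_left t x)) < e2"
          by eventually_elim (rule \<eta>(2), use s' in auto)
      qed (use s in auto)
      then show "\<forall>\<^sub>F s in at t within {0..<t}. dist (G s (stop s x)) (G t (stop_left t x)) < e"
        unfolding eventually_at using \<eta>(1) by blast
    qed
  qed simp
  moreover have "((\<lambda>s. G s (stop s x)) \<longlongrightarrow> G t (stop t x)) (at t within {t..})" if x: "x \<in> \<Omega>" "0 \<le> t" for x t
  proof (rule tendstoI)
    fix e :: real assume e: "e > 0"
    obtain e2 where e2: "0 < e2" "e2 < e" using dense[OF e] by blast
    obtain \<eta> N where \<eta>: "\<eta> > 0" "\<And>n u. n \<ge> N \<Longrightarrow> \<bar>u - t\<bar> < \<eta> \<Longrightarrow> last_before \<pi> n t \<le> u \<Longrightarrow>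
        dist (G u (stop u (pw_const \<pi> n x))) (G t (stop t x)) < e2"
      by (rule sequence_condition_uniformE[where P = "\<lambda>n u. last_before \<pi> n t \<le> u" and
          f = "\<lambda>n u. G u (stop u (pw_const \<pi> n x))" and l = "G t (stop t x)", OF e2(1) tendsto_const[of t] _ rc[OF x]]) (simp add: last_before_le[OF x(2)], assumption+, rule that)
    have "dist (G s (stop s x)) (G t (stop t x)) < e" if s: "s \<in> {t..}" "dist s t < \<eta>" for s
    proof (rule limit_close[OF path_stop[OF x(1)] _ e2])
      have s': "t \<le> s" "\<bar>s - t\<bar> < \<eta>" using s by (auto simp: dist_real_def)
      from eventually_ge_at_top[of N]
      show "\<forall>\<^sub>F n in sequentially. dist (G s (stop s (pw_const \<pi> n x))) (G t (stop t x)) < e2"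
        by eventually_elim (rule \<eta>(2), use s' last_before_le[OF x(2)] in \<open>auto intro: order_trans\<close>)
    qed (use s x in auto)
    then show "\<forall>\<^sub>F s in at t within {t..}. dist (G s (stop s x)) (G t (stop t x)) < e"
      unfolding eventually_at using \<eta>(1) by blast
  qed
  moreover have "((\<lambda>s. G s (stop_left s x)) \<longlongrightarrow> G t (stop t x)) (at t within {t<..})" if x: "x \<in> \<Omega>" "0 \<le> t" for x t
  proof (rule tendstoI)
    fix e :: real assume e: "e > 0"
    obtain e2 where e2: "0 < e2" "e2 < e" using dense[OF e] by blast
    have base: "\<forall>\<^sub>F n in sequentially. last_before \<pi> n t < t + inverse (real (Suc n))"
    proof (intro always_eventually allI)
      fix n :: nat
      have "0 < inverse (real (Suc n))" by simp
      then show "last_before \<pi> n t < t + inverse (real (Suc n))" using last_before_le[OF x(2), of n] by linarith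
    qed
    have v: "(\<lambda>n. t + inverse (real (Suc n))) \<longlonglongrightarrow> t" by (rule LIMSEQ_inverse_real_of_nat_add)
    obtain \<eta> N where \<eta>: "\<eta> > 0" "\<And>n u. n \<ge> N \<Longrightarrow> \<bar>u - t\<bar> < \<eta> \<Longrightarrow> last_before \<pi> n t < u \<Longrightarrow>
        dist (G u (stop_left u (pw_const \<pi> n x))) (G t (stop t x)) < e2"
      by (rule sequence_condition_uniformE[where P = "\<lambda>n u. last_before \<pi> n t < u" and
          f = "\<lambda>n u. G u (stop_left u (pw_const \<pi> n x))" and l = "G t (stop t x)", OF e2(1) v base rd[OF x]]) (assumption+, rule that)
    have "dist (G s (stop_left s x)) (G t (stop t x)) < e" if s: "s \<in> {t<..}" "dist s t < \<eta>" for s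
    proof (rule limit_close[OF path_left[OF x(1)] _ e2])
      have "t < s" "s < t + \<eta>" using s by (auto simp: dist_real_def)
      from near_right[OF x(2) this] eventually_ge_at_top[of N]
      show "\<forall>\<^sub>F n in sequentially. dist (G (last_before \<pi> n s) (stop_left (last_before \<pi> n s) (pw_const \<pi> n x))) (G t (stop t x)) < e2"
        by eventually_elim (rule \<eta>(2), use last_before_le[OF x(2)] in \<open>auto intro: le_less_trans\<close>)
    qed (use s x in auto)
    then show "\<forall>\<^sub>F s in at t within {t<..}. dist (G s (stop_left s x)) (G t (stop t x)) < e"
      unfolding eventually_at using \<eta>(1) by blast
  qed
  moreover have "(\<lambda>n. G (u n) (stop (u n) (pw_const \<pi> n x))) \<longlonglongrightarrow> G t (stop_left t x)"
    if "x \<in> \<Omega>" "0 \<le> t" "u \<longlonglongrightarrow> t" "\<forall>\<^sub>F n in sequentially. 0 \<le> u n \<and> u n < last_before \<pi> n t" for x t u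
  proof (cases "t = 0")
    case True
    \<comment> \<open>At \<open>t = 0\<close> also \<open>t'\<^sub>n = 0\<close>, so no nonnegative
      time lies before it and the condition is vacuous.\<close>
    have "\<forall>\<^sub>F n :: nat in sequentially. False"
      using that(4) by eventually_elim (use True in auto)
    then show ?thesis by simp
  qed (use ld that in auto)
  ultimately show ?thesis
    unfolding continuous_fun_def left_cont_def right_cont_def using lc rc rd by auto
qed

end

section \<open>The functional \<open>Mf\<close> and its derivatives\<close>

context ito_setting
begin

text \<open>The sum up to index \<open>lo n t\<close> reads \<open>y\<close> at the partition point
  after \<open>t\<close>; for paths in \<open>\<Omega>\<close> this look-ahead disappears in the
  limit by right-continuity.\<close>

definition I :: "'m path \<Rightarrow> real \<Rightarrow> real" where
  "I y t = lim (\<lambda>n. gsum y n (lo n t))"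

definition Mf :: "real \<Rightarrow> 'm path \<Rightarrow> real" where
  "Mf t y = F 0 (stop 0 y) + I y t"

lemma ito_pathI:
  assumes "x \<in> \<Omega>"
  obtains V where "ito_path \<pi> \<Omega> \<U> F x V"
proof -
  have "x \<in> Q_paths \<pi>" using Q_paths assms by blast
  then obtain V where "J1_lim (quad_sum \<pi> x) V" unfolding Q_paths_def by blast
  then have "ito_path \<pi> \<Omega> \<U> F x V" using assms by unfold_locales
  then show thesis by (rule that)
qed

lemma I_0: "I y 0 = 0"
proof -
  have "(\<lambda>n. gsum y n (lo n 0)) \<longlonglongrightarrow> 0"
    by (rule tendsto_eventually) (use lo_0 in eventually_elim, simp add: gsum_def)
  then show ?thesis unfolding I_def by (rule limI)
qed

text \<open>\<open>m\<close> lives in a locale that fixes a path and its quadratic variation.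
  Replacing it by \<open>I\<close> makes the limit available for several paths at once, as stopping
  and bumping require.\<close>

lemma gsum_tendsto_I:
  assumes x: "x \<in> \<Omega>" and t: "t \<ge> 0"
    and j: "\<forall>\<^sub>F n in sequentially. j n < kk n" "(\<lambda>n. tp n (j n)) \<longlonglongrightarrow> t"
      "\<forall>\<^sub>F n in sequentially. last_before \<pi> n t \<le> tp n (j n)"
  shows "(\<lambda>n. gsum x n (j n)) \<longlonglongrightarrow> I x t"
proof -
  obtain V where "ito_path \<pi> \<Omega> \<U> F x V" using x by (rule ito_pathI)
  then interpret ito_path \<pi> \<Omega> \<U> F x V .
  have "(\<lambda>n. gsum x n (lo n t)) \<longlonglongrightarrow> m t"
    using t eventually_lo_const[OF t] lo_tendsto[of "\<lambda>_. t" t] last_before_le_lo[OF t]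
    by (intro gsum_tendsto) (auto elim: eventually_mono)
  then have "m t = I x t" unfolding I_def by (rule limI[symmetric])
  then show ?thesis using gsum_tendsto[OF t j] by simp
qed

lemma gsum_tendsto_I_left:
  assumes x: "x \<in> \<Omega>" and t: "t > 0"
    and j: "\<forall>\<^sub>F n in sequentially. j n < kk n" "(\<lambda>n. tp n (j n)) \<longlonglongrightarrow> t"
      "\<forall>\<^sub>F n in sequentially. tp n (j n) < last_before \<pi> n t"
  shows "(\<lambda>n. gsum x n (j n)) \<longlonglongrightarrow> I x t - vert_grad F t (stop_left t x) \<bullet> jump x t"
proof -
  obtain V where "ito_path \<pi> \<Omega> \<U> F x V" using x by (rule ito_pathI)
  then interpret ito_path \<pi> \<Omega> \<U> F x V .
  have "(\<lambda>n. gsum x n (lb n t)) \<longlonglongrightarrow> I x t" "(\<lambda>n. gsum x n (lb n t)) \<longlonglongrightarrow> m t"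
    using t eventually_lb_const[OF t] lb_tendsto[of "\<lambda>_. t" t]
    by (auto intro!: gsum_tendsto_I gsum_tendsto x simp: last_before_eq elim: eventually_mono)
  then have "m t = I x t" by (metis LIMSEQ_unique)
  then show ?thesis using gsum_tendsto_left[OF t j] by simp
qed

lemma gsum_lb: "x \<in> \<Omega> \<Longrightarrow> t > 0 \<Longrightarrow> (\<lambda>n. gsum x n (lb n t)) \<longlonglongrightarrow> I x t"
  using eventually_lb_const[of t] lb_tendsto[of "\<lambda>_. t" t]
  by (intro gsum_tendsto_I) (auto simp: last_before_eq elim: eventually_mono)

lemma gsum_lo: "x \<in> \<Omega> \<Longrightarrow> t \<ge> 0 \<Longrightarrow> (\<lambda>n. gsum x n (lo n t)) \<longlonglongrightarrow> I x t"
  using eventually_lo_const[of t] lo_tendsto[of "\<lambda>_. t" t] last_before_le_lo[of t]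
  by (intro gsum_tendsto_I) (auto elim: eventually_mono)

lemma grad_tendsto:
  assumes "x \<in> \<Omega>" "t > 0"
  shows "(\<lambda>n. vert_grad F (tp n (lb n t)) (stop_left (tp n (lb n t)) (pw_const \<pi> n x))) \<longlonglongrightarrow>
    vert_grad F t (stop_left t x)"
proof -
  have "0 \<le> tp n (lb n t)" for n by (intro tp_nonneg lb_le)
  moreover from this have "(\<lambda>n. pre (vert_grad F) (tp n (lb n t)) (stop_left (tp n (lb n t)) (pw_const \<pi> n x))) \<longlonglongrightarrow>
      pre (vert_grad F) t (stop_left t x)"
    using assms lb_tendsto[of "\<lambda>_. t" t]
    by (intro left_contD(2)[OF grad_left]) (auto simp: last_before_eq)
  ultimately show ?thesis using assms by (simp add: pre_def)
qed

text \<open>The gradient at a partition point reads \<open>x\<^sup>n\<close> strictly before that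
  point, hence \<open>x\<close> up to and including it. Paths that agree before \<open>t\<close>
  therefore share all gradients up to index \<open>lb n t\<close> and all earlier increments; only
  the right endpoint of the last increment can differ.\<close>

lemma gsum_change_last:
  assumes lb: "0 < lb n t" "lb n t < kk n" "tp n (lb n t) < t"
    and eq: "\<And>s. 0 \<le> s \<Longrightarrow> s < t \<Longrightarrow> y s = x s"
  shows "gsum y n (lb n t) = gsum x n (lb n t) +
    vert_grad F (tp n (lb n t)) (stop_left (tp n (lb n t)) (pw_const \<pi> n x)) \<bullet> (y (tp n (Suc (lb n t))) - x (tp n (Suc (lb n t))))"
proof -
  obtain k where k: "lb n t = Suc k" using lb by (metis Suc_pred)
  have sl: "stop_left (tp n i) (pw_const \<pi> n y) = stop_left (tp n i) (pw_const \<pi> n x)"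
    if "0 < i" "i \<le> lb n t" for i
  proof (rule stop_left_pw_const_cong[OF that(1)])
    have "tp n i \<le> tp n (lb n t)" using lb that by (intro tp_le) auto
    then show "y s = x s" if "0 \<le> s" "s \<le> tp n i" for s using eq that lb by simp
  qed (use lb that in auto)
  have "gsum y n k = gsum x n k"
    unfolding gsum_def
  proof (intro sum.cong refl)
    fix i assume i: "i \<in> {1..k}"
    then have "tp n (Suc i) \<le> tp n (lb n t)" "tp n i \<le> tp n (lb n t)" using lb k by (auto intro!: tp_le)
    then have "y (tp n (Suc i)) = x (tp n (Suc i))" "y (tp n i) = x (tp n i)"
      using lb i k by (auto intro!: eq tp_nonneg)
    then show "gterm y n i = gterm x n i" using sl[of i] i k by (simp add: gterm_def dx_def)
  qed
  moreover have "y (tp n (lb n t)) = x (tp n (lb n t))" using lb by (intro eq tp_nonneg) auto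
  ultimately show ?thesis using sl[of "lb n t"] lb
    by (simp add: gsum_def k gterm_def dx_def inner_diff_right)
qed

text \<open>\<open>lo n t\<close> exceeds \<open>lb n t\<close> by one when \<open>t\<close> is a
  partition point and equals it otherwise; the possible extra increment starts at \<open>t\<close>
  and vanishes for a path constant from \<open>t\<close> on.\<close>

lemma gsum_const_tail:
  assumes "lb n t < kk n" "tp n (lb n t) < t" "t \<le> tp n (Suc (lb n t))"
    and "lo n t < kk n" "tp n (lo n t) \<le> t" "t < tp n (Suc (lo n t))"
    and "\<And>s. t \<le> s \<Longrightarrow> y s = y t"
  shows "gsum y n (lo n t) = gsum y n (lb n t)"
proof -
  have "tp n (lb n t) < tp n (Suc (lo n t))" using assms(2,6) by simp
  then have le: "lb n t \<le> lo n t" using tp_less_iff[of "lb n t" n "Suc (lo n t)"] assms(1,4) by simp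
  have "gterm y n i = 0" if i: "i \<in> {1..lo n t} - {1..lb n t}" for i
  proof -
    have "tp n (Suc (lb n t)) \<le> tp n i" "tp n i \<le> tp n (Suc i)" using i assms(1,4) by (auto intro!: tp_le)
    then have "t \<le> tp n i" "t \<le> tp n (Suc i)" using assms(3) by linarith+
    then have "y (tp n i) = y t" "y (tp n (Suc i)) = y t" by (blast intro: assms(7))+
    then show ?thesis by (simp add: gterm_def dx_def)
  qed
  then show ?thesis unfolding gsum_def using le by (intro sum.mono_neutral_right) auto
qed

lemma stop_const: "stop t y = y \<Longrightarrow> t \<le> s \<Longrightarrow> y s = y t"
  by (drule fun_cong[of _ _ s]) (simp add: stop_def)

text \<open>Stopping replaces only the endpoint value \<open>x (tp n (Suc (lb n t)))\<close> by
  \<open>x t\<close>; the two merge by right-continuity while the gradients converge.\<close>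

lemma I_stop:
  assumes x: "x \<in> \<Omega>" and t: "t \<ge> 0"
  shows "I (stop t x) t = I x t"
proof (cases "t = 0")
  case True
  then show ?thesis by (simp add: I_0)
next
  case False
  then have t: "t > 0" using t by simp
  have "(\<lambda>n. x (tp n (Suc (lb n t)))) \<longlonglongrightarrow> x t"
  proof (rule tendsto_at_right_sequence)
    show "(x \<longlongrightarrow> x t) (at_right t)" using cadlag[OF x] t by (simp add: cadlag_def)
    show "(\<lambda>n. tp n (Suc (lb n t))) \<longlonglongrightarrow> t"
      using eventually_lb_const[OF t] lb_tendsto[of "\<lambda>_. t" t] t by (intro mesh_Suc) (auto elim: eventually_mono)
    show "\<forall>\<^sub>F n in sequentially. t \<le> tp n (Suc (lb n t))"
      using eventually_lb_const[OF t] by (auto elim: eventually_mono)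
  qed
  from tendsto_inner[OF grad_tendsto[OF x t] tendsto_diff[OF tendsto_const[of "x t"] this]]
  have "(\<lambda>n. gsum x n (lb n t) + vert_grad F (tp n (lb n t)) (stop_left (tp n (lb n t)) (pw_const \<pi> n x)) \<bullet>
      (x t - x (tp n (Suc (lb n t))))) \<longlonglongrightarrow> I x t"
    using tendsto_add[OF gsum_lb[OF x t]] by fastforce
  then have "(\<lambda>n. gsum (stop t x) n (lb n t)) \<longlonglongrightarrow> I x t"
  proof (rule Lim_transform_eventually)
    show "\<forall>\<^sub>F n in sequentially. gsum x n (lb n t) + vert_grad F (tp n (lb n t)) (stop_left (tp n (lb n t)) (pw_const \<pi> n x)) \<bullet>
      (x t - x (tp n (Suc (lb n t)))) = gsum (stop t x) n (lb n t)"
      using eventually_lb_const[OF t] lb_pred(1)[OF t]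
    proof eventually_elim
      case (elim n)
      then have "stop t x (tp n (Suc (lb n t))) = x t" by (simp add: stop_def min.absorb2)
      then show ?case using gsum_change_last[of n t "stop t x" x] elim by (simp add: stop_def)
    qed
  qed
  moreover have "(\<lambda>n. gsum (stop t x) n (lb n t)) \<longlonglongrightarrow> I (stop t x) t"
    by (rule gsum_lb[OF stop_in[OF x] t]) (use t in simp)
  ultimately show ?thesis using LIMSEQ_unique by blast
qed

text \<open>Increments after \<open>t\<close> vanish for a path stopped at \<open>t\<close>. This is
  why the horizontal derivative of \<open>Mf\<close> is 0.\<close>

lemma I_later:
  assumes y: "y \<in> \<Omega>" "stop t y = y" and t: "0 \<le> t" "t \<le> u"
  shows "I y u = I y t"
proof -
  have "\<forall>\<^sub>F n in sequentially. gsum y n (lo n u) = gsum y n (lo n t)"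
    using eventually_lo_const[OF t(1)] eventually_lo_const[of u, OF order_trans[OF t]]
  proof eventually_elim
    case (elim n)
    have "tp n (lo n t) < tp n (Suc (lo n u))" using elim t by linarith
    then have le: "lo n t \<le> lo n u" using tp_less_iff[of "lo n t" n "Suc (lo n u)"] elim by simp
    have "gterm y n i = 0" if i: "i \<in> {1..lo n u} - {1..lo n t}" for i
    proof -
      have "tp n (Suc (lo n t)) \<le> tp n i" "tp n i \<le> tp n (Suc i)" using i elim by (auto intro!: tp_le)
      then have "t \<le> tp n i" "t \<le> tp n (Suc i)" using elim by linarith+
      then have "y (tp n i) = y t" "y (tp n (Suc i)) = y t" by (blast intro: stop_const[OF y(2)])+
      then show ?thesis by (simp add: gterm_def dx_def)
    qed
    then show ?case unfolding gsum_def using le by (intro sum.mono_neutral_right) auto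
  qed
  then have "(\<lambda>n. gsum y n (lo n t)) \<longlonglongrightarrow> I y u"
    using gsum_lo[OF y(1), of u] t by (auto intro: Lim_transform_eventually)
  then show ?thesis using gsum_lo[OF y(1) t(1)] LIMSEQ_unique by blast
qed

text \<open>The dependence on \<open>e\<close> is affine already at the level of the sums, because
  the bump enters exactly one increment. The limit for the bumped path is computed from that for
  \<open>y\<close>.\<close>

lemma I_bump:
  assumes y: "y \<in> \<Omega>" "stop t y = y" and t: "t > 0"
  shows "I (bump t e y) t = I y t + vert_grad F t (stop_left t y) \<bullet> e"
proof -
  have tail: "bump t e y s = bump t e y t" if "t \<le> s" for s
    using stop_const[OF y(2) that] that by (simp add: bump_def)
  have "(\<lambda>n. gsum y n (lb n t) + vert_grad F (tp n (lb n t)) (stop_left (tp n (lb n t)) (pw_const \<pi> n y)) \<bullet> e)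
      \<longlonglongrightarrow> I y t + vert_grad F t (stop_left t y) \<bullet> e"
    by (intro tendsto_intros gsum_lb grad_tendsto y t)
  then have "(\<lambda>n. gsum (bump t e y) n (lo n t)) \<longlonglongrightarrow> I y t + vert_grad F t (stop_left t y) \<bullet> e"
  proof (rule Lim_transform_eventually)
    show "\<forall>\<^sub>F n in sequentially. gsum y n (lb n t) + vert_grad F (tp n (lb n t)) (stop_left (tp n (lb n t)) (pw_const \<pi> n y)) \<bullet> e =
        gsum (bump t e y) n (lo n t)"
      using eventually_lb_const[OF t] lb_pred(1)[OF t] eventually_lo_const[OF less_imp_le[OF t]]
    proof eventually_elim
      case (elim n)
      have "gsum (bump t e y) n (lo n t) = gsum (bump t e y) n (lb n t)"
        using elim by (intro gsum_const_tail tail) auto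
      also have "\<dots> = gsum y n (lb n t) + vert_grad F (tp n (lb n t)) (stop_left (tp n (lb n t)) (pw_const \<pi> n y)) \<bullet> e"
        using gsum_change_last[of n t "bump t e y" y] elim by (simp add: bump_def)
      finally show ?case by simp
    qed
  qed
  then show ?thesis unfolding I_def by (rule limI)
qed

lemma stop_0_bump: "t > 0 \<Longrightarrow> stop 0 (bump t e y) = stop 0 y"
  by (auto simp: stop_def bump_def fun_eq_iff)

lemma Mf_stop: "x \<in> \<Omega> \<Longrightarrow> t \<ge> 0 \<Longrightarrow> Mf t (stop t x) = F 0 (stop 0 x) + I x t"
  by (simp add: Mf_def I_stop)

lemma Mf_bump:
  assumes "y \<in> \<Omega>" "stop t y = y" "t > 0"
  shows "Mf t (bump t e y) = Mf t y + vert_grad F t (stop_left t y) \<bullet> e"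
  using assms by (simp add: Mf_def I_bump stop_0_bump)

text \<open>At time 0 a bump changes the initial value rather than an increment, so the vertical
  gradient there comes from \<open>F\<close> itself.\<close>

lemma Mf_bump_0:
  assumes "stop 0 y = y"
  shows "Mf 0 (bump 0 e y) = F 0 (bump 0 e y)"
  using assms by (simp add: Mf_def I_0 stop_bump)

lemma Mf_stop_left:
  assumes "x \<in> \<Omega>" "t > 0"
  shows "Mf t (stop_left t x) = F 0 (stop 0 x) + (I x t - vert_grad F t (stop_left t x) \<bullet> jump x t)"
proof -
  have "Mf t (bump t (- jump x t) (stop t x)) = Mf t (stop t x) + vert_grad F t (stop_left t (stop t x)) \<bullet> (- jump x t)"
    using assms by (intro Mf_bump stop_in) auto
  then show ?thesis using assms
    by (simp add: stop_left_eq_bump[symmetric] stop_left_stop Mf_stop)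
qed

text \<open>On \<open>x\<^sup>n\<close> the functional is again a limit over all partitions. It is
  evaluated jump by jump: constant between jumps by \<open>I_later\<close>, and at each jump changed
  by the exact bump formula, whose gradient is the one in \<open>gterm\<close>.\<close>

lemma Mf_pw_const:
  assumes T: "stop T (pw_const \<pi> n x) \<in> \<Omega>"
  shows "j < kk n \<Longrightarrow> tp n j \<le> u \<Longrightarrow> tp n j \<le> T \<Longrightarrow> Mf u (stop (tp n j) (pw_const \<pi> n x)) = F 0 (stop 0 (pw_const \<pi> n x)) + gsum x n j"
proof (induction j arbitrary: u)
  case 0
  have "stop 0 (pw_const \<pi> n x) \<in> \<Omega>" using stop_in[OF T, of 0] 0 by (simp add: min_def)
  then have "I (stop 0 (pw_const \<pi> n x)) u = I (stop 0 (pw_const \<pi> n x)) 0" using 0 by (intro I_later) auto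
  then show ?case using 0 by (simp add: Mf_def I_0 gsum_def)
next
  case (Suc j)
  let ?z = "pw_const \<pi> n x" and ?s = "tp n (Suc j)"
  have less: "0 \<le> tp n j" "tp n j < ?s" using Suc.prems by (auto intro: tp_nonneg tp_less)
  have in1: "stop (tp n j) ?z \<in> \<Omega>" using stop_in[OF T, of "tp n j"] less Suc.prems by (simp add: min_def)
  have in2: "stop ?s ?z \<in> \<Omega>" using stop_in[OF T, of ?s] less Suc.prems by (simp add: min_def)
  have "Mf u (stop ?s ?z) = Mf ?s (stop ?s ?z)"
    unfolding Mf_def using I_later[OF in2, of ?s u] less Suc.prems by simp
  also have "\<dots> = Mf ?s (bump ?s (dx x n (Suc j)) (stop (tp n j) ?z))"
    using stop_Suc_pw_const[of j n x] Suc.prems by simp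
  also have "\<dots> = Mf ?s (stop (tp n j) ?z) + vert_grad F ?s (stop_left ?s (stop (tp n j) ?z)) \<bullet> dx x n (Suc j)"
    using in1 less by (intro Mf_bump) (auto simp: min_def)
  also have "Mf ?s (stop (tp n j) ?z) = F 0 (stop 0 ?z) + gsum x n j"
    using Suc.prems less by (intro Suc.IH) auto
  also have "stop_left ?s (stop (tp n j) ?z) = stop_left ?s ?z"
    using stop_left_pw_const[of j n ?s x] stop_left_const[of "tp n j" "stop (tp n j) ?z" ?s] less Suc.prems by simp
  finally show ?case by (simp add: gsum_def gterm_def)
qed

lemma pw_initial: "x \<in> \<Omega> \<Longrightarrow> (\<lambda>n. F 0 (stop 0 (pw_const \<pi> n x))) \<longlonglongrightarrow> F 0 (stop 0 x)"
  by (rule right_contD(2)[OF F_right]) auto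

lemma Mf_pw_tendsto:
  assumes x: "x \<in> \<Omega>" and L: "(\<lambda>n. gsum x n (j n)) \<longlonglongrightarrow> L" and u: "u \<longlonglongrightarrow> t"
    and j: "\<forall>\<^sub>F n in sequentially. j n < kk n \<and> tp n (j n) \<le> u n \<and> w n = stop (tp n (j n)) (pw_const \<pi> n x)"
  shows "(\<lambda>n. Mf (u n) (w n)) \<longlonglongrightarrow> F 0 (stop 0 x) + L"
proof (rule Lim_transform_eventually[OF tendsto_add[OF pw_initial[OF x] L]])
  have "\<forall>\<^sub>F n in sequentially. u n < max (t + 1) 1" using u by (intro order_tendstoD(2)) auto
  moreover have "\<forall>\<^sub>F n in sequentially. stop (max (t + 1) 1) (pw_const \<pi> n x) \<in> \<Omega>"
    using x by (intro eventually_pw_in) auto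
  ultimately show "\<forall>\<^sub>F n in sequentially. F 0 (stop 0 (pw_const \<pi> n x)) + gsum x n (j n) = Mf (u n) (w n)"
    using j
  proof eventually_elim
    case (elim n)
    then have "tp n (j n) \<le> max (t + 1) 1" by linarith
    then show ?case using Mf_pw_const[OF elim(2), of "j n" "u n"] elim by simp
  qed
qed

text \<open>Stopping \<open>x\<^sup>n\<close> at \<open>u n\<close> selects the index
  \<open>lo n (u n)\<close>, stopping just before selects \<open>lb n (u n)\<close>. The comparison
  of \<open>u n\<close> with \<open>t'\<^sub>n\<close> passes to the selected partition point and
  decides which of the two limits of \<open>gsum\<close> applies.\<close>

lemma Mf_continuous: "continuous_fun \<pi> \<Omega> Mf"
proof (rule continuous_funI)
  fix x :: "'m path" and t :: real and u :: "nat \<Rightarrow> real"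
  assume x: "x \<in> \<Omega>" and t: "0 \<le> t" and u: "u \<longlonglongrightarrow> t"
  let ?z = "\<lambda>n. pw_const \<pi> n x"
  { assume ge: "\<forall>\<^sub>F n in sequentially. last_before \<pi> n t \<le> u n"
    have u0: "\<forall>\<^sub>F n in sequentially. 0 \<le> u n"
      using ge by eventually_elim (rule order_trans[OF last_before_nonneg])
    note lo = eventually_lo[OF u u0]
    have L: "(\<lambda>n. gsum x n (lo n (u n))) \<longlonglongrightarrow> I x t"
    proof (rule gsum_tendsto_I[OF x t])
      show "\<forall>\<^sub>F n in sequentially. lo n (u n) < kk n" using lo by (auto elim: eventually_mono)
      show "(\<lambda>n. tp n (lo n (u n))) \<longlonglongrightarrow> t" by (rule lo_tendsto[OF u u0])
      show "\<forall>\<^sub>F n in sequentially. last_before \<pi> n t \<le> tp n (lo n (u n))"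
        using lo ge unfolding last_before_eq
      proof eventually_elim
        case (elim n)
        then have "tp n (lb n t) < tp n (Suc (lo n (u n)))" by linarith
        then show ?case using elim tp_less_iff[of "lb n t" n "Suc (lo n (u n))"] lb_le by (intro tp_le) auto
      qed
    qed
    show "(\<lambda>n. Mf (u n) (stop (u n) (?z n))) \<longlonglongrightarrow> Mf t (stop t x)"
      unfolding Mf_stop[OF x t]
      by (rule Mf_pw_tendsto[OF x L u], rule eventually_mono[OF lo], intro conjI stop_pw_const; simp) }
  { assume gt: "\<forall>\<^sub>F n in sequentially. last_before \<pi> n t < u n"
    have u0: "\<forall>\<^sub>F n in sequentially. 0 < u n"
      using gt by eventually_elim (rule le_less_trans[OF last_before_nonneg])
    note lb = eventually_lb[OF u u0]
    have L: "(\<lambda>n. gsum x n (lb n (u n))) \<longlonglongrightarrow> I x t"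
    proof (rule gsum_tendsto_I[OF x t])
      show "\<forall>\<^sub>F n in sequentially. lb n (u n) < kk n" using lb by (auto elim: eventually_mono)
      show "(\<lambda>n. tp n (lb n (u n))) \<longlonglongrightarrow> t" by (rule lb_tendsto[OF u u0])
      show "\<forall>\<^sub>F n in sequentially. last_before \<pi> n t \<le> tp n (lb n (u n))"
        using lb gt unfolding last_before_eq
      proof eventually_elim
        case (elim n)
        then have "tp n (lb n t) < tp n (Suc (lb n (u n)))" by linarith
        then show ?case using elim tp_less_iff[of "lb n t" n "Suc (lb n (u n))"] lb_le by (intro tp_le) auto
      qed
    qed
    show "(\<lambda>n. Mf (u n) (stop_left (u n) (?z n))) \<longlonglongrightarrow> Mf t (stop t x)"
      unfolding Mf_stop[OF x t]
      by (rule Mf_pw_tendsto[OF x L u], rule eventually_mono[OF lb], intro conjI stop_left_pw_const; simp) }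
  { assume le: "\<forall>\<^sub>F n in sequentially. 0 \<le> u n \<and> u n \<le> last_before \<pi> n t"
    show "(\<lambda>n. Mf (u n) (stop_left (u n) (?z n))) \<longlonglongrightarrow> Mf t (stop_left t x)"
    proof (cases "t = 0")
      \<comment> \<open>At \<open>t = 0\<close> the bounds force \<open>u n = 0\<close>, where
        stopping and stopping just before agree and the integral is 0.\<close>
      case True
      have "(\<lambda>n. Mf 0 (stop 0 (?z n))) \<longlonglongrightarrow> Mf 0 (stop 0 x)"
        using pw_initial[OF x] by (simp add: Mf_def I_0)
      moreover have "\<forall>\<^sub>F n in sequentially. Mf 0 (stop 0 (?z n)) = Mf (u n) (stop_left (u n) (?z n))"
        using le by eventually_elim (use True in \<open>auto simp: stop_left_0\<close>)
      ultimately show ?thesis using True by (auto simp: stop_left_0 intro: Lim_transform_eventually)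
    next
      case False
      then have t: "t > 0" using t by simp
      have u0: "\<forall>\<^sub>F n in sequentially. 0 < u n" by (rule order_tendstoD(1)[OF u t])
      note lb = eventually_lb[OF u u0]
      have L: "(\<lambda>n. gsum x n (lb n (u n))) \<longlonglongrightarrow> I x t - vert_grad F t (stop_left t x) \<bullet> jump x t"
      proof (rule gsum_tendsto_I_left[OF x t])
        show "\<forall>\<^sub>F n in sequentially. lb n (u n) < kk n" using lb by (auto elim: eventually_mono)
        show "(\<lambda>n. tp n (lb n (u n))) \<longlonglongrightarrow> t" by (rule lb_tendsto[OF u u0])
        show "\<forall>\<^sub>F n in sequentially. tp n (lb n (u n)) < last_before \<pi> n t"
          using lb le by eventually_elim linarith
      qed
      show ?thesis
      unfolding Mf_stop_left[OF x t]
      by (rule Mf_pw_tendsto[OF x L u], rule eventually_mono[OF lb], intro conjI stop_left_pw_const; simp)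
    qed }
next
  fix x :: "'m path" and t :: real and u :: "nat \<Rightarrow> real"
  assume x: "x \<in> \<Omega>" and t: "0 < t" and u: "u \<longlonglongrightarrow> t"
    and less: "\<forall>\<^sub>F n in sequentially. 0 \<le> u n \<and> u n < last_before \<pi> n t"
  have u0: "\<forall>\<^sub>F n in sequentially. 0 \<le> u n" using less by (auto elim: eventually_mono)
  note lo = eventually_lo[OF u u0]
  have L: "(\<lambda>n. gsum x n (lo n (u n))) \<longlonglongrightarrow> I x t - vert_grad F t (stop_left t x) \<bullet> jump x t"
  proof (rule gsum_tendsto_I_left[OF x t])
    show "\<forall>\<^sub>F n in sequentially. lo n (u n) < kk n" using lo by (auto elim: eventually_mono)
    show "(\<lambda>n. tp n (lo n (u n))) \<longlonglongrightarrow> t" by (rule lo_tendsto[OF u u0])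
    show "\<forall>\<^sub>F n in sequentially. tp n (lo n (u n)) < last_before \<pi> n t"
      using lo less by eventually_elim linarith
  qed
  show "(\<lambda>n. Mf (u n) (stop (u n) (pw_const \<pi> n x))) \<longlonglongrightarrow> Mf t (stop_left t x)"
      unfolding Mf_stop_left[OF x t]
      by (rule Mf_pw_tendsto[OF x L u], rule eventually_mono[OF lo], intro conjI stop_pw_const; simp)
qed

lemma Mf_hor_quot:
  assumes "(t, y) \<in> Lam \<Omega>"
  shows "(hor_quot Mf t y \<longlongrightarrow> 0) (at_right 0)"
proof (rule tendsto_eventually)
  obtain t: "0 \<le> t" and y: "y \<in> \<Omega>" "stop t y = y" using assms by (rule LamE)
  have "\<forall>\<^sub>F h in at_right 0. 0 < (h::real)" by (simp add: eventually_at_right_less)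
  then show "\<forall>\<^sub>F h in at_right 0. hor_quot Mf t y h = 0"
  proof eventually_elim
    case (elim h)
    then show ?case using I_later[OF y t, of "t + h"] by (simp add: hor_quot_def Mf_def)
  qed
qed

lemma Mf_GDERIV:
  assumes "(t, y) \<in> Lam \<Omega>"
  shows "GDERIV (\<lambda>e. Mf t (bump t e y)) 0 :> pre (vert_grad F) t y"
proof -
  obtain t: "0 \<le> t" and y: "y \<in> \<Omega>" "stop t y = y" using assms by (rule LamE)
  show ?thesis
  proof (cases "t = 0")
    case True
    then have "stop_left t y = y" using y stop_left_0[of y] by simp
    moreover have "(\<lambda>e. F t (bump t e y)) differentiable (at 0)"
      using vert_diff assms unfolding vert_differentiable_def by blast
    ultimately show ?thesis using True y Mf_bump_0[of y] GDERIV_vert_grad by (simp add: pre_def)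
  next
    case False
    then have "(\<lambda>e. Mf t (bump t e y)) = (\<lambda>e. Mf t y + e \<bullet> pre (vert_grad F) t y)"
      using Mf_bump[OF y] t by (auto simp: pre_def inner_commute)
    then show ?thesis unfolding gderiv_def by (auto intro!: derivative_eq_intros)
  qed
qed

lemma Mf_vert_grad: "(t, y) \<in> Lam \<Omega> \<Longrightarrow> vert_grad Mf t y = pre (vert_grad F) t y"
  by (rule vert_grad_eqI[OF Mf_GDERIV])

text \<open>The gradient of \<open>Mf\<close> is known on \<open>Lam \<Omega>\<close> only. This
  suffices because the paths in the sequence conditions are stopped versions of paths that
  eventually belong to \<open>\<Omega>\<close>.\<close>

lemma left_cont_cong:
  fixes G G' :: "real \<Rightarrow> 'm path \<Rightarrow> 'b::topological_space"
  assumes G: "left_cont \<pi> \<Omega> G" and eq: "\<And>t y. (t, y) \<in> Lam \<Omega> \<Longrightarrow> G' t y = G t y"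
  shows "left_cont \<pi> \<Omega> G'"
  unfolding left_cont_def
proof (intro ballI allI impI conjI)
  fix x t assume x: "x \<in> \<Omega>" and t: "0 \<le> (t::real)"
  have lim: "G' t (stop_left t x) = G t (stop_left t x)" using stop_left_Lam[OF x t] by (rule eq)
  have "((\<lambda>s. G s (stop_left s x)) \<longlongrightarrow> G t (stop_left t x)) (at t within {0..t})"
    using G x t unfolding left_cont_def by blast
  then show "((\<lambda>s. G' s (stop_left s x)) \<longlongrightarrow> G' t (stop_left t x)) (at t within {0..t})"
    unfolding lim by (rule Lim_transform_eventually) (auto simp: eventually_at_filter eq stop_left_Lam x)
  have "((\<lambda>s. G s (stop s x)) \<longlongrightarrow> G t (stop_left t x)) (at t within {0..<t})"
    using G x t unfolding left_cont_def by blast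
  then show "((\<lambda>s. G' s (stop s x)) \<longlongrightarrow> G' t (stop_left t x)) (at t within {0..<t})"
    unfolding lim by (rule Lim_transform_eventually) (auto simp: eventually_at_filter eq stop_Lam x)
  have T: "\<forall>\<^sub>F n in sequentially. stop (t + 1) (pw_const \<pi> n x) \<in> \<Omega>"
    using x t by (intro eventually_pw_in) auto
  fix u assume u: "u \<longlonglongrightarrow> t"
  have less: "\<forall>\<^sub>F n in sequentially. u n < t + 1" by (rule order_tendstoD(2)[OF u]) simp
  { assume ev: "\<forall>\<^sub>F n in sequentially. 0 \<le> u n \<and> u n \<le> last_before \<pi> n t"
    have "\<forall>\<^sub>F n in sequentially. G (u n) (stop_left (u n) (pw_const \<pi> n x)) = G' (u n) (stop_left (u n) (pw_const \<pi> n x))"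
      using T less ev
    proof eventually_elim
      case (elim n)
      then show ?case using eq[OF stop_left_Lam[OF elim(1), of "u n"]] by (simp add: stop_left_stop)
    qed
    with left_contD(2)[OF G x t u ev] show "(\<lambda>n. G' (u n) (stop_left (u n) (pw_const \<pi> n x))) \<longlonglongrightarrow> G' t (stop_left t x)"
      unfolding lim by (rule Lim_transform_eventually) }
  { assume ev: "\<forall>\<^sub>F n in sequentially. 0 \<le> u n \<and> u n < last_before \<pi> n t"
    have "\<forall>\<^sub>F n in sequentially. G (u n) (stop (u n) (pw_const \<pi> n x)) = G' (u n) (stop (u n) (pw_const \<pi> n x))"
      using T less ev
    proof eventually_elim
      case (elim n)
      then show ?case using eq[OF stop_Lam[OF elim(1), of "u n"]] by (simp add: min_def)
    qed
    with left_contD(3)[OF G x t u ev] show "(\<lambda>n. G' (u n) (stop (u n) (pw_const \<pi> n x))) \<longlonglongrightarrow> G' t (stop_left t x)"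
      unfolding lim by (rule Lim_transform_eventually) }
qed

lemma Mf_class_M: "class_M \<pi> \<Omega> Mf"
  unfolding class_M_def
proof (intro conjI)
  show "continuous_fun \<pi> \<Omega> Mf" by (rule Mf_continuous)
  show "hor_differentiable \<Omega> Mf" unfolding hor_differentiable_def using Mf_hor_quot by blast
  show "vert_differentiable \<Omega> Mf"
    unfolding vert_differentiable_def using Mf_GDERIV unfolding gderiv_def differentiable_def by blast
  show "\<forall>(t, y)\<in>Lam \<Omega>. hor_deriv Mf t y = 0"
    unfolding hor_deriv_def using Mf_hor_quot by (auto intro!: tendsto_Lim)
  show "left_cont \<pi> \<Omega> (vert_grad Mf)" by (rule left_cont_cong[OF grad_left Mf_vert_grad])
  show "strictly_causal \<Omega> (vert_grad Mf)"
    unfolding strictly_causal_def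
  proof (safe)
    fix t y assume y: "(t, y) \<in> Lam \<Omega>"
    then have "0 \<le> t" "(t, stop_left t y) \<in> Lam \<Omega>" by (auto elim!: LamE intro: stop_left_Lam)
    then show "vert_grad Mf t y = pre (vert_grad Mf) t y"
      using Mf_vert_grad[OF y] Mf_vert_grad[of t "stop_left t y"] by (simp add: pre_def)
  qed
qed

end

section \<open>Paths with absolutely continuous quadratic variation\<close>

context ito_path
begin

lemma m_eq_I:
  assumes "t \<ge> 0"
  shows "m t = I x t"
proof -
  have "(\<lambda>n. gsum x n (lo n t)) \<longlonglongrightarrow> m t"
    using assms eventually_lo_const[OF assms] lo_tendsto[of "\<lambda>_. t" t] last_before_le_lo[OF assms]
    by (intro gsum_tendsto) (auto elim: eventually_mono)
  then show ?thesis using gsum_lo[OF x_in assms] LIMSEQ_unique by blast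
qed

text \<open>From \<open>a\<close> to a nearby later \<open>b\<close>, each remainder is half the
  pairing of \<open>l\<close> with the squared increment, up to \<open>\<epsilon>\<close> times the
  squared norm: increments are small by continuity of \<open>x\<close> at \<open>a\<close>, and
  \<open>Hn\<close> is close to \<open>l\<close> at all times near \<open>a\<close>. Summation turns
  squared increments into \<open>V b - V a\<close>.\<close>

lemma r_local:
  assumes a: "a > 0" "jump x a = 0" and H: "\<And>u. u \<longlonglongrightarrow> a \<Longrightarrow> (\<lambda>n. Hn n (u n)) \<longlonglongrightarrow> l" and "\<epsilon> > 0"
  shows "\<exists>\<eta>>0. \<forall>b. a < b \<longrightarrow> b < a + \<eta> \<longrightarrow>
    \<bar>r b - r a - 1/2 * (l \<bullet> (V b - V a))\<bar> \<le> \<epsilon> * ((V b - V a) \<bullet> mat 1)"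
proof -
  have "a + 1 \<ge> 0" using a by simp
  then obtain \<omega> where \<omega>: "(\<omega> \<longlongrightarrow> 0) (at_right 0)"
    "\<forall>\<^sub>F n in sequentially. \<forall>i. 0 < i \<and> i < kk n \<and> tp n i \<le> a + 1 \<longrightarrow>
       \<bar>R n i - 1/2 * (Hn n (tp n i) \<bullet> outer (dx x n i))\<bar> \<le> \<omega> (norm (dx x n i)) * (norm (dx x n i))\<^sup>2"
    by (rule R_estimate) (rule that)
  obtain \<delta> where \<delta>: "\<delta> > 0" "\<And>s. 0 < s \<Longrightarrow> s < \<delta> \<Longrightarrow> \<omega> s < \<epsilon> / 2"
    using order_tendstoD(2)[OF \<omega>(1), of "\<epsilon> / 2"] \<open>\<epsilon> > 0\<close> unfolding eventually_at_right_field by auto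
  have "(x \<longlongrightarrow> x a) (at_left a)" using left_lim_tendsto[OF cadlag_x a(1)] a(2) by (simp add: jump_def)
  then have "isCont x a" using x_right a unfolding isCont_def by (simp add: filterlim_split_at)
  then obtain \<eta>1 where \<eta>1: "\<eta>1 > 0" "\<And>s. \<bar>s - a\<bar> < \<eta>1 \<Longrightarrow> norm (x s - x a) < \<delta> / 2"
    using \<delta>(1) unfolding continuous_at_eps_delta dist_norm by (metis half_gt_zero real_norm_def)
  have "\<epsilon> > 0" by fact
  then obtain \<eta>2 N where \<eta>2: "\<eta>2 > 0" "\<And>n u. n \<ge> N \<Longrightarrow> \<bar>u - a\<bar> < \<eta>2 \<Longrightarrow> True \<Longrightarrow> dist (Hn n u) l < \<epsilon>"
    by (rule sequence_condition_uniformE[where P = "\<lambda>_ _. True" and f = Hn and l = l, OF _ tendsto_const[of a] _ H])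
      (simp, assumption, rule that)
  define \<eta> where "\<eta> = min \<eta>1 (min \<eta>2 1)"
  have "\<bar>r b - r a - 1/2 * (l \<bullet> (V b - V a))\<bar> \<le> \<epsilon> * ((V b - V a) \<bullet> mat 1)" if b: "a < b" "b < a + \<eta>" for b
  proof (rule tendsto_le)
    have b0: "b \<ge> 0" using a b by simp
    have a0: "a \<ge> 0" using a by simp
    let ?q = "\<lambda>n. quad_sum \<pi> x n b - quad_sum \<pi> x n a"
    show "(\<lambda>n. \<epsilon> * (?q n \<bullet> mat 1)) \<longlonglongrightarrow> \<epsilon> * ((V b - V a) \<bullet> mat 1)"
      by (intro tendsto_intros quad_sum_tendsto a0 b0)
    show "(\<lambda>n. \<bar>(\<Sum>i=1..lo n b. R n i) - (\<Sum>i=1..lo n a. R n i) - 1/2 * (l \<bullet> ?q n)\<bar>) \<longlonglongrightarrow>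
        \<bar>r b - r a - 1/2 * (l \<bullet> (V b - V a))\<bar>"
      by (intro tendsto_intros quad_sum_tendsto R_sum_lo a0 b0)
    \<comment> \<open>The last interval may reach beyond \<open>b\<close>; its right end is kept
      below \<open>a + \<eta>1\<close>, where \<open>x\<close> is still within
      \<open>\<delta> / 2\<close> of \<open>x a\<close>.\<close>
    have "\<forall>\<^sub>F n in sequentially. \<forall>i<kk n. min (tp n (Suc i)) (a + \<eta>1) - min (tp n i) (a + \<eta>1) < a + \<eta>1 - b"
      using b by (intro eventually_mesh) (auto simp: \<eta>_def)
    with \<omega>(2) eventually_lo_const[OF a0] eventually_lo_const[OF b0] eventually_ge_at_top[of N]
    show "\<forall>\<^sub>F n in sequentially. \<bar>(\<Sum>i=1..lo n b. R n i) - (\<Sum>i=1..lo n a. R n i) - 1/2 * (l \<bullet> ?q n)\<bar> \<le> \<epsilon> * (?q n \<bullet> mat 1)"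
    proof eventually_elim
      case (elim n)
      define A where "A = {lo n a<..lo n b}"
      have le: "lo n a \<le> lo n b"
      proof -
        have "tp n (lo n a) < tp n (Suc (lo n b))" using elim b by linarith
        then show ?thesis using tp_less_iff[of "lo n a" n "Suc (lo n b)"] elim by simp
      qed
      have S1: "(\<Sum>i=1..lo n b. R n i) - (\<Sum>i=1..lo n a. R n i) = (\<Sum>i\<in>A. R n i)"
      proof -
        have "{1..lo n b} = {1..lo n a} \<union> A" using le by (auto simp: A_def)
        then show ?thesis by (simp add: sum.union_disjoint disjoint_iff A_def)
      qed
      have S2: "?q n = (\<Sum>i\<in>A. outer (dx x n i))"
      proof -
        have "{..<Suc (lo n b)} = {..<Suc (lo n a)} \<union> A" using le by (auto simp: A_def)
        moreover have "quad_sum \<pi> x n b = (\<Sum>i<Suc (lo n b). outer (dx x n i))"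
          "quad_sum \<pi> x n a = (\<Sum>i<Suc (lo n a). outer (dx x n i))"
          by (intro quad_sum_lo; use elim in blast)+
        ultimately show ?thesis by (simp add: sum.union_disjoint disjoint_iff A_def del: sum.lessThan_Suc)
      qed
      \<comment> \<open>One \<open>\<epsilon> / 2\<close> comes from the modulus, the other from
        half the deviation of \<open>Hn\<close> from \<open>l\<close>.\<close>
      have est: "\<bar>R n i - 1/2 * (l \<bullet> outer (dx x n i))\<bar> \<le> \<epsilon> * (norm (dx x n i))\<^sup>2" if i: "i \<in> A" for i
      proof -
        have i': "0 < i" "i < kk n" "Suc (lo n a) \<le> i" "i \<le> lo n b" using i elim by (auto simp: A_def)
        have "tp n (Suc (lo n a)) \<le> tp n i" "tp n i \<le> tp n (lo n b)" using i' elim by (auto intro!: tp_le)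
        then have ti: "a < tp n i" "tp n i \<le> b" using elim by auto
        have less: "tp n i < tp n (Suc i)" using i' by (intro tp_less) auto
        have "min (tp n (Suc i)) (a + \<eta>1) - min (tp n i) (a + \<eta>1) < a + \<eta>1 - b" using elim i' by blast
        then have ti': "tp n (Suc i) < a + \<eta>1" using ti b by (auto simp: \<eta>_def min_def split: if_splits)
        have "norm (x (tp n (Suc i)) - x a) < \<delta> / 2" "norm (x (tp n i) - x a) < \<delta> / 2"
          by (intro \<eta>1(2); use ti ti' less in linarith)+
        then have d: "norm (dx x n i) < \<delta>"
          unfolding dx_def using norm_triangle_ineq4[of "x (tp n (Suc i)) - x a" "x (tp n i) - x a"] by simp
        have 1: "\<bar>R n i - 1/2 * (Hn n (tp n i) \<bullet> outer (dx x n i))\<bar> \<le> \<epsilon> / 2 * (norm (dx x n i))\<^sup>2"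
        proof -
          have "\<bar>R n i - 1/2 * (Hn n (tp n i) \<bullet> outer (dx x n i))\<bar> \<le> \<omega> (norm (dx x n i)) * (norm (dx x n i))\<^sup>2"
            using elim(1) i' ti b by (auto simp: \<eta>_def)
          also have "\<dots> \<le> \<epsilon> / 2 * (norm (dx x n i))\<^sup>2"
            using \<delta>(2)[OF _ d] by (cases "dx x n i = 0") (auto intro!: mult_right_mono)
          finally show ?thesis .
        qed
        have "norm (Hn n (tp n i) - l) \<le> \<epsilon>"
        proof -
          have "\<eta> \<le> \<eta>2" by (simp add: \<eta>_def)
          then have "\<bar>tp n i - a\<bar> < \<eta>2" using ti b by linarith
          then show ?thesis using \<eta>2(2)[of n "tp n i"] elim by (simp add: dist_norm)
        qed
        then have "\<bar>(Hn n (tp n i) - l) \<bullet> outer (dx x n i)\<bar> \<le> \<epsilon> * (norm (dx x n i))\<^sup>2"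
          using Cauchy_Schwarz_ineq2[of "Hn n (tp n i) - l" "outer (dx x n i)"]
            mult_right_mono[of "norm (Hn n (tp n i) - l)" \<epsilon> "(norm (dx x n i))\<^sup>2"] by (simp add: norm_outer)
        moreover have "R n i - 1/2 * (l \<bullet> outer (dx x n i)) = (R n i - 1/2 * (Hn n (tp n i) \<bullet> outer (dx x n i))) +
            1/2 * ((Hn n (tp n i) - l) \<bullet> outer (dx x n i))" by (simp add: inner_diff_left diff_divide_distrib)
        ultimately show ?thesis using 1 by linarith
      qed
      have "(\<Sum>i\<in>A. R n i) - 1/2 * (l \<bullet> ?q n) = (\<Sum>i\<in>A. R n i - 1/2 * (l \<bullet> outer (dx x n i)))"
        unfolding S2 by (simp add: inner_sum_right sum_distrib_left sum_subtractf)
      then have "\<bar>(\<Sum>i\<in>A. R n i) - 1/2 * (l \<bullet> ?q n)\<bar> \<le> (\<Sum>i\<in>A. \<epsilon> * (norm (dx x n i))\<^sup>2)"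
        using order_trans[OF sum_abs sum_mono[OF est]] by simp
      also have "\<dots> = \<epsilon> * (?q n \<bullet> mat 1)"
        unfolding S2 by (simp add: inner_sum_left outer_inner_mat_1 sum_distrib_left)
      finally show ?case unfolding S1 .
    qed
  qed simp
  moreover have "\<eta> > 0" using \<eta>1(1) \<eta>2(1) by (simp add: \<eta>_def)
  ultimately show ?thesis by blast
qed

lemma r_right_deriv:
  assumes a: "a > 0" "jump x a = 0" and H: "\<And>u. u \<longlonglongrightarrow> a \<Longrightarrow> (\<lambda>n. Hn n (u n)) \<longlonglongrightarrow> l"
    and V: "(V has_vector_derivative v) (at_right a)"
  shows "(r has_vector_derivative 1/2 * (l \<bullet> v)) (at_right a)"
proof -
  let ?Q = "\<lambda>b. (1 / (b - a)) *\<^sub>R (V b - V a)"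
  have Q: "(?Q \<longlongrightarrow> v) (at_right a)"
  proof (rule LIM_zero_cancel, rule tendsto_norm_zero_cancel)
    have "((\<lambda>b. norm (V b - V a - (b - a) *\<^sub>R v) / norm (b - a)) \<longlongrightarrow> 0) (at_right a)"
      using V unfolding has_vector_derivative_def has_derivative_iff_norm by blast
    moreover have "\<forall>\<^sub>F b in at_right a. norm (V b - V a - (b - a) *\<^sub>R v) / norm (b - a) = norm (?Q b - v)"
      using eventually_at_right_less[of a]
    proof eventually_elim
      case (elim b)
      then have "?Q b - v = (1 / (b - a)) *\<^sub>R (V b - V a - (b - a) *\<^sub>R v)"
        by (simp add: scaleR_diff_right)
      then show ?case using elim by simp
    qed
    ultimately show "((\<lambda>b. norm (?Q b - v)) \<longlongrightarrow> 0) (at_right a)" by (rule Lim_transform_eventually)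
  qed
  have "((\<lambda>b. (r b - r a) / (b - a) - 1/2 * (l \<bullet> ?Q b)) \<longlongrightarrow> 0) (at_right a)"
  proof (rule tendstoI)
    fix e :: real assume e: "e > 0"
    \<comment> \<open>Bounds the trace of the difference quotients of \<open>V\<close> near
      \<open>a\<close>, so that the relative error \<open>e / (2 * K)\<close> contributes less than
      \<open>e\<close>.\<close>
    define K where "K = \<bar>v \<bullet> mat 1\<bar> + 1"
    have K: "K > 0" by (simp add: K_def)
    obtain \<eta> where \<eta>: "\<eta> > 0" "\<And>b. a < b \<Longrightarrow> b < a + \<eta> \<Longrightarrow>
        \<bar>r b - r a - 1/2 * (l \<bullet> (V b - V a))\<bar> \<le> e / (2 * K) * ((V b - V a) \<bullet> mat 1)"
      using r_local[OF a H, of "e / (2 * K)"] e K by auto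
    have "((\<lambda>b. ?Q b \<bullet> mat 1) \<longlongrightarrow> v \<bullet> mat 1) (at_right a)" by (intro tendsto_intros Q)
    then have "\<forall>\<^sub>F b in at_right a. ?Q b \<bullet> mat 1 < K" by (rule order_tendstoD(2)) (auto simp: K_def)
    moreover have "\<forall>\<^sub>F b in at_right a. b \<in> {a<..<a + \<eta>}" using \<eta>(1) by (intro eventually_at_right_real) simp
    ultimately show "\<forall>\<^sub>F b in at_right a. dist ((r b - r a) / (b - a) - 1/2 * (l \<bullet> ?Q b)) 0 < e"
    proof eventually_elim
      case (elim b)
      then have ba: "b - a > 0" by simp
      have "(r b - r a) / (b - a) - 1/2 * (l \<bullet> ?Q b) = (r b - r a - 1/2 * (l \<bullet> (V b - V a))) / (b - a)"
        unfolding inner_scaleR_right by (simp add: diff_divide_distrib)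
      then have "\<bar>(r b - r a) / (b - a) - 1/2 * (l \<bullet> ?Q b)\<bar> = \<bar>r b - r a - 1/2 * (l \<bullet> (V b - V a))\<bar> / (b - a)"
        using ba by simp
      also have "\<dots> \<le> e / (2 * K) * ((V b - V a) \<bullet> mat 1) / (b - a)"
        using elim ba \<eta>(2)[of b] by (intro divide_right_mono) auto
      also have "\<dots> = e / (2 * K) * (?Q b \<bullet> mat 1)" using ba by simp
      also have "\<dots> \<le> e / (2 * K) * K" using elim e K by (intro mult_left_mono) auto
      also have "\<dots> < e" using e K by simp
      finally show ?case by simp
    qed
  qed
  moreover have "((\<lambda>b. 1/2 * (l \<bullet> ?Q b)) \<longlongrightarrow> 1/2 * (l \<bullet> v)) (at_right a)" by (intro tendsto_intros Q)
  ultimately have "((\<lambda>b. (r b - r a) / (b - a) - 1/2 * (l \<bullet> ?Q b) + 1/2 * (l \<bullet> ?Q b)) \<longlongrightarrow> 0 + 1/2 * (l \<bullet> v)) (at_right a)"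
    by (rule tendsto_add)
  then show ?thesis
    by (simp add: has_real_derivative_iff_has_vector_derivative[symmetric] has_field_derivative_iff)
qed

lemma continuous_on_path:
  fixes G :: "real \<Rightarrow> 'm path \<Rightarrow> 'b::topological_space"
  assumes G: "continuous_fun \<pi> \<Omega> G" and no_jump: "\<And>s. s > 0 \<Longrightarrow> jump x s = 0"
  shows "continuous_on {0..T} (\<lambda>s. G s (stop s x))"
  unfolding continuous_on_eq_continuous_within
proof
  fix s assume s: "s \<in> {0..T}"
  have right: "((\<lambda>u. G u (stop u x)) \<longlongrightarrow> G s (stop s x)) (at_right s)"
    using G s x_in unfolding continuous_fun_def by (auto intro: right_contD(1))
  show "continuous (at s within {0..T}) (\<lambda>s. G s (stop s x))"
  proof (cases "s = 0")
    case True
    have "at s within {0..T} \<le> at_right s"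
      unfolding at_within_atLeast[symmetric] by (rule at_le) (use True in auto)
    then show ?thesis using right unfolding continuous_within by (blast intro: tendsto_mono)
  next
    case False
    then have s0: "0 < s" using s by auto
    have "((\<lambda>u. G u (stop u x)) \<longlongrightarrow> G s (stop_left s x)) (at s within {0..<s})"
      using G s x_in unfolding continuous_fun_def by (auto intro: left_contD(1))
    moreover have "at s within {0..<s} = at_left s"
      using s0 by (intro at_within_nhd[where S = "{0<..}"]) auto
    moreover have "stop_left s x = stop s x" using no_jump[OF s0] by (simp add: stop_left_eq_bump)
    ultimately have "((\<lambda>u. G u (stop u x)) \<longlongrightarrow> G s (stop s x)) (at_left s)" by simp
    then have "isCont (\<lambda>u. G u (stop u x)) s" using right unfolding isCont_def by (simp add: filterlim_split_at)
    then show ?thesis by (rule continuous_at_imp_continuous_at_within)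
  qed
qed

lemma F_eq_integral:
  assumes \<sigma>: "\<And>t. t \<ge> 0 \<Longrightarrow> \<sigma> integrable_on {0..t}"
    "\<And>t. t \<ge> 0 \<Longrightarrow> V t = integral {0..t} \<sigma>"
    "\<And>t. t \<ge> 0 \<Longrightarrow> (\<sigma> \<longlongrightarrow> \<sigma> t) (at_right t)"
    and harm: "\<And>t. t \<ge> 0 \<Longrightarrow> h t + 1/2 * (vert_hess F t (stop t x) \<bullet> \<sigma> t) = 0"
    and t: "t \<ge> 0"
  shows "F t (stop t x) = F 0 (stop 0 x) + I x t"
proof -
  \<comment> \<open>An indefinite integral is continuous, so \<open>V\<close> has no jumps; the jump
    of \<open>V\<close> is the squared jump of \<open>x\<close>, hence \<open>x\<close> has none at
    positive times.\<close>
  have no_jump: "jump x s = 0" if s: "s > 0" for s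
  proof -
    have "continuous_on {0..s} (\<lambda>u. integral {0..u} \<sigma>)"
      using s by (intro indefinite_integral_continuous_1 \<sigma>) auto
    then have "((\<lambda>u. integral {0..u} \<sigma>) \<longlongrightarrow> V s) (at_left s)"
      using s \<sigma>(2)[of s] bspec[of "{0..s}" _ s] unfolding continuous_on_def at_within_Icc_at_left[OF s, symmetric]
      by simp
    moreover have "\<forall>\<^sub>F u in at_left s. integral {0..u} \<sigma> = V u"
      using eventually_at_left_real[OF s] by eventually_elim (use \<sigma>(2) in auto)
    ultimately have "(V \<longlongrightarrow> V s) (at_left s)" by (rule Lim_transform_eventually)
    then have "left_lim V s = V s" by (rule left_lim_eqI[OF s])
    then have "outer (jump x s) = 0" using jump_V[OF s] by simp
    then show ?thesis by simp
  qed
  obtain D where D: "countable D" "\<And>u s. s > 0 \<Longrightarrow> s \<notin> D \<Longrightarrow> u \<longlonglongrightarrow> s \<Longrightarrow>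
      (\<lambda>n. Hn n (u n)) \<longlonglongrightarrow> vert_hess F s (stop_left s x)"
    by (rule left_limits_imp_limits_off_countable[of "last_before \<pi>" Hn "\<lambda>s. vert_hess F s (stop_left s x)",
        OF last_before_tendsto[OF less_imp_le] last_before_nonneg Hn_left]) (assumption+, rule that)
  \<comment> \<open>By the formula for \<open>m\<close>, this is \<open>F - Mf\<close> along the
    path: the difference supplies continuity, the integral and \<open>r\<close> supply the right
    derivative.\<close>
  define G where "G s = integral {0..s} h + r s" for s
  have G_eq: "G s = F s (stop s x) - Mf s (stop s x)" if "s \<ge> 0" for s
    using m_eq_I[OF that] Mf_stop[OF x_in that] by (simp add: G_def m_def)
  have "continuous_on {0..t} (\<lambda>s. F s (stop s x) - Mf s (stop s x))"
    using F_left F_right by (intro continuous_on_diff continuous_on_path Mf_continuous no_jump)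
      (auto simp: continuous_fun_def)
  then have cont: "continuous_on {0..t} G"
    by (rule continuous_on_eq) (use G_eq in auto)
  have "G t = G 0"
  proof (rule right_deriv_zero_imp_const[OF t cont])
    \<comment> \<open>Time 0 joins the exceptional set because the local expansion of
      \<open>r\<close> is available at positive times.\<close>
    show "countable (insert 0 D)" using D(1) by simp
    fix s assume s: "s \<in> {0..<t} - insert 0 D"
    then have s0: "s > 0" by auto
    have "((\<lambda>u. integral {0..u} \<sigma>) has_vector_derivative \<sigma> s) (at_right s)"
      using s0 by (intro integral_right_deriv[where T = "s + 1"] \<sigma>) auto
    then have "(V has_vector_derivative \<sigma> s) (at_right s)"
      unfolding at_within_atLeast[symmetric]
      by (rule has_vector_derivative_transform[rotated 2]) (use s0 \<sigma>(2) in auto)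
    then have "(r has_vector_derivative 1/2 * (vert_hess F s (stop_left s x) \<bullet> \<sigma> s)) (at_right s)"
      using s s0 by (intro r_right_deriv no_jump D(2)) auto
    moreover have "((\<lambda>u. integral {0..u} h) has_vector_derivative h s) (at_right s)"
      using s0 by (intro integral_right_deriv[where T = "s + 1"] h_integrable h_right) auto
    moreover have "stop_left s x = stop s x" using no_jump[OF s0] by (simp add: stop_left_eq_bump)
    ultimately have "(G has_vector_derivative h s + 1/2 * (vert_hess F s (stop s x) \<bullet> \<sigma> s)) (at_right s)"
      unfolding G_def[abs_def] by (auto intro: has_vector_derivative_add)
    then show "(G has_vector_derivative 0) (at_right s)" using harm s0 by simp
  qed
  moreover have "G 0 = 0" using G_eq[of 0] Mf_stop[OF x_in, of 0] by (simp add: I_0)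
  ultimately show ?thesis using G_eq[OF t] Mf_stop[OF x_in t] by simp
qed

end

section \<open>Identification with the pathwise integral\<close>

context ito_setting
begin

text \<open>The Riemann sums exceed \<open>gsum\<close> by the term of index 0, in which the
  gradient converges and the increment tends to 0.\<close>

lemma grad_sum_tendsto:
  assumes x: "x \<in> \<Omega>" and t: "t \<ge> 0"
  shows "grad_sum \<pi> F x t \<longlonglongrightarrow> I x t"
proof -
  obtain V where "ito_path \<pi> \<Omega> \<U> F x V" using x by (rule ito_pathI)
  then interpret ito_path \<pi> \<Omega> \<U> F x V .
  have kk: "\<forall>\<^sub>F n in sequentially. 0 < kk n"
    by (rule eventually_kk_pos)
  have "(\<lambda>n. dx x n 0) \<longlonglongrightarrow> 0" using dx_right[of "\<lambda>_. 0" 0] kk by simp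
  moreover have "(\<lambda>n. pre (vert_grad F) 0 (stop_left 0 (pw_const \<pi> n x))) \<longlonglongrightarrow> pre (vert_grad F) 0 (stop_left 0 x)"
    by (rule left_contD(2)[OF grad_left x]) auto
  ultimately have "(\<lambda>n. pre (vert_grad F) 0 (stop_left 0 (pw_const \<pi> n x)) \<bullet> dx x n 0) \<longlonglongrightarrow> pre (vert_grad F) 0 (stop_left 0 x) \<bullet> 0"
    by (intro tendsto_inner)
  then have "(\<lambda>n. gterm x n 0) \<longlonglongrightarrow> 0" by (simp add: gterm_def pre_def)
  from tendsto_add[OF this gsum_lo[OF x t]] have "(\<lambda>n. gterm x n 0 + gsum x n (lo n t)) \<longlonglongrightarrow> I x t" by simp
  then show ?thesis
  proof (rule Lim_transform_eventually)
    show "\<forall>\<^sub>F n in sequentially. gterm x n 0 + gsum x n (lo n t) = grad_sum \<pi> F x t n"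
      using eventually_lo_const[OF t]
    proof eventually_elim
      case (elim n)
      have "{i. i < kk n \<and> tp n i \<le> t} = insert 0 {1..lo n t}"
      proof (intro set_eqI iffI)
        fix i assume i: "i \<in> {i. i < kk n \<and> tp n i \<le> t}"
        then have "tp n i < tp n (Suc (lo n t))" using elim by auto
        then show "i \<in> insert 0 {1..lo n t}" using i elim tp_less_iff[of i n "Suc (lo n t)"] by auto
      next
        fix i assume i: "i \<in> insert 0 {1..lo n t}"
        then have "tp n i \<le> tp n (lo n t)" using elim by (intro tp_le) auto
        then show "i \<in> {i. i < kk n \<and> tp n i \<le> t}" using i elim by auto
      qed
      then have "grad_sum \<pi> F x t n = (\<Sum>i\<in>insert 0 {1..lo n t}. gterm x n i)"
        by (simp add: grad_sum_def gterm_def dx_def tp_def kk_def)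
      then show ?case by (simp add: gsum_def)
    qed
  qed
qed

lemma harmonic_F_eq:
  assumes \<Sigma>: "right_cont \<pi> \<Omega> \<Sigma>" and harm: "harmonic \<pi> \<Omega> \<Sigma> F"
    and x: "x \<in> Omega_Sigma \<pi> \<Omega> \<Sigma>" and t: "t \<ge> 0"
  shows "F t (stop t x) = F 0 (stop 0 x) + I x t"
proof -
  have x_in: "x \<in> \<Omega>" using x by (simp add: Omega_Sigma_def)
  obtain V where "ito_path \<pi> \<Omega> \<U> F x V" using x_in by (rule ito_pathI)
  then interpret ito_path \<pi> \<Omega> \<U> F x V .
  define \<sigma> where "\<sigma> s = \<Sigma> s (stop s x)" for s
  \<comment> \<open>\<open>V 0 = 0\<close> disposes of the initial value subtracted in
    \<open>Omega_Sigma\<close>.\<close>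
  have int: "set_integrable lebesgue {0..s} \<sigma>" "V s = (LINT u:{0..s}|lebesgue. \<sigma> u)" if "s \<ge> 0" for s
    using x that V_0 unfolding Omega_Sigma_def \<sigma>_def by (auto simp: quad_var_eq)
  show ?thesis
  proof (rule F_eq_integral[of \<sigma>])
    show "\<sigma> integrable_on {0..s}" "V s = integral {0..s} \<sigma>" if "s \<ge> 0" for s
      using int[OF that] set_lebesgue_integral_eq_integral[OF int(1)[OF that]] by simp_all
    show "(\<sigma> \<longlongrightarrow> \<sigma> s) (at_right s)" if "s \<ge> 0" for s
      unfolding \<sigma>_def by (rule right_contD(1)[OF \<Sigma> x_in that])
    show "h s + 1/2 * (vert_hess F s (stop s x) \<bullet> \<sigma> s) = 0" if "s \<ge> 0" for s
      using harm x that unfolding harmonic_def h_def \<sigma>_def by blast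
  qed (rule t)
qed

end

theorem theorem6p7:
  fixes \<pi> :: "nat \<Rightarrow> real list"
    and \<Omega> :: "(real \<Rightarrow> real ^ 'm::finite) set"
    and \<U> :: "real \<Rightarrow> (real \<Rightarrow> real ^ 'm) \<Rightarrow> (real ^ 'm) set"
    and \<Sigma> :: "real \<Rightarrow> (real \<Rightarrow> real ^ 'm) \<Rightarrow> real ^ 'm ^ 'm"
    and F :: "real \<Rightarrow> (real \<Rightarrow> real ^ 'm) \<Rightarrow> real"
  assumes "partition_seq \<pi>"
    and "generic \<pi> \<Omega>" and "\<Omega> \<subseteq> Q_paths \<pi>"
    and "jump_nbhds \<Omega> \<U>"
    and "\<forall>(t, y) \<in> Lam \<Omega>. \<Sigma> t y \<in> pos_def_sym" and "right_cont \<pi> \<Omega> \<Sigma>"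
    and "C12 \<pi> \<Omega> \<U> F" and "harmonic \<pi> \<Omega> \<Sigma> F"
  shows "(\<exists>M. class_M \<pi> \<Omega> M \<and>
            (\<forall>x \<in> Omega_Sigma \<pi> \<Omega> \<Sigma>. \<forall>t\<ge>0. M t (stop t x) = F t (stop t x))) \<and>
         (\<forall>M. class_M \<pi> \<Omega> M \<longrightarrow>
            (\<forall>x \<in> Omega_Sigma \<pi> \<Omega> \<Sigma>. \<forall>t\<ge>0. M t (stop t x) = F t (stop t x)) \<longrightarrow>
            (\<forall>x \<in> Omega_Sigma \<pi> \<Omega> \<Sigma>. \<forall>t\<ge>0.
               convergent (grad_sum \<pi> F x t) \<and>
               M t (stop t x) = F t (stop t x) \<and>
               F t (stop t x) = F 0 (stop 0 x) + grad_integral \<pi> F x t))"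
proof -
  interpret ito_setting \<pi> \<Omega> \<U> F
    using assms by unfold_locales
  note F_eq = harmonic_F_eq[OF assms(6,8)]
  have \<Omega>: "x \<in> \<Omega>" if "x \<in> Omega_Sigma \<pi> \<Omega> \<Sigma>" for x
    using that by (simp add: Omega_Sigma_def)
  have "Mf t (stop t x) = F t (stop t x)" if "x \<in> Omega_Sigma \<pi> \<Omega> \<Sigma>" "t \<ge> 0" for x t
    using F_eq[OF that] Mf_stop[OF \<Omega> that(2)] that by simp
  moreover have "convergent (grad_sum \<pi> F x t)" "F t (stop t x) = F 0 (stop 0 x) + grad_integral \<pi> F x t"
    if "x \<in> Omega_Sigma \<pi> \<Omega> \<Sigma>" "t \<ge> 0" for x t
    using F_eq[OF that] grad_sum_tendsto[OF \<Omega>[OF that(1)] that(2)]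
    by (auto simp: grad_integral_def limI intro: convergentI)
  ultimately show ?thesis using Mf_class_M by blast
qed

end
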